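(* Let $a,\beta,c,x>0$. Let $X_1,Y_1$ be non-negative random variables, not almost surely zero, and let $p_\infty(\cdot,\cdot)$, $p_\beta(\cdot,\cdot)$, $q_r$ be defined from their distributions (and $\beta$) as in the context; $a_i=\mathbf{E}X_1^i$, $b_j=\mathbf{E}Y_1^j$. (i) Assume that $\mathbf{E}X_1^2<\infty$ and $Y_1\in\mathcal{P}_{c,\varkappa}$ for some $\varkappa>2$. Then for $k_1,k_2\to+\infty$, $$p_\infty(k_1,k_2)=(1+o(1))\,c^2a_2^{2\varkappa-4}b_1^{2\varkappa-6}(k_1k_2)^{1-\varkappa}.$$ (ii) Assume that $\mathbf{E}e^{aY_1}<\infty$ and $X_1\in\mathcal{P}_{c,\varkappa}$ for some $\varkappa>3$. Let $k_1,k_2\to+\infty$ so that $k_1\le k_2$. Suppose that either $k_2-k_1\to+\infty$ or $k_2-k_1=k$ for an arbitrary but fixed integer $k\ge0$. Then $$p_\beta(k_1,k_2)=(1+o(1))\frac{\beta}{b_1^4a_2}\times\begin{cases} b_1c_1^*c_2^*\,k_1^{2-\varkappa}(k_2-k_1)^{1-\varkappa} & \text{if } k_2-k_1\to+\infty,\\ c_1^*c_{3,k}^*\,k_1^{2-\varkappa} & \text{if } k_2-k_1=k,\end{cases}$$ where $c_1^*=c(b_1\beta^{-1/2})^{\varkappa-1}$, $c_2^*=cb_1^{\varkappa-2}b_2\beta^{(3-\varkappa)/2}$ and $c_{3,k}^*=\sum_{i\ge0}q_iq_{k+i}$. Furthermore, $q_r/(c_2^*r^{1-\varkappa})\to1$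 as $r\to+\infty$. (iii) Assume that $\mathbf{P}(X_1=x)=1$ and $Y_1\in\mathcal{P}_{c,\varkappa}$ for some $\varkappa>2$. Then for $k_1,k_2\to+\infty$, $$p_\beta(k_1,k_2)=(1+o(1))\,c^2x^{4\varkappa-8}b_1^{2\varkappa-6}(k_1k_2)^{1-\varkappa}.$$
   Context: Power law property. For $c>0$, $\varkappa>1$, a non-negative random variable $Z$ has property $\mathcal{P}_{c,\varkappa}$ (written $Z\in\mathcal{P}_{c,\varkappa}$) if either $Z$ is integer valued and $\mathbf{P}(Z=r)/(cr^{-\varkappa})\to1$ as $r\to+\infty$, or $Z$ is absolutely continuous with a density $f_Z$ satisfying $f_Z(t)=(c+o(1))t^{-\varkappa}$ as $t\to+\infty$. Notation. $X_1,Y_1$ are independent non-negative random variables, $a_i=\mathbf{E}X_1^i$, $b_j=\mathbf{E}Y_1^j$, $\beta>0$. $\Lambda_0,\Lambda_1,\Lambda_3$ are mixed Poisson: $\mathbf{P}(\Lambda_i=r)=\mathbf{E}\bigl(e^{-\lambda_i}\lambda_i^r/r!\bigr)$, $r=0,1,\dots$, with $\lambda_0=X_1b_1\beta^{-1/2}$, $\lambda_1=Y_1a_1\beta^{1/2}$, $\lambda_3=Y_1a_2b_1$ (conditionally on $Y_1$, $\Lambda_1$ is Poisson with mean $\lambda_1$). $\tau_1,\tau_2,\dots$ are i.i.d., independent of $(Y_1,\Lambda_1)$, with $\mathbf{P}(\tau_1=r)=\frac{r+1}{\mathbf{E}\Lambda_0}\mathbf{P}(\Lambda_0=r+1)$,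 $r=0,1,\dots$. $d_*=\sum_{j=1}^{\Lambda_1}\tau_j$. For integers $r,k_1,k_2\ge0$: $$q_r=\mathbf{E}\bigl(Y_1\mathbf{P}(d_*=r\mid Y_1)\bigr),\qquad p_\beta(k_1,k_2)=\frac{\beta}{b_1^4a_2}\sum_{r=0}^{\min(k_1,k_2)}(r+1)(r+2)\mathbf{P}(\Lambda_0=r+2)\,q_{k_1-r}q_{k_2-r},$$ $$\tilde p(r)=\frac{r\,\mathbf{P}(\Lambda_3=r)}{\mathbf{E}\Lambda_3},\qquad p_\infty(k_1,k_2)=\tilde p(k_1+1)\tilde p(k_2+1).$$ *)

theory Defs
  imports "HOL-Probability.Probability" "HOL-Library.Landau_Symbols"
begin

definition power_law :: "'a measure \<Rightarrow> real \<Rightarrow> real \<Rightarrow> ('a \<Rightarrow> real) \<Rightarrow> bool" where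
  "power_law M c \<kappa> Z \<longleftrightarrow>
     ((AE \<omega> in M. Z \<omega> \<in> \<int>) \<and>
       (\<lambda>r::nat. measure M {\<omega> \<in> space M. Z \<omega> = real r} / (c * real r powr (-\<kappa>))) \<longlonglongrightarrow> 1)
   \<or> (\<exists>f :: real \<Rightarrow> real. (\<forall>t. 0 \<le> f t) \<and> distributed M lborel Z (\<lambda>t. ennreal (f t)) \<and>
       ((\<lambda>t. f t / t powr (-\<kappa>)) \<longlongrightarrow> c) at_top)"

definition moment :: "'a measure \<Rightarrow> ('a \<Rightarrow> real) \<Rightarrow> nat \<Rightarrow> real" where
  "moment M Z i = (\<integral>\<omega>. Z \<omega> ^ i \<partial>M)"

text \<open>Probability mass function of a random variable with values in the natural numbers.\<close>

definition rv_pmf :: "'a measure \<Rightarrow> ('a \<Rightarrow> nat) \<Rightarrow> nat \<Rightarrow> real" where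
  "rv_pmf M L r = measure M {\<omega> \<in> space M. L \<omega> = r}"

definition mean :: "'a measure \<Rightarrow> ('a \<Rightarrow> nat) \<Rightarrow> real" where
  "mean M L = (\<integral>\<omega>. real (L \<omega>) \<partial>M)"

text \<open>The conditional probability \<open>P(L = r | Y)\<close>, as a random variable: the conditional
  expectation of the indicator of the event given the sigma-algebra generated by \<open>Y\<close>.\<close>

definition cond_pmf :: "'a measure \<Rightarrow> ('a \<Rightarrow> real) \<Rightarrow> ('a \<Rightarrow> nat) \<Rightarrow> nat \<Rightarrow> 'a \<Rightarrow> real" where
  "cond_pmf M Y L r =
     real_cond_exp M (vimage_algebra (space M) Y borel) (indicator {\<omega> \<in> space M. L \<omega> = r})"

text \<open>Unlike \<^const>\<open>poisson_pmf\<close>, this allows the rate 0 (point mass at 0, since \<open>0 ^ 0 = 1\<close>).\<close>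

definition poisson_prob :: "real \<Rightarrow> nat \<Rightarrow> real" where
  "poisson_prob l r = exp (-l) * l ^ r / fact r"

definition mixed_poisson :: "'a measure \<Rightarrow> ('a \<Rightarrow> real) \<Rightarrow> ('a \<Rightarrow> nat) \<Rightarrow> bool" where
  "mixed_poisson M l L \<longleftrightarrow>
     L \<in> measurable M (count_space UNIV) \<and>
     (\<forall>r. rv_pmf M L r = (\<integral>\<omega>. poisson_prob (l \<omega>) r \<partial>M))"

text \<open>Conditionally on \<open>Y\<close>, the variable \<open>L\<close> is Poisson with mean \<open>g Y\<close>. Taking expectations
  shows that \<open>L\<close> is then also mixed Poisson in the (unconditional) sense above.\<close>

definition cond_poisson ::
  "'a measure \<Rightarrow> ('a \<Rightarrow> real) \<Rightarrow> (real \<Rightarrow> real) \<Rightarrow> ('a \<Rightarrow> nat) \<Rightarrow> bool" where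
  "cond_poisson M Y g L \<longleftrightarrow>
     L \<in> measurable M (count_space UNIV) \<and>
     (\<forall>r. AE \<omega> in M. cond_pmf M Y L r \<omega> = poisson_prob (g (Y \<omega>)) r)"

text \<open>Independence of two random variables whose value types may differ
  (which \<^const>\<open>prob_space.indep_var\<close> does not permit): independence of the generated sigma-algebras.\<close>

definition indep_rv ::
  "'a measure \<Rightarrow> 'b measure \<Rightarrow> ('a \<Rightarrow> 'b) \<Rightarrow> 'c measure \<Rightarrow> ('a \<Rightarrow> 'c) \<Rightarrow> bool" where
  "indep_rv M S U T V \<longleftrightarrow>
     U \<in> measurable M S \<and> V \<in> measurable M T \<and>
     prob_space.indep_set M (sets (vimage_algebra (space M) U S)) (sets (vimage_algebra (space M) V T))"

definition random_sum :: "('a \<Rightarrow> nat) \<Rightarrow> (nat \<Rightarrow> 'a \<Rightarrow> nat) \<Rightarrow> 'a \<Rightarrow> nat" where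
  "random_sum N \<tau> \<omega> = (\<Sum>j=1..N \<omega>. \<tau> j \<omega>)"

definition q :: "'a measure \<Rightarrow> ('a \<Rightarrow> real) \<Rightarrow> ('a \<Rightarrow> nat) \<Rightarrow> nat \<Rightarrow> real" where
  "q M Y d r = (\<integral>\<omega>. Y \<omega> * cond_pmf M Y d r \<omega> \<partial>M)"

text \<open>In the following, \<open>L0\<close>, \<open>d\<close>, \<open>L3\<close> stand for the variables \<open>\<Lambda>\<^sub>0\<close>, \<open>d\<^sub>*\<close>, \<open>\<Lambda>\<^sub>3\<close>.\<close>

definition p_beta ::
  "'a measure \<Rightarrow> ('a \<Rightarrow> real) \<Rightarrow> ('a \<Rightarrow> real) \<Rightarrow> real \<Rightarrow> ('a \<Rightarrow> nat) \<Rightarrow> ('a \<Rightarrow> nat) \<Rightarrow> nat \<Rightarrow> nat \<Rightarrow> real"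
where
  "p_beta M X Y \<beta> L0 d k1 k2 =
     \<beta> / (moment M Y 1 ^ 4 * moment M X 2) *
     (\<Sum>r=0..min k1 k2.
        (real r + 1) * (real r + 2) * rv_pmf M L0 (r + 2) * q M Y d (k1 - r) * q M Y d (k2 - r))"

definition p_tilde :: "'a measure \<Rightarrow> ('a \<Rightarrow> nat) \<Rightarrow> nat \<Rightarrow> real" where
  "p_tilde M L3 r = real r * rv_pmf M L3 r / mean M L3"

definition p_infty :: "'a measure \<Rightarrow> ('a \<Rightarrow> nat) \<Rightarrow> nat \<Rightarrow> nat \<Rightarrow> real" where
  "p_infty M L3 k1 k2 = p_tilde M L3 (k1 + 1) * p_tilde M L3 (k2 + 1)"

text \<open>The filter on pairs \<open>(k1, k2)\<close> expressing that
  \<open>k1\<close> and \<open>k2\<close> tend to infinity in such a way that \<open>k1 \<le> k2\<close> and \<open>k2 - k1\<close> tends to infinity.\<close>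

definition far_apart :: "(nat \<times> nat) filter" where
  "far_apart = (at_top \<times>\<^sub>F at_top) \<sqinter> principal {(k1, k2). k1 \<le> k2}
                 \<sqinter> filtercomap (\<lambda>(k1, k2). k2 - k1) at_top"

end

theory Submission
  imports Defs "HOL-Real_Asymp.Real_Asymp"
begin

text \<open>The engine of all three parts is that a Poisson variable with a large rate \<open>u\<close> is concentrated near
\<open>u\<close> on the scale \<open>sqrt u\<close>, which is negligible on the scale of a power law. Mixing Poisson laws of rate
\<open>s Z\<close> over a variable \<open>Z\<close> with tail \<open>c t\<^sup>-\<^sup>\<kappa>\<close> therefore reproduces the tail, with the constant
\<open>c s\<^sup>\<kappa>\<^sup>-\<^sup>1\<close> coming from the change of scale (\<open>power_decay_mixed_poisson\<close>). When \<open>Z\<close> has a density, the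
mixture is compared with the integral of the pure power, which is a Gamma integral, and
\<open>\<Gamma>(r + 1 - \<kappa>) / r!\<close> is asymptotic to \<open>r\<^sup>-\<^sup>\<kappa>\<close>. When \<open>Z\<close> is integer valued, the sum over the lattice is
compared with the integral of a step density. The error is at most the integral of the absolute derivative
of the Poisson kernel in the rate; that derivative is a difference of consecutive Poisson probabilities, and
its smallness follows from the asymptotics already known for densities.

\<^emph>\<open>Heavy \<open>Y\<close>.\<close> The numbers defining \<open>p\<^sub>\<infinity>\<close> are size-biased probabilities of a Poisson mixture over \<open>Y\<close>,
so their asymptotics are immediate. For constant \<open>X\<close> the summands \<open>\<tau>\<close> are themselves Poisson, hence
\<open>q\<^sub>r\<close> is again a Poisson mixture of a power law, now over the lattice, and has a power-law tail. The
remaining factor in \<open>p\<^sub>\<beta>\<close> is a Poisson weight with a super-exponentially small tail, so the sum is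
carried by bounded indices and factorises into \<open>q\<^sub>k\<^sub>1 q\<^sub>k\<^sub>2\<close> (\<open>light_tail_convolution_product\<close>).

\<^emph>\<open>Heavy \<open>X\<close>.\<close> Now \<open>\<tau>\<close> has a power law with exponent \<open>\<kappa> - 1\<close>, and a sum of \<open>n\<close> copies is large
because one of them is: its probability mass function is asymptotic to \<open>n\<close> times that of \<open>\<tau>\<close>. A bound on
the convolution powers that is polynomial in \<open>n\<close> (\<open>fps_power_nth_le_power_law\<close>) and the
exponential moment of \<open>Y\<close> allow summation over \<open>n\<close>, which gives the tail of \<open>q\<close>
(\<open>power_decay_compound\<close>). In \<open>p\<^sub>\<beta>\<close> the factor \<open>(r+1)(r+2) P(\<Lambda>\<^sub>0 = r+2)\<close> has exponent \<open>\<kappa> - 2\<close>,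
smaller than the exponent \<open>\<kappa> - 1\<close> of \<open>q\<close>. So in the sum, written as a convolution over \<open>i = k\<^sub>1 - r\<close>,
the \<open>q\<close>-index \<open>i\<close> stays bounded: the heavy factor contributes \<open>k\<^sub>1\<^sup>2\<^sup>-\<^sup>\<kappa>\<close>, and what is left is the sum over
\<open>i\<close> of \<open>q\<^sub>i q\<^sub>i\<^sub>+\<^sub>m\<close> with \<open>m = k\<^sub>2 - k\<^sub>1\<close>. For fixed \<open>m\<close> this is a constant; for large \<open>m\<close> the
second factor is asymptotically \<open>c\<^sub>2\<^sup>* m\<^sup>1\<^sup>-\<^sup>\<kappa>\<close> and the first sums to \<open>b\<^sub>1\<close>. One statement, about
convolutions with a family depending on a parameter (\<open>convolution_light_family\<close>), covers both.\<close>

section \<open>Sequences with power-law decay\<close>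

text \<open>A limit rather than an asymptotic equivalence, so that \<open>A = 0\<close> is meaningful: it says that \<open>f\<close> is
negligible against \<open>r\<^sup>-\<^sup>\<alpha>\<close>, which is how the lighter of two tails enters a convolution.\<close>

definition power_decay :: "(nat \<Rightarrow> real) \<Rightarrow> real \<Rightarrow> real \<Rightarrow> bool" where
  "power_decay f \<alpha> A \<longleftrightarrow> (\<lambda>r. f r * real r powr \<alpha>) \<longlonglongrightarrow> A"

lemma power_decay_iff_Suc_powr:
  "power_decay f \<alpha> A \<longleftrightarrow> (\<lambda>r. f r * (real r + 1) powr \<alpha>) \<longlonglongrightarrow> A"
proof -
  have "(\<lambda>r. (real r + 1) powr \<alpha>) \<sim>[at_top] (\<lambda>r. real r powr \<alpha>)"
    by real_asymp
  then have "(\<lambda>r. f r * (real r + 1) powr \<alpha>) \<sim>[at_top] (\<lambda>r. f r * real r powr \<alpha>)"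
    by (intro asymp_equiv_mult) auto
  then show ?thesis
    unfolding power_decay_def using tendsto_asymp_equiv_cong by blast
qed

lemma power_decay_cong:
  assumes "eventually (\<lambda>r. f r = g r) at_top"
  shows "power_decay f \<alpha> A \<longleftrightarrow> power_decay g \<alpha> A"
  unfolding power_decay_def by (rule tendsto_cong) (use assms in eventually_elim, simp)

lemma power_decay_cmult:
  assumes "power_decay f \<alpha> A"
  shows "power_decay (\<lambda>r. b * f r) \<alpha> (b * A)"
  using tendsto_mult_left[OF assms[unfolded power_decay_def], of b]
  unfolding power_decay_def by (simp add: mult.assoc)

lemma power_decay_add:
  assumes "power_decay f \<alpha> A" "power_decay g \<alpha> B"
  shows "power_decay (\<lambda>r. f r + g r) \<alpha> (A + B)"
  using tendsto_add[OF assms[unfolded power_decay_def]]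
  unfolding power_decay_def by (simp add: distrib_right)

lemma power_decay_shift:
  "power_decay (\<lambda>r. f (r + k)) \<alpha> A \<longleftrightarrow> power_decay f \<alpha> A"
proof -
  have "(\<lambda>r. real r powr \<alpha>) \<sim>[at_top] (\<lambda>r. real (r + k) powr \<alpha>)"
    unfolding of_nat_add by real_asymp
  then have "(\<lambda>r. f (r + k) * real r powr \<alpha>) \<sim>[at_top] (\<lambda>r. f (r + k) * real (r + k) powr \<alpha>)"
    by (intro asymp_equiv_mult) auto
  then have "power_decay (\<lambda>r. f (r + k)) \<alpha> A \<longleftrightarrow> (\<lambda>r. f (r + k) * real (r + k) powr \<alpha>) \<longlonglongrightarrow> A"
    unfolding power_decay_def using tendsto_asymp_equiv_cong by blast
  then show ?thesis
    unfolding power_decay_def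
    using LIMSEQ_offset[of "\<lambda>r. f r * real r powr \<alpha>" k A]
      LIMSEQ_ignore_initial_segment[of "\<lambda>r. f r * real r powr \<alpha>" A k] by blast
qed

lemma power_decay_times:
  assumes "power_decay f \<alpha> A"
  shows "power_decay (\<lambda>r. (real r + b) * f r) (\<alpha> - 1) A"
proof -
  have "(\<lambda>r. (real r + b) * real r powr (\<alpha> - 1)) \<sim>[at_top] (\<lambda>r. real r powr \<alpha>)"
    by real_asymp
  then have "(\<lambda>r. f r * ((real r + b) * real r powr (\<alpha> - 1))) \<sim>[at_top] (\<lambda>r. f r * real r powr \<alpha>)"
    by (intro asymp_equiv_mult) auto
  then have "(\<lambda>r. f r * ((real r + b) * real r powr (\<alpha> - 1))) \<longlonglongrightarrow> A"
    using assms tendsto_asymp_equiv_cong unfolding power_decay_def by blast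
  then show ?thesis
    unfolding power_decay_def by (simp add: mult_ac)
qed

lemma power_decay_bound:
  assumes "power_decay f \<alpha> A"
  obtains C where "C > 0" "\<And>r. \<bar>f r\<bar> \<le> C * (real r + 1) powr (-\<alpha>)"
proof -
  have "Bseq (\<lambda>r. f r * (real r + 1) powr \<alpha>)"
    using assms convergentI convergent_imp_Bseq unfolding power_decay_iff_Suc_powr by blast
  then obtain C where C: "C > 0" "\<And>r. \<bar>f r * (real r + 1) powr \<alpha>\<bar> \<le> C"
    unfolding Bseq_def real_norm_def by blast
  have "\<bar>f r\<bar> \<le> C * (real r + 1) powr (-\<alpha>)" for r
    using C(2)[of r] by (simp add: abs_mult powr_minus_divide pos_le_divide_eq)
  then show thesis by (rule that[OF C(1)])
qed

lemma power_decay_summable: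
  assumes "power_decay f \<alpha> A" "\<alpha> > 1"
  shows "summable (\<lambda>r. \<bar>f r\<bar>)"
proof -
  obtain C where C: "C > 0" "\<And>r. \<bar>f r\<bar> \<le> C * (real r + 1) powr (-\<alpha>)"
    using power_decay_bound[OF assms(1)] by blast
  have "summable (\<lambda>r. real r powr (-\<alpha>))"
    using assms(2) by (simp add: summable_real_powr_iff)
  then have "summable (\<lambda>r. (real r + 1) powr (-\<alpha>))"
    by (subst (asm) summable_Suc_iff[symmetric]) (simp add: add.commute)
  then have "summable (\<lambda>r. C * (real r + 1) powr (-\<alpha>))"
    by (rule summable_mult)
  then show ?thesis
    by (rule summable_comparison_test[rotated]) (use C in auto)
qed

lemma power_decay_imp_asymp_equiv:
  assumes "power_decay f \<alpha> A" "A \<noteq> 0"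
  shows "f \<sim>[at_top] (\<lambda>r. A * real r powr (-\<alpha>))"
proof (rule asymp_equivI')
  have "(\<lambda>r. f r * real r powr \<alpha> / A) \<longlonglongrightarrow> A / A"
    using assms unfolding power_decay_def by (intro tendsto_intros) auto
  then have "(\<lambda>r. f r * real r powr \<alpha> / A) \<longlonglongrightarrow> 1" using assms by simp
  then show "(\<lambda>r. f r / (A * real r powr (-\<alpha>))) \<longlonglongrightarrow> 1"
    by (simp add: powr_minus field_simps)
qed

lemma powr_le_geometric:
  assumes "z > (1::real)"
  obtains C where "C > 0" "\<And>n. (real n + 1) powr \<alpha> \<le> C * z ^ n"
proof -
  have "(\<lambda>n. (real n + 1) powr \<alpha> / z ^ n) \<longlonglongrightarrow> 0"
    using assms by real_asymp
  then have "Bseq (\<lambda>n. (real n + 1) powr \<alpha> / z ^ n)"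
    using convergentI convergent_imp_Bseq by blast
  then obtain C where C: "C > 0" "\<And>n. \<bar>(real n + 1) powr \<alpha> / z ^ n\<bar> \<le> C"
    unfolding Bseq_def real_norm_def by blast
  have "(real n + 1) powr \<alpha> \<le> C * z ^ n" for n
    using C(2)[of n] assms by (simp add: pos_divide_le_eq)
  then show thesis by (rule that[OF C(1)])
qed

section \<open>Convolutions\<close>

lemma tendsto_suminf_dominated:
  fixes a :: "'z \<Rightarrow> nat \<Rightarrow> real"
  assumes "F \<noteq> bot" "\<And>i. ((\<lambda>z. a z i) \<longlongrightarrow> b i) F"
    and "eventually (\<lambda>z. \<forall>i. \<bar>a z i\<bar> \<le> H i) F" "summable H"
  shows "((\<lambda>z. \<Sum>i. a z i) \<longlongrightarrow> (\<Sum>i. b i)) F"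
proof -
  have "eventually (\<lambda>(i, z). norm (a z i) \<le> H i) (at_top \<times>\<^sub>F F)"
    unfolding eventually_prod_filter using assms(3)
    by (intro exI[of _ "\<lambda>_. True"] exI[of _ "\<lambda>z. \<forall>i. \<bar>a z i\<bar> \<le> H i"]) auto
  from tannerys_theorem[OF assms(2) this assms(4,1)] show ?thesis by blast
qed

text \<open>If the index of \<open>G\<close> is at most half of \<open>K\<close>, the index of \<open>h\<close> is at least \<open>K / 2\<close>, where \<open>h\<close>
is at most a constant times \<open>2\<^sup>\<alpha> K\<^sup>-\<^sup>\<alpha>\<close>; so dominated convergence applies to the rescaled sum.
The set \<open>S z\<close> is left open because the two halves of a convolution must not share the midpoint.\<close>

lemma half_convolution:
  fixes F :: "'z filter" and h :: "nat \<Rightarrow> real"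
  assumes F: "F \<noteq> bot" and K: "filterlim K at_top F"
    and h: "power_decay h \<alpha> A" and \<alpha>: "\<alpha> \<ge> 0"
    and G: "\<And>i. ((\<lambda>z. G z i) \<longlongrightarrow> g i) F"
    and H: "eventually (\<lambda>z. \<forall>i. \<bar>G z i\<bar> \<le> H i) F" "summable H"
    and S: "\<And>z i. i \<in> S z \<Longrightarrow> 2 * i \<le> K z" "\<And>i. eventually (\<lambda>z. i \<in> S z) F"
  shows "((\<lambda>z. (\<Sum>i\<in>S z. h (K z - i) * G z i) * real (K z) powr \<alpha>) \<longlongrightarrow> A * (\<Sum>i. g i)) F"
proof -
  obtain C where C: "C > 0" "\<And>r. \<bar>h r\<bar> \<le> C * (real r + 1) powr (-\<alpha>)"
    using power_decay_bound[OF h] by blast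
  define a where "a = (\<lambda>z i. if i \<in> S z then h (K z - i) * real (K z) powr \<alpha> * G z i else 0)"
  have fin: "finite (S z)" for z
    by (rule finite_subset[of _ "{..K z}"]) (use S(1) in force)+
  have eq: "(\<Sum>i\<in>S z. h (K z - i) * G z i) * real (K z) powr \<alpha> = (\<Sum>i. a z i)" for z
    unfolding a_def
    by (subst suminf_finite[OF fin[of z]]) (auto simp: sum_distrib_left sum_distrib_right mult_ac intro!: sum.cong)
  have hb: "\<bar>h (k - i) * real k powr \<alpha>\<bar> \<le> C * 2 powr \<alpha>" if "2 * i \<le> k" for k i
  proof -
    have "real k powr \<alpha> \<le> (2 * (real (k - i) + 1)) powr \<alpha>"
      using that \<alpha> by (intro powr_mono2) (auto simp: of_nat_diff)
    also have "\<dots> = 2 powr \<alpha> * (real (k - i) + 1) powr \<alpha>"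
      by (rule powr_mult)
    finally have "\<bar>h (k - i) * real k powr \<alpha>\<bar>
        \<le> C * (real (k - i) + 1) powr (-\<alpha>) * (2 powr \<alpha> * (real (k - i) + 1) powr \<alpha>)"
      unfolding abs_mult using C(2)[of "k - i"] C(1) by (intro mult_mono) auto
    also have "\<dots> = C * 2 powr \<alpha>"
      by (simp add: powr_minus field_simps)
    finally show ?thesis .
  qed
  \<comment> \<open>The terms outside \<open>S z\<close> are set to 0, so that dominated convergence runs over a fixed index set.\<close>
  have "((\<lambda>z. \<Sum>i. a z i) \<longlongrightarrow> (\<Sum>i. A * g i)) F"
  proof (rule tendsto_suminf_dominated[OF F])
    show "((\<lambda>z. a z i) \<longlongrightarrow> A * g i) F" for i
    proof -
      have Ki: "filterlim (\<lambda>z. K z - i) at_top F"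
        by (rule filterlim_compose[OF filterlim_minus_const_nat_at_top K])
      have "(\<lambda>r. h r * real (r + i) powr \<alpha>) \<longlonglongrightarrow> A"
      proof -
        have "(\<lambda>r. real (r + i) powr \<alpha>) \<sim>[at_top] (\<lambda>r. real r powr \<alpha>)"
          unfolding of_nat_add by real_asymp
        then have "(\<lambda>r. h r * real (r + i) powr \<alpha>) \<sim>[at_top] (\<lambda>r. h r * real r powr \<alpha>)"
          by (intro asymp_equiv_mult) auto
        then show ?thesis using h tendsto_asymp_equiv_cong unfolding power_decay_def by blast
      qed
      from filterlim_compose[OF this Ki]
      have "((\<lambda>z. h (K z - i) * real (K z - i + i) powr \<alpha>) \<longlongrightarrow> A) F" .
      then have "((\<lambda>z. h (K z - i) * real (K z - i + i) powr \<alpha> * G z i) \<longlongrightarrow> A * g i) F"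
        by (intro tendsto_mult G)
      moreover have "eventually (\<lambda>z. h (K z - i) * real (K z - i + i) powr \<alpha> * G z i = a z i) F"
        using S(2)[of i] by eventually_elim (use S(1) in \<open>force simp: a_def\<close>)
      ultimately show ?thesis by (rule Lim_transform_eventually)
    qed
    show "summable (\<lambda>i. C * 2 powr \<alpha> * H i)" using H(2) by (rule summable_mult)
    show "eventually (\<lambda>z. \<forall>i. \<bar>a z i\<bar> \<le> C * 2 powr \<alpha> * H i) F"
      using H(1)
    proof eventually_elim
      case (elim z)
      show ?case
      proof
        fix i
        have "0 \<le> H i" using elim abs_ge_zero order_trans by blast
        show "\<bar>a z i\<bar> \<le> C * 2 powr \<alpha> * H i"
        proof (cases "i \<in> S z")
          case True
          then have "\<bar>a z i\<bar> = \<bar>h (K z - i) * real (K z) powr \<alpha>\<bar> * \<bar>G z i\<bar>"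
            by (simp add: a_def abs_mult)
          also have "\<dots> \<le> C * 2 powr \<alpha> * H i"
            using hb[OF S(1)[OF True]] elim C(1) by (intro mult_mono) auto
          finally show ?thesis .
        qed (use C(1) \<open>0 \<le> H i\<close> in \<open>simp add: a_def\<close>)
      qed
    qed
  qed
  moreover have "summable g"
  proof (rule summable_comparison_test[OF _ H(2)], intro exI allI impI)
    fix i
    have "((\<lambda>z. \<bar>G z i\<bar>) \<longlongrightarrow> \<bar>g i\<bar>) F" using G by (rule tendsto_rabs)
    moreover have "eventually (\<lambda>z. \<bar>G z i\<bar> \<le> H i) F" using H(1) by (rule eventually_mono) blast
    ultimately show "norm (g i) \<le> H i"
      using tendsto_upperbound F by (metis real_norm_def)
  qed
  ultimately show ?thesis
    unfolding eq by (simp add: suminf_mult)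
qed

lemma sum_convolution_split:
  fixes h G :: "nat \<Rightarrow> real"
  shows "(\<Sum>i=0..k. h (k - i) * G i)
    = (\<Sum>i\<in>{i. 2 * i \<le> k}. h (k - i) * G i) + (\<Sum>i\<in>{i. 2 * i < k}. G (k - i) * h i)"
proof -
  have fin: "finite {i::nat. 2 * i \<le> k}" by (rule finite_subset[of _ "{..k}"]) auto
  have "{0..k} = {i. 2 * i \<le> k} \<union> {i. i \<le> k \<and> k < 2 * i}" by auto
  then have "(\<Sum>i=0..k. h (k - i) * G i)
    = (\<Sum>i\<in>{i. 2 * i \<le> k}. h (k - i) * G i) + (\<Sum>i\<in>{i. i \<le> k \<and> k < 2 * i}. h (k - i) * G i)"
    using fin by (simp only:) (rule sum.union_disjoint, auto)
  also have "(\<Sum>i\<in>{i. i \<le> k \<and> k < 2 * i}. h (k - i) * G i) = (\<Sum>i\<in>{i. 2 * i < k}. G (k - i) * h i)"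
    by (rule sum.reindex_bij_witness[of _ "\<lambda>i. k - i" "\<lambda>i. k - i"]) auto
  finally show ?thesis .
qed

lemma eventually_double_le:
  fixes K :: "'z \<Rightarrow> nat"
  assumes "filterlim K at_top F"
  shows "eventually (\<lambda>z. 2 * i \<le> K z) F" "eventually (\<lambda>z. 2 * i < K z) F"
proof -
  from assms show "eventually (\<lambda>z. 2 * i \<le> K z) F" by (simp add: filterlim_at_top)
  from assms have "eventually (\<lambda>z. Suc (2 * i) \<le> K z) F" unfolding filterlim_at_top by blast
  then show "eventually (\<lambda>z. 2 * i < K z) F" by (simp add: Suc_le_eq)
qed

text \<open>A convolution of two power laws with the same exponent is large only if one of the two indices is: each
half of the sum contributes the tail constant of one factor times the total mass of the other.\<close>

lemma power_decay_convolution: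
  assumes f: "power_decay f \<alpha> A" and g: "power_decay g \<alpha> B" and \<alpha>: "\<alpha> > 1"
  shows "power_decay (\<lambda>k. \<Sum>i=0..k. f i * g (k - i)) \<alpha> (B * (\<Sum>i. f i) + A * (\<Sum>i. g i))"
proof -
  have "((\<lambda>k. (\<Sum>i\<in>{i. 2 * i \<le> k}. g (k - i) * f i) * real k powr \<alpha>) \<longlongrightarrow> B * (\<Sum>i. f i)) at_top"
    by (rule half_convolution[where K = "\<lambda>k. k" and H = "\<lambda>i. \<bar>f i\<bar>" and G = "\<lambda>_. f"])
      (use \<alpha> g power_decay_summable[OF f \<alpha>] eventually_double_le[OF filterlim_ident] in \<open>auto simp: filterlim_ident\<close>)
  moreover have "((\<lambda>k. (\<Sum>i\<in>{i. 2 * i < k}. f (k - i) * g i) * real k powr \<alpha>) \<longlongrightarrow> A * (\<Sum>i. g i)) at_top"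
    by (rule half_convolution[where K = "\<lambda>k. k" and H = "\<lambda>i. \<bar>g i\<bar>" and G = "\<lambda>_. g"])
      (use \<alpha> f power_decay_summable[OF g \<alpha>] eventually_double_le[OF filterlim_ident] in \<open>auto simp: filterlim_ident\<close>)
  ultimately have "((\<lambda>k. ((\<Sum>i\<in>{i. 2 * i \<le> k}. g (k - i) * f i) + (\<Sum>i\<in>{i. 2 * i < k}. f (k - i) * g i))
      * real k powr \<alpha>) \<longlongrightarrow> B * (\<Sum>i. f i) + A * (\<Sum>i. g i)) at_top"
    unfolding distrib_right by (rule tendsto_add)
  then show ?thesis
    unfolding power_decay_def sum_convolution_split[symmetric] by (simp add: mult.commute)
qed

text \<open>When \<open>G z\<close> is uniformly lighter than \<open>h\<close>, only the half in which \<open>h\<close> takes the large index survives. The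
filter lets the second factor vary together with the length of the convolution.\<close>

lemma convolution_light_family:
  fixes F :: "'z filter"
  assumes F: "F \<noteq> bot" and K: "filterlim K at_top F"
    and h: "power_decay h \<alpha> A" and \<alpha>: "\<alpha> > 1"
    and G: "\<And>i. ((\<lambda>z. G z i) \<longlongrightarrow> g i) F"
    and H: "eventually (\<lambda>z. \<forall>i. \<bar>G z i\<bar> \<le> H i) F" "power_decay H \<alpha> 0"
  shows "((\<lambda>z. (\<Sum>i=0..K z. h (K z - i) * G z i) * real (K z) powr \<alpha>) \<longlongrightarrow> A * (\<Sum>i. g i)) F"
proof -
  have sH: "summable H"
    using power_decay_summable[OF H(2) \<alpha>] summable_rabs_cancel by blast
  note sh = power_decay_summable[OF h \<alpha>]
  have 1: "((\<lambda>z. (\<Sum>i\<in>{i. 2 * i \<le> K z}. h (K z - i) * G z i) * real (K z) powr \<alpha>) \<longlongrightarrow> A * (\<Sum>i. g i)) F"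
    by (rule half_convolution[where H = H])
      (use \<alpha> F K h G H(1) sH eventually_double_le[OF K] in auto)
  have 2: "((\<lambda>z. (\<Sum>i\<in>{i. 2 * i < K z}. H (K z - i) * \<bar>h i\<bar>) * real (K z) powr \<alpha>) \<longlongrightarrow> 0 * (\<Sum>i. \<bar>h i\<bar>)) F"
    by (rule half_convolution[where H = "\<lambda>i. \<bar>h i\<bar>"])
      (use \<alpha> F K H(2) sh eventually_double_le[OF K] in auto)
  have 3: "((\<lambda>z. (\<Sum>i\<in>{i. 2 * i < K z}. G z (K z - i) * h i) * real (K z) powr \<alpha>) \<longlongrightarrow> 0) F"
  proof (rule Lim_null_comparison)
    show "eventually (\<lambda>z. norm ((\<Sum>i\<in>{i. 2 * i < K z}. G z (K z - i) * h i) * real (K z) powr \<alpha>)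
        \<le> (\<Sum>i\<in>{i. 2 * i < K z}. H (K z - i) * \<bar>h i\<bar>) * real (K z) powr \<alpha>) F"
      using H(1)
    proof eventually_elim
      case (elim z)
      have "\<bar>\<Sum>i\<in>{i. 2 * i < K z}. G z (K z - i) * h i\<bar> \<le> (\<Sum>i\<in>{i. 2 * i < K z}. H (K z - i) * \<bar>h i\<bar>)"
        by (rule order_trans[OF sum_abs sum_mono]) (use elim in \<open>auto simp: abs_mult intro!: mult_right_mono\<close>)
      then show ?case by (simp add: abs_mult mult_right_mono)
    qed
  qed (use 2 in simp)
  show ?thesis
    using tendsto_add[OF 1 3] by (simp add: sum_convolution_split distrib_right)
qed

section \<open>Convolution powers and compound sums\<close>

text \<open>Convolution powers of a probability mass function \<open>t\<close> are written as the coefficients of powers of its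
generating function, so that the algebra of formal power series is available.\<close>

lemma fps_power_nth_nonneg:
  fixes t :: "nat \<Rightarrow> real"
  assumes "\<And>r. t r \<ge> 0"
  shows "fps_nth (Abs_fps t ^ n) r \<ge> 0"
proof (induction n arbitrary: r)
  case (Suc n)
  then show ?case by (auto simp: fps_mult_nth assms intro!: sum_nonneg)
qed auto

lemma fps_power_nth_sums:
  fixes t :: "nat \<Rightarrow> real"
  assumes "\<And>r. t r \<ge> 0" "t sums 1"
  shows "(\<lambda>r. fps_nth (Abs_fps t ^ n) r) sums 1"
proof (induction n)
  case 0
  show ?case using sums_single[of 0 "\<lambda>_. 1::real"] by (simp cong: if_cong)
next
  case (Suc n)
  have "(\<lambda>k. \<Sum>i\<le>k. t i * fps_nth (Abs_fps t ^ n) (k - i)) sums ((\<Sum>k. t k) * (\<Sum>k. fps_nth (Abs_fps t ^ n) k))"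
    by (rule Cauchy_product_sums)
      (use Suc assms fps_power_nth_nonneg[OF assms(1)] in \<open>auto simp: abs_of_nonneg sums_iff\<close>)
  then show ?case
    using Suc assms by (simp add: fps_mult_nth sums_iff atMost_atLeast0)
qed

text \<open>If a sum of \<open>n + 2\<close> terms is \<open>r\<close>, then either a distinguished term is at least about \<open>r / (n + 2)\<close>, or the sum of
the others is at least about \<open>(n + 1) r / (n + 2)\<close>. Splitting in this proportion, instead of at \<open>r / 2\<close>, makes
the losses in the induction multiply to a power of \<open>n\<close>. Exponential growth in \<open>n\<close> would
be too much: only some exponential moment of the mixing variable is finite.\<close>

lemma fps_power_nth_le_power_law:
  fixes t :: "nat \<Rightarrow> real"
  assumes t: "\<And>r. t r \<ge> 0" "t sums 1" and K: "K \<ge> 0" "\<alpha> \<ge> 0"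
    and le: "\<And>r. t r \<le> K * (real r + 1) powr (-\<alpha>)"
  shows "fps_nth (Abs_fps t ^ Suc n) r \<le> K * real (Suc n) powr (\<alpha> + 1) * (real r + 1) powr (-\<alpha>)"
proof (induction n arbitrary: r)
  case 0
  then show ?case using le by simp
next
  case (Suc n)
  define T where "T = (\<lambda>j. fps_nth (Abs_fps t ^ Suc n) j)"
  define B where "B = K * (real n + 2) powr \<alpha> * (real r + 1) powr (-\<alpha>)"
  have T: "T j \<ge> 0" for j unfolding T_def by (rule fps_power_nth_nonneg[OF t(1)])
  have B: "B \<ge> 0" unfolding B_def using K by simp
  have sub: "(\<Sum>j=0..r. f j) \<le> 1" if "f sums 1" "\<And>j. f j \<ge> 0" for f :: "nat \<Rightarrow> real"
    using sum_le_suminf[of f "{0..r}"] that by (simp add: sums_iff)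
  have term_le: "t j * T (r - j) \<le> B * ((real n + 1) * t j + T (r - j))" if j: "j \<le> r" for j
  proof (cases "real n + 1 \<le> (real n + 2) * (real (r - j) + 1) / (real r + 1)")
    case True
    have "T (r - j) \<le> K * (real n + 1) powr (\<alpha> + 1) * (real (r - j) + 1) powr (-\<alpha>)"
      using Suc[of "r - j"] unfolding T_def by (simp add: add.commute)
    also have "(real (r - j) + 1) powr (-\<alpha>) \<le> ((real n + 1) * (real r + 1) / (real n + 2)) powr (-\<alpha>)"
    proof (rule powr_mono2')
      show "0 < (real n + 1) * (real r + 1) / (real n + 2)"
        by (intro divide_pos_pos mult_pos_pos) auto
      show "(real n + 1) * (real r + 1) / (real n + 2) \<le> real (r - j) + 1"
        using True by (simp add: field_simps)
    qed (use K(2) in simp)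
    also have "\<dots> = (real n + 1) powr (-\<alpha>) * (real n + 2) powr \<alpha> * (real r + 1) powr (-\<alpha>)"
      by (simp add: powr_divide powr_mult powr_minus_divide)
    also have "K * (real n + 1) powr (\<alpha> + 1) * \<dots> = B * (real n + 1)"
      by (simp add: B_def powr_add powr_minus field_simps)
    finally have "T (r - j) \<le> B * (real n + 1)" using K(1) by (simp add: mult_left_mono)
    then have "t j * T (r - j) \<le> t j * (B * (real n + 1))" using t(1) by (intro mult_left_mono)
    also have "\<dots> \<le> B * ((real n + 1) * t j + T (r - j))"
      using B T[of "r - j"] by (simp add: algebra_simps)
    finally show ?thesis .
  next
    case False
    then have "(real n + 2) * (real r - real j + 1) < (real n + 1) * (real r + 1)"
      using j by (simp add: field_simps of_nat_diff)
    then have "(real r + 1) / (real n + 2) \<le> real j + 1"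
      by (simp add: field_simps)
    then have "(real j + 1) powr (-\<alpha>) \<le> ((real r + 1) / (real n + 2)) powr (-\<alpha>)"
      using K(2) by (intro powr_mono2') auto
    also have "\<dots> = (real n + 2) powr \<alpha> * (real r + 1) powr (-\<alpha>)"
      by (simp add: powr_divide powr_minus field_simps)
    finally have "t j \<le> B"
      using order_trans[OF le mult_left_mono[OF _ K(1)]] by (simp add: B_def mult.assoc)
    then have "t j * T (r - j) \<le> B * T (r - j)" using T by (intro mult_right_mono)
    also have "\<dots> \<le> B * ((real n + 1) * t j + T (r - j))"
      using B t(1)[of j] by (simp add: algebra_simps)
    finally show ?thesis .
  qed
  have "fps_nth (Abs_fps t ^ Suc (Suc n)) r = (\<Sum>j=0..r. t j * T (r - j))"
    unfolding T_def power_Suc[of "Abs_fps t" "Suc n"] fps_mult_nth by simp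
  also have "\<dots> \<le> (\<Sum>j=0..r. B * ((real n + 1) * t j + T (r - j)))"
    by (rule sum_mono) (use term_le in auto)
  also have "\<dots> = B * ((real n + 1) * (\<Sum>j=0..r. t j) + (\<Sum>j=0..r. T (r - j)))"
    by (simp add: sum.distrib flip: sum_distrib_left)
  also have "(\<Sum>j=0..r. T (r - j)) = (\<Sum>j=0..r. T j)"
    by (rule sum.reindex_bij_witness[of _ "\<lambda>i. r - i" "\<lambda>i. r - i"]) auto
  also have "B * ((real n + 1) * (\<Sum>j=0..r. t j) + (\<Sum>j=0..r. T j)) \<le> B * ((real n + 1) * 1 + 1)"
    using sub[OF t(2,1)] sub[of T] fps_power_nth_sums[OF t, of "Suc n"] T B
    by (intro mult_left_mono add_mono) (auto simp: T_def)
  also have "\<dots> = K * real (Suc (Suc n)) powr (\<alpha> + 1) * (real r + 1) powr (-\<alpha>)"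
    by (simp add: B_def powr_add add_ac mult_ac)
  finally show ?case .
qed

lemma power_decay_fps_power:
  fixes t :: "nat \<Rightarrow> real"
  assumes t: "\<And>r. t r \<ge> 0" "t sums 1" and d: "power_decay t \<alpha> A" and \<alpha>: "\<alpha> > 1"
  shows "power_decay (\<lambda>r. fps_nth (Abs_fps t ^ n) r) \<alpha> (real n * A)"
proof (induction n)
  case 0
  have "power_decay (\<lambda>_. 0) \<alpha> 0" by (simp add: power_decay_def)
  moreover have "eventually (\<lambda>r. fps_nth (Abs_fps t ^ 0) r = 0) at_top"
    using eventually_gt_at_top[of 0] by eventually_elim auto
  ultimately show ?case by (subst power_decay_cong) auto
next
  case (Suc n)
  have "(\<Sum>r. fps_nth (Abs_fps t ^ n) r) = 1" "(\<Sum>r. t r) = 1"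
    using fps_power_nth_sums[OF t, of n] t(2) by (simp_all add: sums_unique[symmetric])
  with power_decay_convolution[OF d Suc \<alpha>]
  have "power_decay (\<lambda>k. \<Sum>i=0..k. t i * fps_nth (Abs_fps t ^ n) (k - i)) \<alpha> (real n * A + A)"
    by simp
  then show ?case
    by (simp add: fps_mult_nth distrib_right add.commute)
qed

text \<open>Each convolution power has tail constant \<open>n A\<close>; the polynomial bound above dominates the sum over \<open>n\<close>.\<close>

lemma power_decay_compound:
  fixes t w :: "nat \<Rightarrow> real"
  assumes t: "\<And>r. t r \<ge> 0" "t sums 1" and d: "power_decay t \<alpha> A" and \<alpha>: "\<alpha> > 1"
    and w: "\<And>n. w n \<ge> 0" "summable (\<lambda>n. w n * real n powr (\<alpha> + 1))"
  shows "power_decay (\<lambda>r. \<Sum>n. w n * fps_nth (Abs_fps t ^ n) r) \<alpha> (A * (\<Sum>n. real n * w n))"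
proof -
  obtain K where K: "K > 0" "\<And>r. \<bar>t r\<bar> \<le> K * (real r + 1) powr (-\<alpha>)"
    using power_decay_bound[OF d] by blast
  have b: "fps_nth (Abs_fps t ^ n) r * real r powr \<alpha> \<le> K * real n powr (\<alpha> + 1)" if "r > 0" for n r
  proof (cases n)
    case (Suc m)
    have "fps_nth (Abs_fps t ^ n) r \<le> K * real n powr (\<alpha> + 1) * (real r + 1) powr (-\<alpha>)"
      unfolding Suc using K \<alpha> t by (intro fps_power_nth_le_power_law) (auto simp: abs_of_nonneg)
    also have "\<dots> \<le> K * real n powr (\<alpha> + 1) * real r powr (-\<alpha>)"
      using K \<alpha> that by (intro mult_left_mono powr_mono2') auto
    finally show ?thesis using that by (simp add: powr_minus field_simps)
  qed (use that in auto)
  have nn: "fps_nth (Abs_fps t ^ n) r \<ge> 0" for n r by (rule fps_power_nth_nonneg[OF t(1)])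
  have "(\<lambda>r. \<Sum>n. w n * fps_nth (Abs_fps t ^ n) r * real r powr \<alpha>) \<longlonglongrightarrow> (\<Sum>n. w n * (real n * A))"
  proof (rule tendsto_suminf_dominated)
    show "(\<lambda>r. w n * fps_nth (Abs_fps t ^ n) r * real r powr \<alpha>) \<longlonglongrightarrow> w n * (real n * A)" for n
      using tendsto_mult_left[OF power_decay_fps_power[OF t d \<alpha>, of n, unfolded power_decay_def], of "w n"]
      by (simp add: mult.assoc)
    show "summable (\<lambda>n. K * (w n * real n powr (\<alpha> + 1)))" using w(2) by (rule summable_mult)
    show "eventually (\<lambda>r. \<forall>n. \<bar>w n * fps_nth (Abs_fps t ^ n) r * real r powr \<alpha>\<bar> \<le> K * (w n * real n powr (\<alpha> + 1))) at_top"
      using eventually_gt_at_top[of 0]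
    proof eventually_elim
      case (elim r)
      then show ?case
        using mult_left_mono[OF b[OF elim] w(1)] w(1) nn
        by (auto simp: abs_mult abs_of_nonneg mult_ac)
    qed
  qed simp
  moreover have "(\<Sum>n. w n * fps_nth (Abs_fps t ^ n) r * real r powr \<alpha>) = (\<Sum>n. w n * fps_nth (Abs_fps t ^ n) r) * real r powr \<alpha>"
    for r
  proof (rule suminf_mult2[symmetric])
    show "summable (\<lambda>n. w n * fps_nth (Abs_fps t ^ n) r)"
    proof (rule summable_comparison_test_ev)
      show "summable (\<lambda>n. w n * real n powr (\<alpha> + 1))" by (rule w(2))
      show "eventually (\<lambda>n. norm (w n * fps_nth (Abs_fps t ^ n) r) \<le> w n * real n powr (\<alpha> + 1)) at_top"
        using eventually_gt_at_top[of 0]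
      proof eventually_elim
        case (elim n)
        have "fps_nth (Abs_fps t ^ n) r \<le> 1"
          using sum_le_suminf[of "\<lambda>r. fps_nth (Abs_fps t ^ n) r" "{r}"] fps_power_nth_sums[OF t, of n] nn
          by (simp add: sums_iff)
        also have "1 \<le> real n powr (\<alpha> + 1)"
          using elim \<alpha> by (intro ge_one_powr_ge_zero) auto
        finally show ?case using w(1) nn by (simp add: abs_of_nonneg mult_left_mono)
      qed
    qed
  qed
  moreover have "(\<Sum>n. w n * (real n * A)) = A * (\<Sum>n. real n * w n)"
  proof -
    have "summable (\<lambda>n. real n * w n)"
    proof (rule summable_comparison_test[OF _ w(2)], intro exI allI impI)
      fix n :: nat
      have "real n \<le> real n powr (\<alpha> + 1)"
        using \<alpha> powr_mono[of 1 "\<alpha> + 1" "real n"] by (cases "n = 0") auto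
      from mult_right_mono[OF this w(1)[of n]] w(1)[of n]
      show "norm (real n * w n) \<le> w n * real n powr (\<alpha> + 1)" by (simp add: mult.commute)
    qed
    from suminf_mult[OF this, of A] show ?thesis by (simp add: mult_ac)
  qed
  ultimately show ?thesis
    unfolding power_decay_def by simp
qed

section \<open>Exchanging sums and integrals\<close>

lemma sums_integral_nonneg:
  fixes f :: "nat \<Rightarrow> 'b \<Rightarrow> real"
  assumes f: "\<And>n. f n \<in> borel_measurable N" "\<And>n. AE x in N. 0 \<le> f n x"
    and g: "AE x in N. (\<lambda>n. f n x) sums g x" "integrable N g"
  shows "(\<lambda>n. \<integral>x. f n x \<partial>N) sums (\<integral>x. g x \<partial>N)" "integrable N (f n)"
proof -
  have nn: "AE x in N. \<forall>n. 0 \<le> f n x" using f(2) by (simp add: AE_all_countable)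
  have le: "AE x in N. norm (f n x) \<le> norm (g x)" for n
    using nn g(1)
  proof eventually_elim
    case (elim x)
    then show ?case
      using sum_le_suminf[of "\<lambda>n. f n x" "{n}"] by (auto simp: sums_iff)
  qed
  show i: "integrable N (f n)" for n
    by (rule Bochner_Integration.integrable_bound[OF g(2) f(1) le])
  have "(\<lambda>n. \<integral>x. (\<Sum>i<n. f i x) \<partial>N) \<longlonglongrightarrow> (\<integral>x. g x \<partial>N)"
  proof (rule integral_dominated_convergence[OF _ _ g(2)])
    show "g \<in> borel_measurable N" using g(2) by simp
    show "(\<lambda>x. \<Sum>i<n. f i x) \<in> borel_measurable N" for n using f(1) by simp
    show "AE x in N. (\<lambda>n. \<Sum>i<n. f i x) \<longlonglongrightarrow> g x" using g(1) by (simp add: sums_def)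
    show "AE x in N. norm (\<Sum>i<n. f i x) \<le> g x" for n
      using nn g(1)
    proof eventually_elim
      case (elim x)
      then show ?case
        using sum_le_suminf[of "\<lambda>n. f n x" "{..<n}"] by (auto simp: sums_iff sum_nonneg abs_of_nonneg)
    qed
  qed
  then show "(\<lambda>n. \<integral>x. f n x \<partial>N) sums (\<integral>x. g x \<partial>N)"
    unfolding sums_def using i by simp
qed

lemma integrable_sums_nonneg:
  fixes f :: "nat \<Rightarrow> 'b \<Rightarrow> real"
  assumes f: "\<And>n. integrable N (f n)" "\<And>n. AE x in N. 0 \<le> f n x"
    and g: "g \<in> borel_measurable N" "AE x in N. (\<lambda>n. f n x) sums g x"
    and s: "summable (\<lambda>n. \<integral>x. f n x \<partial>N)"
  shows "integrable N g"
proof -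
  have nn: "AE x in N. \<forall>n. 0 \<le> f n x" using f(2) by (simp add: AE_all_countable)
  have "integrable N (\<lambda>x. \<Sum>n. f n x)"
  proof (rule integrable_suminf[OF f(1)])
    show "AE x in N. summable (\<lambda>n. norm (f n x))"
      using nn g(2) by eventually_elim (auto simp: sums_iff)
    have "(\<integral>x. norm (f n x) \<partial>N) = (\<integral>x. f n x \<partial>N)" for n
      using f(2)[of n] f(1) by (intro integral_cong_AE) (auto elim: eventually_mono)
    then show "summable (\<lambda>n. \<integral>x. norm (f n x) \<partial>N)" using s by simp
  qed
  moreover have "AE x in N. (\<Sum>n. f n x) = g x"
    using g(2) by eventually_elim (simp add: sums_iff)
  ultimately show ?thesis
    using f g by (subst integrable_cong_AE[where g = "\<lambda>x. \<Sum>n. f n x"]) auto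
qed

section \<open>Poisson probabilities\<close>

lemma poisson_prob_nonneg: "l \<ge> 0 \<Longrightarrow> poisson_prob l r \<ge> 0"
  by (simp add: poisson_prob_def)

lemma poisson_prob_sums_1: "(\<lambda>r. poisson_prob l r) sums 1"
proof -
  have "(\<lambda>r. exp (-l) * (l ^ r /\<^sub>R fact r)) sums (exp (-l) * exp l)"
    by (intro sums_mult exp_converges)
  then show ?thesis by (simp add: poisson_prob_def exp_minus field_simps)
qed

lemma poisson_prob_le_1: "l \<ge> 0 \<Longrightarrow> poisson_prob l r \<le> 1"
  using sum_le_suminf[of "poisson_prob l" "{r}"] poisson_prob_sums_1[of l]
  by (simp add: sums_iff poisson_prob_nonneg)

lemma poisson_prob_le_power: "l \<ge> 0 \<Longrightarrow> poisson_prob l r \<le> l ^ r / fact r"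
  by (simp add: poisson_prob_def divide_right_mono mult_left_le_one_le)

text \<open>The size-biasing identity: multiplying by the rate shifts the index. It turns \<open>E (Y 1{\<Lambda> = n})\<close> into
a mixed Poisson probability and makes the rescaled law of \<open>\<tau>\<close> Poisson when \<open>X\<close> is constant.\<close>

lemma poisson_prob_Suc: "(real r + 1) * poisson_prob l (Suc r) = l * poisson_prob l r"
  by (simp add: poisson_prob_def divide_simps)

lemma poisson_prob_mean_sums: "(\<lambda>r. real r * poisson_prob l r) sums l"
proof -
  have "(\<lambda>r. l * poisson_prob l r) sums (l * 1)" by (intro sums_mult poisson_prob_sums_1)
  then have "(\<lambda>r. real (Suc r) * poisson_prob l (Suc r)) sums l"
    by (simp add: poisson_prob_Suc[symmetric] add.commute)
  then show ?thesis by (subst (asm) sums_Suc_iff) simp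
qed

lemma poisson_prob_pgf_sums: "(\<lambda>n. poisson_prob l n * z ^ n) sums exp ((z - 1) * l)"
proof -
  have "(\<lambda>n. exp (-l) * ((l * z) ^ n /\<^sub>R fact n)) sums (exp (-l) * exp (l * z))"
    by (intro sums_mult exp_converges)
  also have "exp (-l) * exp (l * z) = exp ((z - 1) * l)"
    by (simp add: exp_add[symmetric] algebra_simps)
  finally show ?thesis
    by (simp add: poisson_prob_def power_mult_distrib divide_inverse mult_ac)
qed

text \<open>The sum of \<open>n\<close> independent Poisson variables of rate \<open>l\<close> is Poisson of rate \<open>n l\<close>, because the generating
function is an exponential.\<close>

lemma fps_power_poisson_prob:
  "fps_nth (Abs_fps (poisson_prob l) ^ n) r = poisson_prob (real n * l) r"
proof -
  have "Abs_fps (poisson_prob l) = fps_const (exp (-l)) * fps_exp l"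
    by (simp add: fps_eq_iff poisson_prob_def)
  then have "Abs_fps (poisson_prob l) ^ n = fps_const (exp (-l) ^ n) * fps_exp (real n * l)"
    by (simp add: power_mult_distrib fps_exp_power_mult fps_const_power)
  then show ?thesis
    by (simp add: poisson_prob_def exp_of_nat_mult[symmetric])
qed

lemma measurable_poisson_prob [measurable]:
  "(\<lambda>l. poisson_prob l r) \<in> borel_measurable borel"
  unfolding poisson_prob_def by measurable

lemma integrable_mult_poisson_prob:
  fixes f :: "'b \<Rightarrow> real"
  assumes "integrable N f" "g \<in> borel_measurable N" "AE x in N. f x = 0 \<or> 0 \<le> g x"
  shows "integrable N (\<lambda>x. f x * poisson_prob (g x) r)"
proof (rule Bochner_Integration.integrable_bound[OF assms(1)])
  show "AE x in N. norm (f x * poisson_prob (g x) r) \<le> norm (f x)"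
    using assms(3)
  proof eventually_elim
    case (elim x)
    then show ?case
      using poisson_prob_le_1[of "g x" r] poisson_prob_nonneg[of "g x" r]
      by (auto simp: abs_mult mult_left_le)
  qed
qed (use assms in measurable)

lemma fact_dominates_power_law:
  fixes y :: real
  shows "(\<lambda>r. y ^ r / fact r * real r powr \<kappa>) \<longlonglongrightarrow> 0"
proof -
  have "(\<lambda>r. real r powr \<kappa> / 2 ^ r) \<longlonglongrightarrow> 0" by real_asymp
  moreover have "(\<lambda>r. (2 * y) ^ r / fact r) \<longlonglongrightarrow> 0"
    using summable_LIMSEQ_zero[OF summable_exp[of "2 * y"]] by (simp add: field_simps)
  ultimately have "(\<lambda>r. (real r powr \<kappa> / 2 ^ r) * ((2 * y) ^ r / fact r)) \<longlonglongrightarrow> 0"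
    by (rule tendsto_mult_zero)
  then show ?thesis by (simp add: power_mult_distrib mult_ac)
qed

section \<open>The Gamma integral of a power against the Poisson kernel\<close>

lemma Gamma_fact_ratio:
  assumes "z > 0"
  shows "(\<lambda>n. Gamma (real n + 1 + z) / (fact n * real n powr z)) \<longlonglongrightarrow> 1"
proof -
  have nz: "z \<notin> \<int>\<^sub>\<le>\<^sub>0" using assms by (auto elim: nonpos_Ints_cases)
  have G: "Gamma z > 0" using assms by (rule Gamma_real_pos)
  have "(\<lambda>n. Gamma z / Gamma_series z n) \<longlonglongrightarrow> Gamma z / Gamma z"
    using G by (intro tendsto_intros Gamma_series_LIMSEQ) auto
  moreover have "eventually (\<lambda>n. Gamma z / Gamma_series z n = Gamma (real n + 1 + z) / (fact n * real n powr z)) at_top"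
    using eventually_gt_at_top[of 0]
  proof eventually_elim
    case (elim n)
    have "pochhammer z (n + 1) = Gamma (real n + 1 + z) / Gamma z"
      using pochhammer_Gamma[OF nz, of "n + 1"] by (simp add: add_ac)
    then show ?case
      using G elim by (simp add: Gamma_series_def powr_def)
  qed
  ultimately show ?thesis using G by (auto elim: Lim_transform_eventually)
qed

text \<open>Gauss' product formula describes \<open>\<Gamma>(n + 1 + z)\<close> only for \<open>z\<close> away from the poles, whereas \<open>-\<kappa>\<close> may be
a negative integer. Writing \<open>\<kappa> = m - \<theta>\<close> with \<open>\<theta> > 0\<close> and a natural number \<open>m\<close>, both numerator and
denominator become values at positive shifts of \<open>n = r - m\<close>.\<close>

lemma power_decay_Gamma_fact:
  assumes "\<kappa> > 0"
  shows "power_decay (\<lambda>r. Gamma (real r + 1 - \<kappa>) / fact r) \<kappa> 1"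
proof -
  \<comment> \<open>The summand 1 keeps \<open>\<theta>\<close> positive when \<open>\<kappa>\<close> is an integer.\<close>
  define m where "m = nat \<lfloor>\<kappa>\<rfloor> + 1"
  define \<theta> where "\<theta> = real m - \<kappa>"
  have m: "m > 0" and \<theta>: "\<theta> > 0" unfolding \<theta>_def m_def using assms by linarith+
  have "(\<lambda>n. (Gamma (real n + 1 + \<theta>) / (fact n * real n powr \<theta>)) /
      (Gamma (real n + 1 + real m) / (fact n * real n powr real m))) \<longlonglongrightarrow> 1 / 1"
    by (intro tendsto_divide Gamma_fact_ratio) (use m \<theta> in auto)
  then have "(\<lambda>n. Gamma (real n + 1 + \<theta>) / Gamma (real n + 1 + real m) * (real n powr real m / real n powr \<theta>)) \<longlonglongrightarrow> 1"
    by (simp add: mult_ac)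
  then have "(\<lambda>n. Gamma (real (n + m) + 1 - \<kappa>) / fact (n + m) * real n powr \<kappa>) \<longlonglongrightarrow> 1"
  proof (rule Lim_transform_eventually)
    have 1: "Gamma (real n + 1 + real m) = fact (n + m)" for n
      using Gamma_fact[where 'a = real, of "n + m"] by (simp add: add_ac)
    have 2: "real n powr real m / real n powr \<theta> = real n powr \<kappa>" for n
      by (simp add: powr_diff[symmetric] \<theta>_def)
    have 3: "real n + 1 + \<theta> = real (n + m) + 1 - \<kappa>" for n by (simp add: \<theta>_def)
    show "eventually (\<lambda>n. Gamma (real n + 1 + \<theta>) / Gamma (real n + 1 + real m) * (real n powr real m / real n powr \<theta>)
        = Gamma (real (n + m) + 1 - \<kappa>) / fact (n + m) * real n powr \<kappa>) at_top"
      by (intro always_eventually allI) (simp only: 1 2 3)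
  qed
  then have "power_decay (\<lambda>n. Gamma (real (n + m) + 1 - \<kappa>) / fact (n + m)) \<kappa> 1"
    by (simp only: power_decay_def)
  then show ?thesis
    by (rule iffD1[OF power_decay_shift[of "\<lambda>r. Gamma (real r + 1 - \<kappa>) / fact r" m]])
qed

lemma has_bochner_integral_powr_poisson_prob:
  assumes s: "s > 0" and r: "real r + 1 > \<kappa>"
  shows "has_bochner_integral lborel (\<lambda>t. indicator {0<..} t * t powr (-\<kappa>) * poisson_prob (t * s) r)
    (s powr (\<kappa> - 1) * (Gamma (real r + 1 - \<kappa>) / fact r))"
proof -
  define z where "z = real r + 1 - \<kappa>"
  have z: "z > 0" using r by (simp add: z_def)
  have "(\<integral>\<^sup>+t. ennreal (indicator {0..} t * t powr (z - 1) / exp t) \<partial>lborel) = ennreal (Gamma z)"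
    using Gamma_conv_nn_integral_real[OF z] by simp
  then have "has_bochner_integral lborel (\<lambda>t. indicator {0..} t * t powr (z - 1) / exp t) (Gamma z)"
    using Gamma_real_pos[OF z] by (intro has_bochner_integral_nn_integral) auto
  then have "has_bochner_integral lborel
      (\<lambda>t. indicator {0..} (0 + s * t) * (0 + s * t) powr (z - 1) / exp (0 + s * t)) (Gamma z /\<^sub>R \<bar>s\<bar>)"
    using s by (subst (asm) lborel_has_bochner_integral_real_affine_iff[where c = s and t = 0]) auto
  then have "has_bochner_integral lborel
      (\<lambda>t. s powr \<kappa> / fact r * (indicator {0..} (s * t) * (s * t) powr (z - 1) / exp (s * t)))
      (s powr \<kappa> / fact r * (Gamma z / s))"
    using s by (intro has_bochner_integral_mult_right) (simp add: divide_inverse mult.commute)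
  also have "s powr \<kappa> / fact r * (Gamma z / s) = s powr (\<kappa> - 1) * (Gamma z / fact r)"
    using s by (simp add: powr_diff)
  finally show ?thesis
    unfolding z_def[symmetric]
  proof (rule has_bochner_integral_cong[THEN iffD1, rotated -1])
    fix t :: real
    show "s powr \<kappa> / fact r * (indicator {0..} (s * t) * (s * t) powr (z - 1) / exp (s * t)) =
         indicator {0<..} t * t powr (-\<kappa>) * poisson_prob (t * s) r"
    proof (cases "t > 0")
      case True
      have "(s * t) powr (z - 1) = (s * t) ^ r * (s * t) powr (-\<kappa>)"
        using True s by (simp add: z_def powr_add[symmetric] powr_realpow[symmetric])
      also have "(s * t) powr (-\<kappa>) = t powr (-\<kappa>) / s powr \<kappa>"
        using True s by (simp add: powr_mult powr_minus_divide)
      finally show ?thesis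
        using True s by (simp add: poisson_prob_def exp_minus mult_ac divide_inverse)
    qed (use s in \<open>auto simp: indicator_def zero_le_mult_iff\<close>)
  qed auto
qed

section \<open>Poisson mixtures of power laws\<close>

text \<open>Beyond a threshold \<open>T\<close> the density is within \<open>\<epsilon> t\<^sup>-\<^sup>\<kappa>\<close> of \<open>c t\<^sup>-\<^sup>\<kappa>\<close>, whose mixture is the explicit Gamma
integral. Below \<open>T\<close> the Poisson kernel is at most \<open>(T s)\<^sup>r / r!\<close>, which is negligible against every power.\<close>

lemma power_decay_poisson_mixture_density:
  fixes f :: "real \<Rightarrow> real"
  assumes f: "\<And>t. f t \<ge> 0" "integrable lborel f" "\<And>t. t \<le> 0 \<Longrightarrow> f t = 0"
    and lim: "((\<lambda>t. f t / t powr (-\<kappa>)) \<longlongrightarrow> c) at_top"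
    and pos: "\<kappa> > 0" "c \<ge> 0" "s > 0"
  shows "power_decay (\<lambda>r. \<integral>t. f t * poisson_prob (t * s) r \<partial>lborel) \<kappa> (c * s powr (\<kappa> - 1))"
proof -
  define g where "g = (\<lambda>t::real. indicator {0<..} t * t powr (-\<kappa>))"
  define J where "J = (\<lambda>r. \<integral>t. g t * poisson_prob (t * s) r \<partial>lborel)"
  define Q where "Q = (\<lambda>r. \<integral>t. f t * poisson_prob (t * s) r \<partial>lborel)"
  have kernel: "has_bochner_integral lborel (\<lambda>t. g t * poisson_prob (t * s) r)
      (s powr (\<kappa> - 1) * (Gamma (real r + 1 - \<kappa>) / fact r))" if "real r \<ge> \<kappa>" for r
    unfolding g_def by (rule has_bochner_integral_powr_poisson_prob) (use that pos in auto)
  have large: "eventually (\<lambda>r. real r \<ge> \<kappa>) at_top"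
    using filterlim_real_sequentially unfolding filterlim_at_top by blast
  have J: "power_decay J \<kappa> (s powr (\<kappa> - 1))"
  proof -
    have "power_decay (\<lambda>r. s powr (\<kappa> - 1) * (Gamma (real r + 1 - \<kappa>) / fact r)) \<kappa> (s powr (\<kappa> - 1) * 1)"
      by (intro power_decay_cmult power_decay_Gamma_fact pos)
    moreover have "eventually (\<lambda>r. s powr (\<kappa> - 1) * (Gamma (real r + 1 - \<kappa>) / fact r) = J r) at_top"
      using large by eventually_elim (unfold J_def, rule has_bochner_integral_integral_eq[OF kernel, symmetric])
    ultimately show ?thesis by (subst (asm) power_decay_cong) auto
  qed
  have intf: "integrable lborel (\<lambda>t. f t * poisson_prob (t * s) r)" for r
  proof (rule integrable_mult_poisson_prob[OF f(2)])
    show "AE t in lborel. f t = 0 \<or> 0 \<le> t * s"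
      using f(3) pos(3) by (intro always_eventually) (metis less_eq_real_def linorder_le_cases mult_nonneg_nonneg)
  qed simp
  have "(\<lambda>r. (Q r - c * J r) * real r powr \<kappa>) \<longlonglongrightarrow> 0"
  proof (rule LIMSEQ_I)
    fix e :: real assume e: "e > 0"
    \<comment> \<open>The tail error is \<open>\<epsilon>\<close> times a quantity that converges to \<open>s\<^sup>\<kappa>\<^sup>-\<^sup>1\<close>.\<close>
    define \<epsilon> where "\<epsilon> = e / (2 * (s powr (\<kappa> - 1) + 1))"
    have \<epsilon>: "\<epsilon> > 0" unfolding \<epsilon>_def using e by (intro divide_pos_pos) (auto intro: add_nonneg_pos)
    have "eventually (\<lambda>t. \<bar>f t / t powr (-\<kappa>) - c\<bar> < \<epsilon>) at_top"
      using tendstoD[OF lim \<epsilon>] by (simp add: dist_real_def)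
    then obtain T0 where T0: "\<And>t. t \<ge> T0 \<Longrightarrow> \<bar>f t / t powr (-\<kappa>) - c\<bar> < \<epsilon>"
      unfolding eventually_at_top_linorder by blast
    define T where "T = max T0 1"
    have T: "T > 0" unfolding T_def by simp
    have close: "\<bar>f t - c * t powr (-\<kappa>)\<bar> \<le> \<epsilon> * t powr (-\<kappa>)" if "t \<ge> T" for t
    proof -
      have p: "t powr (-\<kappa>) > 0" and "t \<ge> T0" using that T unfolding T_def by auto
      have "f t - c * t powr (-\<kappa>) = (f t / t powr (-\<kappa>) - c) * t powr (-\<kappa>)"
        using p by (simp add: left_diff_distrib)
      then have "\<bar>f t - c * t powr (-\<kappa>)\<bar> = \<bar>f t / t powr (-\<kappa>) - c\<bar> * t powr (-\<kappa>)"
        by (simp only: abs_mult abs_of_pos[OF p])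
      also have "\<dots> \<le> \<epsilon> * t powr (-\<kappa>)"
        using T0[OF \<open>t \<ge> T0\<close>] p by (intro mult_right_mono) auto
      finally show ?thesis .
    qed
    define R where "R = (\<lambda>r. (T * s) ^ r / fact r)"
    define C where "C = (\<integral>t. f t \<partial>lborel) + c * T powr (-\<kappa>) * T"
    have bound: "\<bar>Q r - c * J r\<bar> \<le> R r * C + \<epsilon> * J r" if r: "real r \<ge> \<kappa>" for r
    proof -
      have intg: "integrable lborel (\<lambda>t. g t * poisson_prob (t * s) r)"
        using kernel[OF r] by (rule has_bochner_integral_iff[THEN iffD1, THEN conjunct1])
      have inti: "integrable lborel (indicator {0..T} :: real \<Rightarrow> real)"
        using T by (intro integrable_real_indicator) auto
      have R0: "R r \<ge> 0" unfolding R_def using T pos by simp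
      have dom: "\<bar>f t * poisson_prob (t * s) r - c * (g t * poisson_prob (t * s) r)\<bar>
          \<le> R r * (f t + c * T powr (-\<kappa>) * indicator {0..T} t) + \<epsilon> * (g t * poisson_prob (t * s) r)" for t
      proof -
        consider "t \<le> 0" | "0 < t" "t < T" | "t \<ge> T" "t > 0" using T by linarith
        then show ?thesis
        proof cases
          case 1
          then show ?thesis using f(3)[OF 1] R0 pos by (simp add: g_def)
        next
          case 2
          have nn: "poisson_prob (t * s) r \<ge> 0" using 2 pos by (intro poisson_prob_nonneg) auto
          have "poisson_prob (t * s) r \<le> (t * s) ^ r / fact r"
            using 2 pos by (intro poisson_prob_le_power) auto
          also have "\<dots> \<le> R r"
            unfolding R_def using 2 pos by (intro divide_right_mono power_mono) auto
          finally have le: "poisson_prob (t * s) r \<le> R r" .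
          have "t powr (-\<kappa>) * poisson_prob (t * s) r \<le> t powr (-\<kappa>) * ((t * s) ^ r / fact r)"
            using 2 pos by (intro mult_left_mono poisson_prob_le_power) auto
          also have "\<dots> = t powr (real r - \<kappa>) * (s ^ r / fact r)"
            using 2 by (simp add: powr_diff powr_minus powr_realpow power_mult_distrib divide_inverse mult_ac)
          also have "\<dots> \<le> T powr (real r - \<kappa>) * (s ^ r / fact r)"
            using 2 r pos by (intro mult_right_mono powr_mono2) auto
          also have "\<dots> = T powr (-\<kappa>) * R r"
            using T by (simp add: R_def powr_diff powr_minus powr_realpow power_mult_distrib divide_inverse mult_ac)
          finally have le2: "g t * poisson_prob (t * s) r \<le> T powr (-\<kappa>) * R r" using 2 by (simp add: g_def)
          have gn: "g t * poisson_prob (t * s) r \<ge> 0" using nn by (simp add: g_def)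
          have "\<bar>f t * poisson_prob (t * s) r - c * (g t * poisson_prob (t * s) r)\<bar>
              \<le> f t * poisson_prob (t * s) r + c * (g t * poisson_prob (t * s) r)"
            using nn gn f(1)[of t] pos by (intro abs_leI) (auto simp: algebra_simps)
          also have "\<dots> \<le> f t * R r + c * (T powr (-\<kappa>) * R r)"
            using le le2 f(1) pos by (intro add_mono mult_left_mono) auto
          also have "\<dots> = R r * (f t + c * T powr (-\<kappa>) * indicator {0..T} t)"
            using 2 by (simp add: algebra_simps)
          also have "\<dots> \<le> \<dots> + \<epsilon> * (g t * poisson_prob (t * s) r)"
            using gn \<epsilon> by simp
          finally show ?thesis .
        next
          case 3
          have nn: "poisson_prob (t * s) r \<ge> 0" using 3 pos by (intro poisson_prob_nonneg) auto
          have "f t * poisson_prob (t * s) r - c * (g t * poisson_prob (t * s) r)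
              = (f t - c * t powr (-\<kappa>)) * poisson_prob (t * s) r"
            using 3 by (simp add: g_def left_diff_distrib)
          then have "\<bar>f t * poisson_prob (t * s) r - c * (g t * poisson_prob (t * s) r)\<bar>
              = \<bar>f t - c * t powr (-\<kappa>)\<bar> * poisson_prob (t * s) r"
            by (simp only: abs_mult abs_of_nonneg[OF nn])
          also have "\<dots> \<le> \<epsilon> * t powr (-\<kappa>) * poisson_prob (t * s) r"
            using close[OF 3(1)] nn by (intro mult_right_mono) auto
          also have "\<dots> \<le> R r * (f t + c * T powr (-\<kappa>) * indicator {0..T} t) + \<epsilon> * (g t * poisson_prob (t * s) r)"
            using 3 R0 f(1)[of t] pos by (simp add: g_def)
          finally show ?thesis .
        qed
      qed
      have "\<bar>Q r - c * J r\<bar> = \<bar>\<integral>t. f t * poisson_prob (t * s) r - c * (g t * poisson_prob (t * s) r) \<partial>lborel\<bar>"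
        unfolding Q_def J_def using intf intg by simp
      also have "\<dots> \<le> (\<integral>t. R r * (f t + c * T powr (-\<kappa>) * indicator {0..T} t) + \<epsilon> * (g t * poisson_prob (t * s) r) \<partial>lborel)"
        using f(2) intf intg inti dom
        by (intro order_trans[OF integral_abs_bound integral_mono]) auto
      also have "\<dots> = R r * C + \<epsilon> * J r"
        unfolding C_def J_def using f(2) intg inti T by simp
      finally show ?thesis .
    qed
    have "(\<lambda>r. R r * real r powr \<kappa> * C + \<epsilon> * (J r * real r powr \<kappa>)) \<longlonglongrightarrow> 0 * C + \<epsilon> * s powr (\<kappa> - 1)"
      unfolding R_def using J[unfolded power_decay_def]
      by (intro tendsto_intros fact_dominates_power_law)
    moreover have "0 * C + \<epsilon> * s powr (\<kappa> - 1) < e"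
    proof -
      have "\<epsilon> * s powr (\<kappa> - 1) < \<epsilon> * (2 * (s powr (\<kappa> - 1) + 1))"
        using \<epsilon> by (intro mult_strict_left_mono) (auto intro: add_nonneg_pos)
      also have "\<dots> = e"
        unfolding \<epsilon>_def by (simp add: add_nonneg_eq_0_iff)
      finally show ?thesis by simp
    qed
    ultimately have "eventually (\<lambda>r. R r * real r powr \<kappa> * C + \<epsilon> * (J r * real r powr \<kappa>) < e) at_top"
      by (rule order_tendstoD(2))
    then have "eventually (\<lambda>r. norm ((Q r - c * J r) * real r powr \<kappa> - 0) < e) at_top"
      using large
    proof eventually_elim
      case (elim r)
      have "norm ((Q r - c * J r) * real r powr \<kappa> - 0) = \<bar>Q r - c * J r\<bar> * real r powr \<kappa>"
        by (simp add: abs_mult)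
      also have "\<dots> \<le> (R r * C + \<epsilon> * J r) * real r powr \<kappa>"
        by (intro mult_right_mono bound elim) simp
      also have "\<dots> = R r * real r powr \<kappa> * C + \<epsilon> * (J r * real r powr \<kappa>)"
        by (simp add: algebra_simps)
      finally show ?case using elim(1) by linarith
    qed
    then show "\<exists>no. \<forall>n\<ge>no. norm ((Q n - c * J n) * real n powr \<kappa> - 0) < e"
      by (simp add: eventually_sequentially)
  qed
  then have "power_decay (\<lambda>r. Q r - c * J r) \<kappa> 0" by (simp add: power_decay_def)
  from power_decay_add[OF this power_decay_cmult[OF J, of c]] show ?thesis
    by (simp add: Q_def)
qed

text \<open>With \<open>x = 1 - u / (r + 1)\<close> the left-hand side is \<open>p \<bar>x\<bar>\<close> for the probability \<open>p\<close> at \<open>r\<close>, and the bracket on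
the right, which is nearly a second difference, is \<open>p x\<^sup>2\<close>; the inequality is
\<open>2 \<bar>x\<bar> \<le> x\<^sup>2 / e + e\<close>. It replaces an absolute value by a linear expression, which can be integrated against
a density: the second difference of a regularly decaying sequence is negligible, and \<open>e\<close> is arbitrary.\<close>

lemma abs_diff_poisson_prob_le:
  assumes u: "u \<ge> 0" and e: "e > 0"
  shows "\<bar>poisson_prob u r - poisson_prob u (Suc r)\<bar>
    \<le> ((poisson_prob u r - 2 * poisson_prob u (Suc r)
          + (real r + 2) / (real r + 1) * poisson_prob u (Suc (Suc r))) / e + e * poisson_prob u r) / 2"
proof -
  define p where "p = poisson_prob u r"
  define x where "x = 1 - u / (real r + 1)"
  have p: "p \<ge> 0" unfolding p_def using u by (rule poisson_prob_nonneg)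
  have 1: "poisson_prob u (Suc r) = p * (1 - x)"
    using poisson_prob_Suc[of r u] unfolding p_def x_def by (simp add: field_simps)
  have 2: "(real r + 2) / (real r + 1) * poisson_prob u (Suc (Suc r)) = p * (1 - x)\<^sup>2"
  proof -
    have "(real r + 2) * poisson_prob u (Suc (Suc r)) = u * poisson_prob u (Suc r)"
      using poisson_prob_Suc[of "Suc r" u] by (simp add: add_ac)
    then have "(real r + 2) / (real r + 1) * poisson_prob u (Suc (Suc r)) = (1 - x) * poisson_prob u (Suc r)"
      by (simp add: x_def)
    then show ?thesis by (simp add: 1 power2_eq_square mult_ac)
  qed
  have "\<bar>x\<bar> \<le> (x\<^sup>2 / e + e) / 2"
  proof -
    have "0 \<le> (\<bar>x\<bar> - e)\<^sup>2 / e" using e by simp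
    also have "\<dots> = x\<^sup>2 / e + e - 2 * \<bar>x\<bar>"
      using e by (simp add: power2_diff add_divide_distrib diff_divide_distrib power2_eq_square[of e])
    finally show ?thesis by simp
  qed
  then have le: "p * \<bar>x\<bar> \<le> p * ((x\<^sup>2 / e + e) / 2)" using p by (rule mult_left_mono)
  have "\<bar>p - p * (1 - x)\<bar> = p * \<bar>x\<bar>"
    using p by (simp add: right_diff_distrib abs_mult)
  also note le
  also have "p * ((x\<^sup>2 / e + e) / 2) = ((p - 2 * (p * (1 - x)) + p * (1 - x)\<^sup>2) / e + e * p) / 2"
    using e by (simp add: field_simps power2_eq_square)
  finally show ?thesis unfolding 1 2 p_def[symmetric] .
qed

lemma has_real_derivative_poisson_prob:
  "((\<lambda>t. poisson_prob (t * s) (Suc r)) has_real_derivative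
      s * (poisson_prob (t * s) r - poisson_prob (t * s) (Suc r))) (at t)"
proof -
  have "((\<lambda>t. exp (-(t * s)) * (t * s) ^ Suc r / fact (Suc r)) has_real_derivative
      (exp (-(t * s)) * (- s) * (t * s) ^ Suc r + exp (-(t * s)) * (real (Suc r) * (t * s) ^ r * s)) / fact (Suc r)) (at t)"
    by (rule derivative_eq_intros refl | simp)+
  moreover have "(exp (-(t * s)) * (- s) * (t * s) ^ Suc r + exp (-(t * s)) * (real (Suc r) * (t * s) ^ r * s)) / fact (Suc r)
      = s * (poisson_prob (t * s) r - poisson_prob (t * s) (Suc r))"
    by (simp add: poisson_prob_def add_divide_distrib right_diff_distrib divide_simps)
  ultimately show ?thesis by (simp add: poisson_prob_def)
qed

text \<open>The oscillation of the Poisson kernel over a unit interval of rates is at most the integral of its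
absolute derivative there. The interval is half open so that consecutive ones partition the half-line.\<close>

lemma poisson_prob_average_diff:
  fixes n r :: nat
  assumes s: "s > 0"
  defines "D \<equiv> \<lambda>t. s * \<bar>poisson_prob (t * s) r - poisson_prob (t * s) (Suc r)\<bar>"
  defines "I \<equiv> {real n <.. real n + 1}"
  shows "\<bar>poisson_prob ((real n + 1) * s) (Suc r) - (\<integral>t. indicator I t * poisson_prob (t * s) (Suc r) \<partial>lborel)\<bar>
    \<le> (\<integral>t. indicator I t * D t \<partial>lborel)"
proof -
  define P where "P = (\<lambda>t. poisson_prob (t * s) (Suc r))"
  define P' where "P' = (\<lambda>t. s * (poisson_prob (t * s) r - poisson_prob (t * s) (Suc r)))"
  define E where "E = (\<integral>t. indicator I t * D t \<partial>lborel)"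
  have D: "D t = \<bar>P' t\<bar>" for t using s by (simp add: D_def P'_def abs_mult)
  have [measurable]: "P \<in> borel_measurable borel" "P' \<in> borel_measurable borel" "D \<in> borel_measurable borel"
    "I \<in> sets borel"
    unfolding P_def P'_def D_def I_def by measurable
  have intI: "integrable lborel (\<lambda>t. indicator I t * b :: real)" for b
    by (intro integrable_mult_left integrable_real_indicator) (auto simp: I_def)
  have bnd: "integrable lborel (\<lambda>t. indicator J t * h t :: real)"
    if "J \<subseteq> I" "J \<in> sets borel" "h \<in> borel_measurable borel" "\<And>t. t \<in> I \<Longrightarrow> \<bar>h t\<bar> \<le> b" for J h b
    by (rule Bochner_Integration.integrable_bound[OF intI[of b]])
      (use that in \<open>auto simp: indicator_def intro!: always_eventually order_trans[OF _ abs_ge_self]\<close>)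
  have P01: "0 \<le> poisson_prob (t * s) k" "poisson_prob (t * s) k \<le> 1" if "t \<in> I" for t k
    using that s by (auto simp: I_def intro!: poisson_prob_nonneg poisson_prob_le_1)
  have P1: "\<bar>P t\<bar> \<le> 1" if "t \<in> I" for t
    using P01[OF that] by (simp add: P_def)
  have D1: "\<bar>D t\<bar> \<le> s" if "t \<in> I" for t
    using P01[OF that, of r] P01[OF that, of "Suc r"] s by (simp add: D_def abs_mult mult_left_le abs_le_iff)
  have pt: "\<bar>P (real n + 1) - P t\<bar> \<le> E" if t: "t \<in> I" for t
  proof -
    have sub: "{t..real n + 1} \<subseteq> I" using t by (auto simp: I_def)
    have "(\<integral>x. P' x * indicator {t..real n + 1} x \<partial>lborel) = P (real n + 1) - P t"
    proof (rule integral_FTC_Icc_real)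
      show "t \<le> real n + 1" using t by (simp add: I_def)
      show "DERIV P x :> P' x" for x
        unfolding P_def P'_def by (rule has_real_derivative_poisson_prob)
      show "isCont P' x" for x
        unfolding P'_def poisson_prob_def by (intro continuous_intros) auto
    qed
    then have "\<bar>P (real n + 1) - P t\<bar> = \<bar>\<integral>x. indicator {t..real n + 1} x * P' x \<partial>lborel\<bar>"
      by (simp add: mult.commute)
    also have "\<dots> \<le> (\<integral>x. \<bar>indicator {t..real n + 1} x * P' x\<bar> \<partial>lborel)"
      by (rule integral_abs_bound)
    also have "\<dots> = (\<integral>x. indicator {t..real n + 1} x * D x \<partial>lborel)"
      by (intro Bochner_Integration.integral_cong) (auto simp: D indicator_def)
    also have "\<dots> \<le> E"
      unfolding E_def
    proof (rule integral_mono)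
      show "integrable lborel (\<lambda>x. indicator {t..real n + 1} x * D x)"
        by (rule bnd[OF sub _ _ D1]) auto
      show "integrable lborel (\<lambda>x. indicator I x * D x)"
        by (rule bnd[OF subset_refl _ _ D1]) auto
    qed (use sub D in \<open>auto simp: indicator_def\<close>)
    finally show ?thesis .
  qed
  have m: "(\<integral>t. indicator I t \<partial>lborel) = (1::real)" by (simp add: I_def)
  have intP: "integrable lborel (\<lambda>t. indicator I t * P t)"
    by (rule bnd[OF subset_refl _ _ P1]) auto
  have "P (real n + 1) - (\<integral>t. indicator I t * P t \<partial>lborel)
      = (\<integral>t. indicator I t * P (real n + 1) - indicator I t * P t \<partial>lborel)"
    using intI intP m by simp
  also have "\<bar>\<dots>\<bar> \<le> (\<integral>t. indicator I t * E \<partial>lborel)"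
  proof (rule order_trans[OF integral_abs_bound integral_mono])
    show "integrable lborel (\<lambda>t. \<bar>indicator I t * P (real n + 1) - indicator I t * P t\<bar>)"
      using intI intP by (intro integrable_abs Bochner_Integration.integrable_diff)
  qed (use pt intI in \<open>auto simp: indicator_def\<close>)
  also have "\<dots> = E" using m by simp
  finally show ?thesis unfolding P_def E_def .
qed

text \<open>The weights define a step density with the same tail, to which the statement for densities applies. Replacing
the values of the Poisson kernel at lattice points by averages over unit intervals costs at most the
integral of the step density against the absolute derivative of the kernel, which
\<open>abs_diff_poisson_prob_le\<close> bounds by the density mixture at three consecutive indices.\<close>

lemma power_decay_poisson_mixture_weights:
  assumes w: "\<And>n. w n \<ge> 0" "power_decay w \<kappa> c" and \<kappa>: "\<kappa> > 1" and s: "s > 0"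
  shows "power_decay (\<lambda>r. \<Sum>n. w n * poisson_prob (real n * s) r) \<kappa> (c * s powr (\<kappa> - 1))"
proof -
  define I where "I = (\<lambda>n. {real n <.. real n + 1})"
  \<comment> \<open>The weight \<open>w 0\<close> is dropped: it multiplies the Poisson probability of rate 0, which vanishes at positive indices.\<close>
  define f where "f = (\<lambda>t::real. if t > 0 then w (nat \<lceil>t\<rceil>) else 0)"
  define C where "C = c * s powr (\<kappa> - 1)"
  define a where "a = (\<lambda>r. \<integral>t. f t * poisson_prob (t * s) r \<partial>lborel)"
  define b where "b = (\<lambda>r. \<Sum>n. w n * poisson_prob (real n * s) r)"
  define D where "D = (\<lambda>r t. s * \<bar>poisson_prob (t * s) r - poisson_prob (t * s) (Suc r)\<bar>)"
  have c: "c \<ge> 0"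
    using w(2) unfolding power_decay_def by (rule LIMSEQ_le_const) (use w(1) in auto)
  have sw: "summable w"
    using power_decay_summable[OF w(2) \<kappa>] w(1) by simp
  then have sw': "summable (\<lambda>n. w (Suc n))" by (simp add: summable_Suc_iff)
  have f0: "f t \<ge> 0" for t using w(1) by (simp add: f_def)
  have fm [measurable]: "f \<in> borel_measurable borel" unfolding f_def by measurable
  have Im [measurable]: "I n \<in> sets borel" for n unfolding I_def by simp
  have I_iff: "t \<in> I n \<longleftrightarrow> t > 0 \<and> nat \<lceil>t\<rceil> = Suc n" for t n
    unfolding I_def by (auto simp: nat_eq_iff ceiling_eq_iff)
  have step: "(\<lambda>n. w (Suc n) * (indicator (I n) t * \<psi> t)) sums (f t * \<psi> t)" for t and \<psi> :: "real \<Rightarrow> real"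
  proof (cases "t > 0")
    case True
    then obtain k where k: "nat \<lceil>t\<rceil> = Suc k" by (cases "nat \<lceil>t\<rceil>") auto
    have "(\<lambda>n. if n = k then w (Suc k) * \<psi> t else 0) sums (w (Suc k) * \<psi> t)"
      by (rule sums_single)
    moreover have "(\<lambda>n. if n = k then w (Suc k) * \<psi> t else 0) = (\<lambda>n. w (Suc n) * (indicator (I n) t * \<psi> t))"
      using True k by (auto simp: indicator_def I_iff)
    ultimately show ?thesis using True k by (simp add: f_def)
  next
    case False
    then show ?thesis by (simp add: f_def I_iff indicator_def)
  qed
  have intf: "integrable lborel f"
  proof (rule integrable_sums_nonneg)
    show "integrable lborel (\<lambda>t. w (Suc n) * (indicator (I n) t * 1))" for n
      by (intro integrable_mult_right integrable_mult_left integrable_real_indicator) (auto simp: I_def)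
    show "AE t in lborel. (\<lambda>n. w (Suc n) * (indicator (I n) t * 1)) sums f t"
      using step[of _ "\<lambda>_. 1"] by simp
    have eq: "(\<integral>t. w (Suc n) * (indicator (I n) t * 1) \<partial>lborel) = w (Suc n)" for n
      by (simp add: I_def)
    show "summable (\<lambda>n. \<integral>t. w (Suc n) * (indicator (I n) t * 1) \<partial>lborel)"
      unfolding eq by (rule sw')
  qed (use w(1) in auto)
  have intP: "integrable lborel (\<lambda>t. f t * poisson_prob (t * s) r)" for r
  proof (rule integrable_mult_poisson_prob[OF intf])
    show "AE t in lborel. f t = 0 \<or> 0 \<le> t * s"
      using s by (intro always_eventually) (simp add: f_def)
  qed simp
  have "((\<lambda>t. f t / t powr (-\<kappa>)) \<longlongrightarrow> c) at_top"
  proof -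
    have "filterlim (\<lambda>t::real. nat \<lceil>t\<rceil>) at_top at_top"
      unfolding filterlim_at_top
    proof
      fix k :: nat
      show "eventually (\<lambda>t::real. k \<le> nat \<lceil>t\<rceil>) at_top"
        using eventually_ge_at_top[of "real k"] by eventually_elim linarith
    qed
    from filterlim_compose[OF w(2)[unfolded power_decay_def] this]
    have "((\<lambda>t::real. w (nat \<lceil>t\<rceil>) * real (nat \<lceil>t\<rceil>) powr \<kappa>) \<longlongrightarrow> c) at_top" .
    moreover have "(\<lambda>t::real. w (nat \<lceil>t\<rceil>) * real (nat \<lceil>t\<rceil>) powr \<kappa>) \<sim>[at_top] (\<lambda>t. f t / t powr (-\<kappa>))"
    proof -
      have "(\<lambda>t. real_of_int \<lceil>t\<rceil> powr \<kappa>) \<sim>[at_top] (\<lambda>t. t powr \<kappa>)"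
      proof (rule asymp_equivI')
        have "((\<lambda>t. real_of_int \<lceil>t\<rceil> / t) \<longlongrightarrow> 1) at_top" by real_asymp
        then have "((\<lambda>t. (real_of_int \<lceil>t\<rceil> / t) powr \<kappa>) \<longlongrightarrow> 1 powr \<kappa>) at_top"
          by (intro tendsto_powr tendsto_const) auto
        then show "((\<lambda>t. real_of_int \<lceil>t\<rceil> powr \<kappa> / t powr \<kappa>) \<longlongrightarrow> 1) at_top"
          by (simp add: powr_divide)
      qed
      then have "(\<lambda>t. w (nat \<lceil>t\<rceil>) * real_of_int \<lceil>t\<rceil> powr \<kappa>) \<sim>[at_top] (\<lambda>t. w (nat \<lceil>t\<rceil>) * t powr \<kappa>)"
        by (intro asymp_equiv_mult) auto
      moreover have "eventually (\<lambda>t. w (nat \<lceil>t\<rceil>) * real_of_int \<lceil>t\<rceil> powr \<kappa> = w (nat \<lceil>t\<rceil>) * real (nat \<lceil>t\<rceil>) powr \<kappa>) at_top"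
        using eventually_gt_at_top[of 0] by eventually_elim simp
      moreover have "eventually (\<lambda>t. w (nat \<lceil>t\<rceil>) * t powr \<kappa> = f t / t powr (-\<kappa>)) at_top"
        using eventually_gt_at_top[of 0] by eventually_elim (simp add: f_def powr_minus_divide)
      ultimately show ?thesis by (rule asymp_equiv_transfer)
    qed
    ultimately show ?thesis using tendsto_asymp_equiv_cong by blast
  qed
  then have a: "power_decay a \<kappa> C"
    unfolding a_def C_def using f0 intf \<kappa> c s
    by (intro power_decay_poisson_mixture_density) (auto simp: f_def)
  have D_le: "f t * D r t \<le> f t * (s / 2 * ((poisson_prob (t * s) r - 2 * poisson_prob (t * s) (Suc r)
          + (real r + 2) / (real r + 1) * poisson_prob (t * s) (Suc (Suc r))) / e + e * poisson_prob (t * s) r))"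
    if "e > 0" for e r t
  proof (cases "t > 0")
    case True
    then have "t * s \<ge> 0" using s by simp
    from mult_left_mono[OF abs_diff_poisson_prob_le[OF this \<open>e > 0\<close>, of r] less_imp_le[OF s]]
    show ?thesis
      unfolding D_def by (intro mult_left_mono f0) (simp add: mult.assoc)
  qed (simp add: f_def)
  have intD: "integrable lborel (\<lambda>t. f t * D r t)" for r
  proof (rule Bochner_Integration.integrable_bound)
    show "integrable lborel (\<lambda>t. s * (f t * poisson_prob (t * s) r + f t * poisson_prob (t * s) (Suc r)))"
      using intP by (intro integrable_mult_right Bochner_Integration.integrable_add)
    show "AE t in lborel. norm (f t * D r t)
        \<le> norm (s * (f t * poisson_prob (t * s) r + f t * poisson_prob (t * s) (Suc r)))"
    proof (intro always_eventually allI)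
      fix t
      show "norm (f t * D r t) \<le> norm (s * (f t * poisson_prob (t * s) r + f t * poisson_prob (t * s) (Suc r)))"
      proof (cases "t > 0")
        case True
        have nn: "poisson_prob (t * s) k \<ge> 0" for k using True s by (intro poisson_prob_nonneg) simp
        have "\<bar>poisson_prob (t * s) r - poisson_prob (t * s) (Suc r)\<bar> \<le> poisson_prob (t * s) r + poisson_prob (t * s) (Suc r)"
          using nn[of r] nn[of "Suc r"] by linarith
        then have "f t * D r t \<le> f t * (s * (poisson_prob (t * s) r + poisson_prob (t * s) (Suc r)))"
          unfolding D_def using s f0 by (intro mult_left_mono) auto
        moreover have "f t * D r t \<ge> 0" using f0 s by (simp add: D_def)
        ultimately show ?thesis by (simp add: algebra_simps)
      qed (simp add: f_def)
    qed
  qed (simp add: D_def)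
  have a_sums: "(\<lambda>n. w (Suc n) * (\<integral>t. indicator (I n) t * poisson_prob (t * s) r \<partial>lborel)) sums a r" for r
  proof -
    have "(\<lambda>n. \<integral>t. w (Suc n) * (indicator (I n) t * poisson_prob (t * s) r) \<partial>lborel) sums a r"
      unfolding a_def
    proof (rule sums_integral_nonneg[OF _ _ _ intP])
      show "AE t in lborel. 0 \<le> w (Suc n) * (indicator (I n) t * poisson_prob (t * s) r)" for n
        using w(1) s by (auto simp: I_iff indicator_def intro!: always_eventually mult_nonneg_nonneg poisson_prob_nonneg)
      show "AE t in lborel. (\<lambda>n. w (Suc n) * (indicator (I n) t * poisson_prob (t * s) r)) sums (f t * poisson_prob (t * s) r)"
        by (intro always_eventually allI step)
    qed simp
    then show ?thesis by simp
  qed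
  have D_sums: "(\<lambda>n. w (Suc n) * (\<integral>t. indicator (I n) t * D r t \<partial>lborel)) sums (\<integral>t. f t * D r t \<partial>lborel)" for r
  proof -
    have "(\<lambda>n. \<integral>t. w (Suc n) * (indicator (I n) t * D r t) \<partial>lborel) sums (\<integral>t. f t * D r t \<partial>lborel)"
    proof (rule sums_integral_nonneg[OF _ _ _ intD])
      show "AE t in lborel. 0 \<le> w (Suc n) * (indicator (I n) t * D r t)" for n
        using w(1) s by (auto simp: D_def)
      show "AE t in lborel. (\<lambda>n. w (Suc n) * (indicator (I n) t * D r t)) sums (f t * D r t)"
        by (intro always_eventually allI step)
    qed (simp add: D_def)
    then show ?thesis by simp
  qed
  have b_sums: "(\<lambda>n. w (Suc n) * poisson_prob ((real n + 1) * s) (Suc r)) sums b (Suc r)" for r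
  proof -
    have "summable (\<lambda>n. w n * poisson_prob (real n * s) (Suc r))"
      by (rule summable_comparison_test[OF _ sw])
        (use w(1) s poisson_prob_nonneg poisson_prob_le_1 in \<open>auto simp: abs_mult mult_left_le\<close>)
    then have "(\<lambda>n. w n * poisson_prob (real n * s) (Suc r)) sums b (Suc r)"
      unfolding b_def by (rule summable_sums)
    then have "(\<lambda>n. w (Suc n) * poisson_prob (real (Suc n) * s) (Suc r)) sums b (Suc r)"
      by (subst sums_Suc_iff) (simp add: poisson_prob_def)
    then show ?thesis by (simp add: add.commute)
  qed
  have ba: "\<bar>b (Suc r) - a (Suc r)\<bar> \<le> (\<integral>t. f t * D r t \<partial>lborel)" for r
  proof -
    have 1: "(\<lambda>n. w (Suc n) * poisson_prob ((real n + 1) * s) (Suc r)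
        - w (Suc n) * (\<integral>t. indicator (I n) t * poisson_prob (t * s) (Suc r) \<partial>lborel)) sums (b (Suc r) - a (Suc r))"
      by (intro sums_diff b_sums a_sums)
    have 2: "norm (w (Suc n) * poisson_prob ((real n + 1) * s) (Suc r)
        - w (Suc n) * (\<integral>t. indicator (I n) t * poisson_prob (t * s) (Suc r) \<partial>lborel))
        \<le> w (Suc n) * (\<integral>t. indicator (I n) t * D r t \<partial>lborel)" for n
      using mult_left_mono[OF poisson_prob_average_diff[OF s, of n r] w(1)[of "Suc n"]] w(1)[of "Suc n"]
      unfolding D_def I_def by (simp add: abs_mult flip: right_diff_distrib)
    from norm_sums_le[OF 1 D_sums 2] show ?thesis by simp
  qed
  have fD: "(\<integral>t. f t * D r t \<partial>lborel)
      \<le> s / 2 * ((a r - 2 * a (Suc r) + (real r + 2) / (real r + 1) * a (Suc (Suc r))) / e + e * a r)"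
    if e: "e > 0" for r e
  proof -
    define q0 q1 q2 where "q0 = s / 2 * (1 / e + e)" and "q1 = - s / e"
      and "q2 = s / 2 * ((real r + 2) / (real r + 1)) / e"
    have eq: "s / 2 * ((x - 2 * y + (real r + 2) / (real r + 1) * z) / e + e * x) = q0 * x + q1 * y + q2 * z" for x y z
      unfolding q0_def q1_def q2_def using e by (simp add: algebra_simps add_divide_distrib diff_divide_distrib)
    have "(\<integral>t. f t * D r t \<partial>lborel) \<le> (\<integral>t. q0 * (f t * poisson_prob (t * s) r) + q1 * (f t * poisson_prob (t * s) (Suc r))
        + q2 * (f t * poisson_prob (t * s) (Suc (Suc r))) \<partial>lborel)"
    proof (rule integral_mono[OF intD])
      show "f t * D r t \<le> q0 * (f t * poisson_prob (t * s) r) + q1 * (f t * poisson_prob (t * s) (Suc r))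
        + q2 * (f t * poisson_prob (t * s) (Suc (Suc r)))" for t
        using D_le[OF e, of t r] unfolding eq by (simp add: algebra_simps)
    qed (use intP in simp)
    also have "\<dots> = q0 * a r + q1 * a (Suc r) + q2 * a (Suc (Suc r))"
      unfolding a_def using intP by simp
    finally show ?thesis unfolding eq .
  qed
  have "(\<lambda>r. (b (Suc r) - a (Suc r)) * real r powr \<kappa>) \<longlonglongrightarrow> 0"
  proof (rule LIMSEQ_I)
    fix \<epsilon> :: real assume \<epsilon>: "\<epsilon> > 0"
    have C: "C \<ge> 0" unfolding C_def using c by simp
    \<comment> \<open>The second differences vanish in the limit; what remains of the bound is \<open>e s C / 2\<close>.\<close>
    define e where "e = \<epsilon> / (s * C + 1)"
    have sC: "s * C + 1 > 0" using s C by (intro add_nonneg_pos) auto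
    have e: "e > 0" unfolding e_def using \<epsilon> sC by simp
    have a1: "(\<lambda>r. a (Suc r) * real r powr \<kappa>) \<longlonglongrightarrow> C"
      using a power_decay_shift[of a 1] by (simp add: power_decay_def)
    have a2: "(\<lambda>r. a (Suc (Suc r)) * real r powr \<kappa>) \<longlonglongrightarrow> C"
      using a power_decay_shift[of a 2] by (simp add: power_decay_def)
    have "(\<lambda>r. (real r + 2) / (real r + 1)) \<longlonglongrightarrow> 1" by real_asymp
    then have "(\<lambda>r. s / 2 * ((a r * real r powr \<kappa> - 2 * (a (Suc r) * real r powr \<kappa>)
        + (real r + 2) / (real r + 1) * (a (Suc (Suc r)) * real r powr \<kappa>)) / e + e * (a r * real r powr \<kappa>)))
        \<longlonglongrightarrow> s / 2 * ((C - 2 * C + 1 * C) / e + e * C)"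
      using a a1 a2 e unfolding power_decay_def by (intro tendsto_intros) auto
    moreover have "s / 2 * ((C - 2 * C + 1 * C) / e + e * C) < \<epsilon>"
    proof -
      have "s / 2 * ((C - 2 * C + 1 * C) / e + e * C) = e * (s * C) / 2" by simp
      also have "\<dots> \<le> e * (s * C)" using e s C by simp
      also have "\<dots> < e * (s * C + 1)" using e by simp
      also have "\<dots> = \<epsilon>" unfolding e_def using sC by simp
      finally show ?thesis .
    qed
    ultimately have "eventually (\<lambda>r. s / 2 * ((a r * real r powr \<kappa> - 2 * (a (Suc r) * real r powr \<kappa>)
        + (real r + 2) / (real r + 1) * (a (Suc (Suc r)) * real r powr \<kappa>)) / e + e * (a r * real r powr \<kappa>)) < \<epsilon>) at_top"
      by (rule order_tendstoD(2))
    then have "eventually (\<lambda>r. norm ((b (Suc r) - a (Suc r)) * real r powr \<kappa> - 0) < \<epsilon>) at_top"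
    proof eventually_elim
      case (elim r)
      have "norm ((b (Suc r) - a (Suc r)) * real r powr \<kappa> - 0) = \<bar>b (Suc r) - a (Suc r)\<bar> * real r powr \<kappa>"
        by (simp add: abs_mult)
      also have "\<dots> \<le> (s / 2 * ((a r - 2 * a (Suc r) + (real r + 2) / (real r + 1) * a (Suc (Suc r))) / e + e * a r)) * real r powr \<kappa>"
        by (intro mult_right_mono order_trans[OF ba fD] e) simp
      also have "\<dots> = s / 2 * ((a r * real r powr \<kappa> - 2 * (a (Suc r) * real r powr \<kappa>)
        + (real r + 2) / (real r + 1) * (a (Suc (Suc r)) * real r powr \<kappa>)) / e + e * (a r * real r powr \<kappa>))"
        by (simp add: algebra_simps add_divide_distrib diff_divide_distrib)
      finally show ?case using elim by linarith
    qed
    then show "\<exists>no. \<forall>n\<ge>no. norm ((b (Suc n) - a (Suc n)) * real n powr \<kappa> - 0) < \<epsilon>"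
      by (simp add: eventually_sequentially)
  qed
  then have "power_decay (\<lambda>r. b (r + 1) - a (r + 1)) \<kappa> 0" by (simp add: power_decay_def)
  then have "power_decay (\<lambda>r. b r - a r) \<kappa> 0"
    by (rule iffD1[OF power_decay_shift[of "\<lambda>r. b r - a r" 1]])
  from power_decay_add[OF this a] show ?thesis by (simp add: b_def C_def)
qed

section \<open>Mixed Poisson variables\<close>

lemma power_decay_mixed_poisson:
  assumes "prob_space M" and Z: "Z \<in> borel_measurable M" "AE \<omega> in M. 0 \<le> Z \<omega>"
    and pl: "power_law M c \<kappa> Z" and pos: "c > 0" "\<kappa> > 1" "s > 0"
  shows "power_decay (\<lambda>r. \<integral>\<omega>. poisson_prob (Z \<omega> * s) r \<partial>M) \<kappa> (c * s powr (\<kappa> - 1))"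
proof -
  interpret prob_space M by fact
  have intZ: "integrable M (\<lambda>\<omega>. poisson_prob (Z \<omega> * s) r)" for r
  proof -
    have "AE \<omega> in M. (1::real) = 0 \<or> 0 \<le> Z \<omega> * s"
      using Z(2) by eventually_elim (use pos in auto)
    from integrable_mult_poisson_prob[of M "\<lambda>_. 1" "\<lambda>\<omega>. Z \<omega> * s", OF _ _ this] Z(1)
    show ?thesis by simp
  qed
  from pl[unfolded power_law_def] show ?thesis
  proof (elim disjE conjE exE)
    assume int: "AE \<omega> in M. Z \<omega> \<in> \<int>"
      and lim: "(\<lambda>r. measure M {\<omega> \<in> space M. Z \<omega> = real r} / (c * real r powr (-\<kappa>))) \<longlonglongrightarrow> 1"
    define w where "w = (\<lambda>n. measure M {\<omega> \<in> space M. Z \<omega> = real n})"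
    have "power_decay w \<kappa> c"
      using tendsto_mult_left[OF lim, of c] pos
      by (simp add: power_decay_def w_def powr_minus_divide)
    from power_decay_poisson_mixture_weights[OF _ this pos(2,3)]
    have pd: "power_decay (\<lambda>r. \<Sum>n. w n * poisson_prob (real n * s) r) \<kappa> (c * s powr (\<kappa> - 1))"
      by (simp add: w_def)
    have "(\<Sum>n. w n * poisson_prob (real n * s) r) = (\<integral>\<omega>. poisson_prob (Z \<omega> * s) r \<partial>M)" for r
    proof -
      define f where "f = (\<lambda>n \<omega>. indicator {\<omega> \<in> space M. Z \<omega> = real n} \<omega> * poisson_prob (real n * s) r)"
      have m: "{\<omega> \<in> space M. Z \<omega> = real n} \<in> sets M" for n using Z(1) by measurable
      have "(\<lambda>n. \<integral>\<omega>. f n \<omega> \<partial>M) sums (\<integral>\<omega>. poisson_prob (Z \<omega> * s) r \<partial>M)"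
      proof (rule sums_integral_nonneg[OF _ _ _ intZ])
        show "f n \<in> borel_measurable M" for n unfolding f_def using m[of n] by measurable
        show "AE \<omega> in M. 0 \<le> f n \<omega>" for n
          unfolding f_def using pos by (intro always_eventually allI mult_nonneg_nonneg poisson_prob_nonneg) auto
        show "AE \<omega> in M. (\<lambda>n. f n \<omega>) sums poisson_prob (Z \<omega> * s) r"
          using int Z(2) AE_space
        proof eventually_elim
          case (elim \<omega>)
          then obtain k :: nat where k: "Z \<omega> = real k"
            by (metis Ints_cases nonneg_int_cases of_int_0_le_iff of_int_of_nat_eq)
          have "(\<lambda>n. if n = k then poisson_prob (real k * s) r else 0) sums poisson_prob (real k * s) r"
            by (rule sums_single)
          moreover have "(\<lambda>n. if n = k then poisson_prob (real k * s) r else 0) = (\<lambda>n. f n \<omega>)"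
            using elim(3) k by (auto simp: f_def indicator_def)
          ultimately show ?case by (simp add: k)
        qed
      qed
      moreover have "(\<integral>\<omega>. f n \<omega> \<partial>M) = w n * poisson_prob (real n * s) r" for n
        unfolding f_def w_def using m[of n] by simp
      ultimately show ?thesis by (simp add: sums_iff)
    qed
    with pd show ?thesis by simp
  next
    fix f :: "real \<Rightarrow> real"
    assume f0: "\<forall>t. 0 \<le> f t" and dist: "distributed M lborel Z (\<lambda>t. ennreal (f t))"
      and lim: "((\<lambda>t. f t / t powr (-\<kappa>)) \<longlongrightarrow> c) at_top"
    \<comment> \<open>The density of a nonnegative variable may be nonzero on a null set of negative numbers.\<close>
    define f' where "f' = (\<lambda>t. if t > 0 then f t else 0)"
    have fm [measurable]: "f \<in> borel_measurable borel"
      using distributed_real_measurable[OF _ dist] f0 by simp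
    have intf: "integrable lborel f"
      using distributed_integrable[OF dist, of "\<lambda>_. 1"] f0 by simp
    have "integrable lborel f'"
      by (rule Bochner_Integration.integrable_bound[OF intf]) (auto simp: f'_def)
    moreover have "((\<lambda>t. f' t / t powr (-\<kappa>)) \<longlongrightarrow> c) at_top"
    proof (rule Lim_transform_eventually[OF lim])
      show "eventually (\<lambda>t. f t / t powr (-\<kappa>) = f' t / t powr (-\<kappa>)) at_top"
        using eventually_gt_at_top[of 0] by eventually_elim (simp add: f'_def)
    qed
    ultimately have pd: "power_decay (\<lambda>r. \<integral>t. f' t * poisson_prob (t * s) r \<partial>lborel) \<kappa> (c * s powr (\<kappa> - 1))"
      using f0 pos by (intro power_decay_poisson_mixture_density) (auto simp: f'_def)
    have "AE t in lborel. f t > 0 \<longrightarrow> 0 \<le> t"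
    proof -
      have "AE t in distr M lborel Z. 0 \<le> t"
        using Z by (subst AE_distr_iff) auto
      then have "AE t in density lborel (\<lambda>t. ennreal (f t)). 0 \<le> t"
        by (simp only: distributed_distr_eq_density[OF dist])
      then show ?thesis by (simp add: AE_density)
    qed
    moreover have "AE t in lborel. t \<noteq> (0::real)" by (rule AE_lborel_singleton)
    ultimately have "AE t in lborel. f t = f' t"
      by eventually_elim (use f0 in \<open>auto simp: f'_def less_le\<close>)
    then have "(\<integral>t. f' t * poisson_prob (t * s) r \<partial>lborel) = (\<integral>t. f t * poisson_prob (t * s) r \<partial>lborel)" for r
      by (intro integral_cong_AE) (auto simp: f'_def)
    also have "\<dots>r = (\<integral>\<omega>. poisson_prob (Z \<omega> * s) r \<partial>M)" for r
      using f0 by (intro distributed_integral[OF dist]) auto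
    finally show ?thesis using pd by simp
  qed
qed

text \<open>The mean of \<open>Z\<close> is the mean of its Poisson mixture, a series whose terms are known to be summable. This treats
the discrete and the absolutely continuous case at once.\<close>

lemma power_law_integrable:
  assumes "prob_space M" and Z: "Z \<in> borel_measurable M" "AE \<omega> in M. 0 \<le> Z \<omega>"
    and pl: "power_law M c \<kappa> Z" and pos: "c > 0" "\<kappa> > 2"
  shows "integrable M Z"
proof (rule integrable_sums_nonneg)
  interpret prob_space M by fact
  show "integrable M (\<lambda>\<omega>. real r * poisson_prob (Z \<omega>) r)" for r
    using Z by (intro integrable_mult_poisson_prob) auto
  show "AE \<omega> in M. 0 \<le> real r * poisson_prob (Z \<omega>) r" for r
    using Z(2) by eventually_elim (simp add: poisson_prob_nonneg)
  show "AE \<omega> in M. (\<lambda>r. real r * poisson_prob (Z \<omega>) r) sums Z \<omega>"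
    by (intro always_eventually allI poisson_prob_mean_sums)
  have "power_decay (\<lambda>r. \<integral>\<omega>. poisson_prob (Z \<omega>) r \<partial>M) \<kappa> c"
    using power_decay_mixed_poisson[OF assms(1) Z pl pos(1), of 1] pos by simp
  from power_decay_summable[OF power_decay_times[OF this, of 0]] pos
  show "summable (\<lambda>r. \<integral>\<omega>. real r * poisson_prob (Z \<omega>) r \<partial>M)"
    by (simp add: summable_rabs_cancel)
qed (use Z in auto)

lemma mixed_poisson_mean:
  assumes "prob_space M" and L: "mixed_poisson M l L"
    and l: "integrable M l" "AE \<omega> in M. 0 \<le> l \<omega>"
  shows "mean M L = (\<integral>\<omega>. l \<omega> \<partial>M)"
proof -
  interpret prob_space M by fact
  have Lm [measurable]: "L \<in> measurable M (count_space UNIV)"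
    and pmf: "\<And>r. rv_pmf M L r = (\<integral>\<omega>. poisson_prob (l \<omega>) r \<partial>M)"
    using L by (auto simp: mixed_poisson_def)
  define f where "f = (\<lambda>r \<omega>. real r * indicator {\<omega> \<in> space M. L \<omega> = r} \<omega>)"
  have m: "{\<omega> \<in> space M. L \<omega> = r} \<in> sets M" for r by measurable
  have If: "integrable M (f r)" "(\<integral>\<omega>. f r \<omega> \<partial>M) = real r * rv_pmf M L r" for r
    using m[of r] unfolding f_def rv_pmf_def by (auto intro!: integrable_real_indicator simp: less_top[symmetric])
  have s1: "(\<lambda>r. real r * rv_pmf M L r) sums (\<integral>\<omega>. l \<omega> \<partial>M)"
  proof -
    have "(\<lambda>r. \<integral>\<omega>. real r * poisson_prob (l \<omega>) r \<partial>M) sums (\<integral>\<omega>. l \<omega> \<partial>M)"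
    proof (rule sums_integral_nonneg[OF _ _ _ l(1)])
      show "AE \<omega> in M. 0 \<le> real r * poisson_prob (l \<omega>) r" for r
        using l(2) by eventually_elim (simp add: poisson_prob_nonneg)
      show "AE \<omega> in M. (\<lambda>r. real r * poisson_prob (l \<omega>) r) sums l \<omega>"
        by (intro always_eventually allI poisson_prob_mean_sums)
      show "(\<lambda>\<omega>. real r * poisson_prob (l \<omega>) r) \<in> borel_measurable M" for r
        using l(1) by measurable
    qed
    then show ?thesis by (simp add: pmf)
  qed
  have fs: "AE \<omega> in M. (\<lambda>r. f r \<omega>) sums real (L \<omega>)"
    using AE_space
  proof eventually_elim
    case (elim \<omega>)
    have "(\<lambda>r. if r = L \<omega> then real (L \<omega>) else 0) sums real (L \<omega>)" by (rule sums_single)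
    moreover have "(\<lambda>r. if r = L \<omega> then real (L \<omega>) else 0) = (\<lambda>r. f r \<omega>)"
      using elim by (auto simp: f_def indicator_def)
    ultimately show ?case by simp
  qed
  have f0: "AE \<omega> in M. 0 \<le> f r \<omega>" for r by (simp add: f_def)
  have "integrable M (\<lambda>\<omega>. real (L \<omega>))"
    by (rule integrable_sums_nonneg[OF If(1) f0 _ fs]) (use s1 in \<open>auto simp: If(2) sums_iff\<close>)
  from sums_integral_nonneg(1)[OF _ f0 fs this] If
  have "(\<lambda>r. real r * rv_pmf M L r) sums mean M L"
    unfolding mean_def by (simp add: borel_measurable_integrable)
  with s1 show ?thesis by (rule sums_unique2[symmetric])
qed

section \<open>The law of the compound sum\<close>

lemma rv_pmf_nonneg: "rv_pmf M L r \<ge> 0"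
  by (simp add: rv_pmf_def)

lemma rv_pmf_sums_1:
  assumes "prob_space M" "L \<in> measurable M (count_space UNIV)"
  shows "rv_pmf M L sums 1"
proof -
  interpret prob_space M by fact
  have "(\<lambda>r. prob {\<omega> \<in> space M. L \<omega> = r}) sums prob (\<Union>r. {\<omega> \<in> space M. L \<omega> = r})"
    using assms(2) by (intro finite_measure_UNION) (auto simp: disjoint_family_on_def)
  also have "(\<Union>r. {\<omega> \<in> space M. L \<omega> = r}) = space M" by auto
  finally show ?thesis by (simp add: rv_pmf_def[abs_def] prob_space)
qed

lemma rv_pmf_sum_iid:
  assumes "prob_space M" and indep: "prob_space.indep_vars M (\<lambda>_. count_space UNIV) \<tau> {1..}"
    and t: "\<And>j r. j \<ge> 1 \<Longrightarrow> rv_pmf M (\<tau> j) r = t r"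
  shows "rv_pmf M (\<lambda>\<omega>. \<Sum>j=1..n. \<tau> j \<omega>) r = fps_nth (Abs_fps t ^ n) r"
proof (induction n arbitrary: r)
  interpret prob_space M by fact
  case 0
  show ?case by (auto simp: rv_pmf_def prob_space)
next
  interpret prob_space M by fact
  case (Suc n)
  have tm: "\<tau> j \<in> measurable M (count_space UNIV)" if "j \<ge> 1" for j
    using indep that by (auto simp: indep_vars_def)
  define S where "S = (\<lambda>\<omega>. \<Sum>j=1..n. \<tau> j \<omega>)"
  have Sm: "S \<in> measurable M (count_space UNIV)" unfolding S_def using tm by measurable
  have "indep_vars (\<lambda>_. borel) (\<lambda>j \<omega>. real (\<tau> j \<omega>)) {1..}"
    by (rule indep_vars_compose2[OF indep]) simp
  then have "indep_vars (\<lambda>_. borel) (\<lambda>j \<omega>. real (\<tau> j \<omega>)) (insert (Suc n) {1..n})"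
    by (rule indep_vars_subset) auto
  from indep_vars_sum[OF _ _ this]
  have ind: "indep_var borel (\<lambda>\<omega>. real (\<tau> (Suc n) \<omega>)) borel (\<lambda>\<omega>. real (S \<omega>))"
    by (simp add: S_def)
  have prod: "prob {\<omega> \<in> space M. \<tau> (Suc n) \<omega> = i \<and> S \<omega> = k} = rv_pmf M (\<tau> (Suc n)) i * rv_pmf M S k" for i k
  proof -
    have "prob ((\<lambda>\<omega>. (real (\<tau> (Suc n) \<omega>), real (S \<omega>))) -` ({real i} \<times> {real k}) \<inter> space M)
        = prob ((\<lambda>\<omega>. real (\<tau> (Suc n) \<omega>)) -` {real i} \<inter> space M) * prob ((\<lambda>\<omega>. real (S \<omega>)) -` {real k} \<inter> space M)"
      by (rule indep_varD[OF ind]) auto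
    moreover have "(\<lambda>\<omega>. (real (\<tau> (Suc n) \<omega>), real (S \<omega>))) -` ({real i} \<times> {real k}) \<inter> space M
        = {\<omega> \<in> space M. \<tau> (Suc n) \<omega> = i \<and> S \<omega> = k}"
      "(\<lambda>\<omega>. real (\<tau> (Suc n) \<omega>)) -` {real i} \<inter> space M = {\<omega> \<in> space M. \<tau> (Suc n) \<omega> = i}"
      "(\<lambda>\<omega>. real (S \<omega>)) -` {real k} \<inter> space M = {\<omega> \<in> space M. S \<omega> = k}" by auto
    ultimately show ?thesis by (simp add: rv_pmf_def)
  qed
  have "rv_pmf M (\<lambda>\<omega>. \<Sum>j=1..Suc n. \<tau> j \<omega>) r
      = prob (\<Union>i\<in>{0..r}. {\<omega> \<in> space M. \<tau> (Suc n) \<omega> = i \<and> S \<omega> = r - i})"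
    unfolding rv_pmf_def S_def by (rule arg_cong[where f = prob]) auto
  also have "\<dots> = (\<Sum>i=0..r. prob {\<omega> \<in> space M. \<tau> (Suc n) \<omega> = i \<and> S \<omega> = r - i})"
    using tm[of "Suc n"] Sm by (intro finite_measure_finite_Union) (auto simp: disjoint_family_on_def)
  also have "\<dots> = (\<Sum>i=0..r. t i * fps_nth (Abs_fps t ^ n) (r - i))"
    unfolding prod Suc[folded S_def] using t by simp
  also have "\<dots> = fps_nth (Abs_fps t ^ Suc n) r" by (simp add: fps_mult_nth)
  finally show ?case .
qed

lemma indep_rv_compose:
  assumes "prob_space M" and ind: "indep_rv M S U T V"
    and f: "f \<in> measurable S N1" and g: "g \<in> measurable T N2"
  shows "prob_space.indep_var M N1 (\<lambda>\<omega>. f (U \<omega>)) N2 (\<lambda>\<omega>. g (V \<omega>))"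
proof -
  interpret prob_space M by fact
  have U: "U \<in> measurable M S" and V: "V \<in> measurable M T"
    and i: "indep_set (sets (vimage_algebra (space M) U S)) (sets (vimage_algebra (space M) V T))"
    using ind by (auto simp: indep_rv_def)
  have sub: "sigma_sets (space M) {(\<lambda>\<omega>. h (W \<omega>)) -` A \<inter> space M |A. A \<in> sets N} \<subseteq> sets (vimage_algebra (space M) W R)"
    if W: "W \<in> measurable M R" and h: "h \<in> measurable R N" for h W N and R :: "'r measure"
  proof -
    have "(\<lambda>\<omega>. h (W \<omega>)) \<in> measurable (vimage_algebra (space M) W R) N"
      using W by (intro measurable_compose[OF measurable_vimage_algebra1 h]) (auto dest: measurable_space)
    then have "{(\<lambda>\<omega>. h (W \<omega>)) -` A \<inter> space M |A. A \<in> sets N} \<subseteq> sets (vimage_algebra (space M) W R)"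
      by (auto dest!: measurable_sets)
    then show ?thesis
      using sets.sigma_sets_subset[of _ "vimage_algebra (space M) W R"] by simp
  qed
  have "indep_set (sigma_sets (space M) {(\<lambda>\<omega>. f (U \<omega>)) -` A \<inter> space M |A. A \<in> sets N1})
      (sigma_sets (space M) {(\<lambda>\<omega>. g (V \<omega>)) -` A \<inter> space M |A. A \<in> sets N2})"
    using i unfolding indep_set_def
    by (rule indep_sets_mono_sets) (use sub[OF U f] sub[OF V g] in \<open>auto split: bool.splits\<close>)
  then show ?thesis
    unfolding indep_var_eq using measurable_compose[OF U f] measurable_compose[OF V g] by simp
qed

text \<open>By the defining property of conditional expectation, integrating against a function of the conditioning variable
removes the conditioning. Thus \<open>q\<^sub>r = E (Y 1{d = r})\<close>, and conditional laws disappear from the argument.\<close>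

lemma integral_cond_pmf:
  assumes "prob_space M" and Y: "integrable M Y" and L: "L \<in> measurable M (count_space UNIV)"
  shows "(\<integral>\<omega>. Y \<omega> * cond_pmf M Y L r \<omega> \<partial>M) = (\<integral>\<omega>. Y \<omega> * indicator {\<omega> \<in> space M. L \<omega> = r} \<omega> \<partial>M)"
    and "cond_pmf M Y L r \<in> borel_measurable M"
proof -
  interpret prob_space M by fact
  define F where "F = vimage_algebra (space M) Y borel"
  have "subalgebra M F"
    unfolding F_def subalgebra_def using Y by (auto simp: sets_vimage_algebra2 intro!: measurable_sets)
  then interpret finite_measure_subalgebra M F by unfold_locales
  have A [measurable]: "{\<omega> \<in> space M. L \<omega> = r} \<in> sets M" using L by measurable
  have "Y \<in> borel_measurable F"
    unfolding F_def by (rule measurable_vimage_algebra1) auto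
  moreover have "integrable M (\<lambda>\<omega>. Y \<omega> * indicator {\<omega> \<in> space M. L \<omega> = r} \<omega>)"
    using Y by (intro integrable_real_mult_indicator) auto
  ultimately show "(\<integral>\<omega>. Y \<omega> * cond_pmf M Y L r \<omega> \<partial>M) = (\<integral>\<omega>. Y \<omega> * indicator {\<omega> \<in> space M. L \<omega> = r} \<omega> \<partial>M)"
    unfolding cond_pmf_def F_def[symmetric] by (intro real_cond_exp_intg(2)) auto
  show "cond_pmf M Y L r \<in> borel_measurable M"
    unfolding cond_pmf_def by (rule borel_measurable_cond_exp2)
qed

text \<open>\<open>q\<close> is the law of \<open>d\<close> biased by \<open>Y\<close>, hence of total mass \<open>E Y\<close>.\<close>

lemma q_sums:
  assumes "prob_space M" and Y: "integrable M Y" "AE \<omega> in M. 0 \<le> Y \<omega>"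
    and d: "d \<in> measurable M (count_space UNIV)"
  shows "q M Y d r \<ge> 0" "q M Y d sums moment M Y 1"
proof -
  define f where "f = (\<lambda>r \<omega>. Y \<omega> * indicator {\<omega> \<in> space M. d \<omega> = r} \<omega>)"
  have q: "q M Y d r = (\<integral>\<omega>. f r \<omega> \<partial>M)" for r
    unfolding q_def f_def by (rule integral_cond_pmf(1)[OF assms(1) Y(1) d])
  have f0: "AE \<omega> in M. 0 \<le> f r \<omega>" for r
    using Y(2) by eventually_elim (simp add: f_def)
  then show "q M Y d r \<ge> 0" unfolding q by (rule integral_nonneg_AE)
  have "(\<lambda>r. \<integral>\<omega>. f r \<omega> \<partial>M) sums (\<integral>\<omega>. Y \<omega> \<partial>M)"
  proof (rule sums_integral_nonneg(1)[OF _ f0 _ Y(1)])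
    have "{\<omega> \<in> space M. d \<omega> = r} \<in> sets M" for r using d by measurable
    then show "f r \<in> borel_measurable M" for r unfolding f_def using Y(1) by measurable
    show "AE \<omega> in M. (\<lambda>r. f r \<omega>) sums Y \<omega>"
      using AE_space
    proof eventually_elim
      case (elim \<omega>)
      have "(\<lambda>r. if r = d \<omega> then Y \<omega> else 0) sums Y \<omega>" by (rule sums_single)
      moreover have "(\<lambda>r. if r = d \<omega> then Y \<omega> else 0) = (\<lambda>r. f r \<omega>)"
        using elim by (auto simp: f_def indicator_def)
      ultimately show ?case by simp
    qed
  qed
  then show "q M Y d sums moment M Y 1" by (simp add: q[abs_def] moment_def)
qed

text \<open>Decomposing according to the number \<open>n\<close> of summands, independence separates \<open>E (Y 1{N = n})\<close> from the law of a
sum of \<open>n\<close> copies of \<open>\<tau>\<close>. So \<open>q\<close> is a mixture of convolution powers, the form in which both the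
Poisson and the heavy-tailed case can be evaluated.\<close>

lemma q_compound_sums:
  assumes "prob_space M" and Y: "integrable M Y" "AE \<omega> in M. 0 \<le> Y \<omega>"
    and N: "cond_poisson M Y g N" and g: "g \<in> borel_measurable borel"
    and iid: "prob_space.indep_vars M (\<lambda>_. count_space UNIV) \<tau> {1..}" "\<And>j r. j \<ge> 1 \<Longrightarrow> rv_pmf M (\<tau> j) r = t r"
    and ind: "indep_rv M (borel \<Otimes>\<^sub>M count_space UNIV) (\<lambda>\<omega>. (Y \<omega>, N \<omega>))
           (\<Pi>\<^sub>M j\<in>{1..}. count_space UNIV) (\<lambda>\<omega>. \<lambda>j\<in>{1..}. \<tau> j \<omega>)"
  shows "random_sum N \<tau> \<in> measurable M (count_space UNIV)"
    and "(\<lambda>n. (\<integral>\<omega>. Y \<omega> * poisson_prob (g (Y \<omega>)) n \<partial>M) * fps_nth (Abs_fps t ^ n) r) sums q M Y (random_sum N \<tau>) r"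
proof -
  interpret prob_space M by fact
  have Nm [measurable]: "N \<in> measurable M (count_space UNIV)"
    and cN: "\<And>r. AE \<omega> in M. cond_pmf M Y N r \<omega> = poisson_prob (g (Y \<omega>)) r"
    using N by (auto simp: cond_poisson_def)
  have Ym [measurable]: "Y \<in> borel_measurable M" using Y by auto
  have tm: "\<tau> j \<in> measurable M (count_space UNIV)" if "j \<ge> 1" for j
    using iid(1) that by (auto simp: indep_vars_def)
  define S where "S = (\<lambda>n \<omega>. \<Sum>j=1..n. \<tau> j \<omega>)"
  have Sm [measurable]: "S n \<in> measurable M (count_space UNIV)" for n
    unfolding S_def using tm by measurable
  have d_eq: "random_sum N \<tau> = (\<lambda>\<omega>. S (N \<omega>) \<omega>)" by (simp add: fun_eq_iff random_sum_def S_def)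
  show dm: "random_sum N \<tau> \<in> measurable M (count_space UNIV)"
    unfolding d_eq by (rule measurable_compose_countable[OF Sm Nm])
  have mS [measurable]: "{\<omega> \<in> space M. S n \<omega> = k} \<in> sets M" for n k by measurable
  have mN [measurable]: "{\<omega> \<in> space M. N \<omega> = k} \<in> sets M" for k by measurable
  have md [measurable]: "{\<omega> \<in> space M. random_sum N \<tau> \<omega> = k} \<in> sets M" for k using dm by measurable
  define f where "f = (\<lambda>n \<omega>. Y \<omega> * indicator {\<omega> \<in> space M. N \<omega> = n} \<omega> * indicator {\<omega> \<in> space M. S n \<omega> = r} \<omega>)"
  have f_int: "(\<integral>\<omega>. f n \<omega> \<partial>M) = (\<integral>\<omega>. Y \<omega> * poisson_prob (g (Y \<omega>)) n \<partial>M) * fps_nth (Abs_fps t ^ n) r" for n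
  proof -
    have S_pmf: "(\<integral>\<omega>. indicator {\<omega> \<in> space M. S n \<omega> = r} \<omega> \<partial>M) = fps_nth (Abs_fps t ^ n) r"
    proof -
      have "{\<omega> \<in> space M. S n \<omega> = r} \<inter> space M = {\<omega> \<in> space M. S n \<omega> = r}" by auto
      moreover have "rv_pmf M (S n) r = fps_nth (Abs_fps t ^ n) r"
        using rv_pmf_sum_iid[OF assms(1) iid, of n r] by (simp only: S_def)
      ultimately show ?thesis by (simp add: rv_pmf_def)
    qed
    have "indep_var borel (\<lambda>\<omega>. (\<lambda>(y, k). y * indicator {n} k :: real) (Y \<omega>, N \<omega>))
      borel (\<lambda>\<omega>. (\<lambda>v. indicator {r} (\<Sum>j=1..n. v j) :: real) (\<lambda>j\<in>{1..}. \<tau> j \<omega>))"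
    proof (rule indep_rv_compose[OF assms(1) ind])
      show "(\<lambda>(y, k). y * indicator {n} k :: real) \<in> borel_measurable (borel \<Otimes>\<^sub>M count_space UNIV)"
        unfolding split_beta'
        by (intro borel_measurable_times measurable_fst measurable_compose[OF measurable_snd]) simp
      have proj: "(\<lambda>v. v j) \<in> measurable (\<Pi>\<^sub>M j\<in>{1..}. count_space (UNIV :: nat set)) (count_space UNIV)"
        if "j \<ge> 1" for j :: nat
        by (rule measurable_component_singleton) (use that in simp)
      have "(\<lambda>v. \<Sum>j=1..n. v j) \<in> measurable (\<Pi>\<^sub>M j\<in>{1..}. count_space (UNIV :: nat set)) (count_space UNIV)"
      proof (rule measurable_sum_nat)
        fix j assume "j \<in> {1..n}"
        with proj[of j] show "(\<lambda>v. v j) \<in> measurable (\<Pi>\<^sub>M j\<in>{1..}. count_space (UNIV :: nat set)) (count_space UNIV)"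
          by (simp only: atLeastAtMost_iff)
      qed
      then show "(\<lambda>v. indicator {r} (\<Sum>j=1..n. v j) :: real) \<in> borel_measurable (\<Pi>\<^sub>M j\<in>{1..}. count_space UNIV)"
        by (rule measurable_compose) simp
    qed
    moreover have "(\<lambda>\<omega>. (\<lambda>v. indicator {r} (\<Sum>j=1..n. v j) :: real) (\<lambda>j\<in>{1..}. \<tau> j \<omega>)) = (\<lambda>\<omega>. indicator {r} (S n \<omega>))"
      by (auto simp: S_def)
    ultimately have iv: "indep_var borel (\<lambda>\<omega>. Y \<omega> * indicator {n} (N \<omega>)) borel (\<lambda>\<omega>. indicator {r} (S n \<omega>) :: real)"
      by simp
    have eqs: "\<And>\<omega>. \<omega> \<in> space M \<Longrightarrow> Y \<omega> * indicator {n} (N \<omega>) = Y \<omega> * indicator {\<omega> \<in> space M. N \<omega> = n} \<omega>"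
      "\<And>\<omega>. \<omega> \<in> space M \<Longrightarrow> (indicator {r} (S n \<omega>) :: real) = indicator {\<omega> \<in> space M. S n \<omega> = r} \<omega>"
      by (auto simp: indicator_def)
    have i1: "integrable M (\<lambda>\<omega>. Y \<omega> * indicator {n} (N \<omega>))"
      using integrable_real_mult_indicator[OF mN Y(1), of n]
      by (subst Bochner_Integration.integrable_cong[OF refl eqs(1)]) (auto simp: mult.commute)
    have i2: "integrable M (\<lambda>\<omega>. indicator {r} (S n \<omega>) :: real)"
      by (subst Bochner_Integration.integrable_cong[OF refl eqs(2)]) (auto simp: less_top[symmetric])
    have "(\<integral>\<omega>. f n \<omega> \<partial>M) = (\<integral>\<omega>. (Y \<omega> * indicator {n} (N \<omega>)) * indicator {r} (S n \<omega>) \<partial>M)"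
      unfolding f_def by (intro Bochner_Integration.integral_cong) (auto simp: eqs)
    also have "\<dots> = (\<integral>\<omega>. Y \<omega> * indicator {n} (N \<omega>) \<partial>M) * (\<integral>\<omega>. indicator {r} (S n \<omega>) \<partial>M)"
      by (rule indep_var_lebesgue_integral[OF iv i1 i2])
    also have "(\<integral>\<omega>. indicator {r} (S n \<omega>) \<partial>M) = fps_nth (Abs_fps t ^ n) r"
      unfolding S_pmf[symmetric] by (intro Bochner_Integration.integral_cong eqs) auto
    also have "(\<integral>\<omega>. Y \<omega> * indicator {n} (N \<omega>) \<partial>M) = (\<integral>\<omega>. Y \<omega> * cond_pmf M Y N n \<omega> \<partial>M)"
      unfolding integral_cond_pmf(1)[OF assms(1) Y(1) Nm]
      by (intro Bochner_Integration.integral_cong eqs) auto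
    also have "\<dots> = (\<integral>\<omega>. Y \<omega> * poisson_prob (g (Y \<omega>)) n \<partial>M)"
    proof (rule integral_cong_AE)
      show "AE \<omega> in M. Y \<omega> * cond_pmf M Y N n \<omega> = Y \<omega> * poisson_prob (g (Y \<omega>)) n"
        using cN[of n] by eventually_elim simp
      show "(\<lambda>\<omega>. Y \<omega> * cond_pmf M Y N n \<omega>) \<in> borel_measurable M"
        using integral_cond_pmf(2)[OF assms(1) Y(1) Nm, of n] by measurable
    qed (use g in measurable)
    finally show ?thesis .
  qed
  have "(\<lambda>n. \<integral>\<omega>. f n \<omega> \<partial>M) sums (\<integral>\<omega>. Y \<omega> * indicator {\<omega> \<in> space M. random_sum N \<tau> \<omega> = r} \<omega> \<partial>M)"
  proof (rule sums_integral_nonneg(1))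
    show "f n \<in> borel_measurable M" for n unfolding f_def by measurable
    show "AE \<omega> in M. 0 \<le> f n \<omega>" for n
      using Y(2) by eventually_elim (simp add: f_def)
    show "integrable M (\<lambda>\<omega>. Y \<omega> * indicator {\<omega> \<in> space M. random_sum N \<tau> \<omega> = r} \<omega>)"
      using Y(1) md by (intro integrable_real_mult_indicator) auto
    show "AE \<omega> in M. (\<lambda>n. f n \<omega>) sums (Y \<omega> * indicator {\<omega> \<in> space M. random_sum N \<tau> \<omega> = r} \<omega>)"
      using AE_space
    proof eventually_elim
      case (elim \<omega>)
      let ?v = "Y \<omega> * indicator {\<omega> \<in> space M. random_sum N \<tau> \<omega> = r} \<omega>"
      have "(\<lambda>n. if n = N \<omega> then ?v else 0) sums ?v" by (rule sums_single)
      moreover have "(\<lambda>n. if n = N \<omega> then ?v else 0) = (\<lambda>n. f n \<omega>)"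
        using elim by (auto simp: f_def d_eq indicator_def)
      ultimately show ?case by simp
    qed
  qed
  then show "(\<lambda>n. (\<integral>\<omega>. Y \<omega> * poisson_prob (g (Y \<omega>)) n \<partial>M) * fps_nth (Abs_fps t ^ n) r) sums q M Y (random_sum N \<tau>) r"
    unfolding f_int q_def integral_cond_pmf(1)[OF assms(1) Y(1) dm] .
qed

section \<open>Asymptotics in two indices\<close>

lemma asymp_equiv_prod:
  fixes f f' :: "'b \<Rightarrow> real" and g g' :: "'c \<Rightarrow> real"
  assumes "f \<sim>[F] f'" "g \<sim>[G] g'"
  shows "(\<lambda>(x, y). f x * g y) \<sim>[F \<times>\<^sub>F G] (\<lambda>(x, y). f' x * g' y)"
proof -
  have "(\<lambda>z. f (fst z)) \<sim>[F \<times>\<^sub>F G] (\<lambda>z. f' (fst z))"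
    by (rule asymp_equiv_compose'[OF assms(1) filterlim_fst])
  moreover have "(\<lambda>z. g (snd z)) \<sim>[F \<times>\<^sub>F G] (\<lambda>z. g' (snd z))"
    by (rule asymp_equiv_compose'[OF assms(2) filterlim_snd])
  ultimately show ?thesis
    unfolding split_beta' by (rule asymp_equiv_mult)
qed

lemma tendsto_imp_asymp_equiv_powr:
  fixes f :: "'z \<Rightarrow> real"
  assumes "((\<lambda>z. f z * x z powr a * y z powr b) \<longlongrightarrow> A) F" "A \<noteq> 0"
  shows "f \<sim>[F] (\<lambda>z. A * x z powr (-a) * y z powr (-b))"
proof (rule asymp_equivI')
  have "((\<lambda>z. f z * x z powr a * y z powr b / A) \<longlongrightarrow> A / A) F"
    using assms by (intro tendsto_intros) auto
  then show "((\<lambda>z. f z / (A * x z powr (-a) * y z powr (-b))) \<longlongrightarrow> 1) F"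
    using assms(2) by (simp add: powr_minus_divide mult_ac)
qed

text \<open>Since \<open>k \<le> (k - r + 1) (r + 1)\<close>, shifting the index of a power law by \<open>r\<close> costs at most a factor
\<open>(r + 1)\<^sup>\<alpha>\<close>, uniformly in \<open>k\<close>. A weight with a moment of order \<open>2 \<alpha>\<close> dominates both shifts simultaneously,
however the two indices grow relative to each other.\<close>

lemma light_tail_convolution_product:
  assumes u: "power_decay u \<alpha> A" and \<alpha>: "\<alpha> \<ge> 0"
    and p: "\<And>r. p r \<ge> 0" "summable (\<lambda>r. p r * (real r + 1) powr (2 * \<alpha>))"
  shows "((\<lambda>(k1, k2). (\<Sum>r=0..min k1 k2. p r * u (k1 - r) * u (k2 - r)) * (real k1 powr \<alpha> * real k2 powr \<alpha>))
    \<longlongrightarrow> A\<^sup>2 * (\<Sum>r. p r)) (at_top \<times>\<^sub>F at_top)"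
proof -
  obtain C where C: "C > 0" "\<And>r. \<bar>u r\<bar> \<le> C * (real r + 1) powr (-\<alpha>)"
    using power_decay_bound[OF u] by blast
  define v where "v = (\<lambda>r k. u (k - r) * real k powr \<alpha>)"
  have v_le: "\<bar>v r k\<bar> \<le> C * (real r + 1) powr \<alpha>" if "r \<le> k" for r k
  proof -
    have "real k \<le> (real (k - r) + 1) * (real r + 1)"
    proof -
      obtain m where "k = r + m" using \<open>r \<le> k\<close> le_Suc_ex by blast
      then show ?thesis by (simp add: algebra_simps)
    qed
    then have "real k powr \<alpha> \<le> ((real (k - r) + 1) * (real r + 1)) powr \<alpha>"
      using \<alpha> by (intro powr_mono2) auto
    also have "\<dots> = (real (k - r) + 1) powr \<alpha> * (real r + 1) powr \<alpha>" by (rule powr_mult)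
    finally have "\<bar>v r k\<bar> \<le> C * (real (k - r) + 1) powr (-\<alpha>) * ((real (k - r) + 1) powr \<alpha> * (real r + 1) powr \<alpha>)"
      unfolding v_def abs_mult using C by (intro mult_mono) auto
    also have "\<dots> = C * (real r + 1) powr \<alpha>" by (simp add: powr_minus_divide)
    finally show ?thesis .
  qed
  have v_lim: "(\<lambda>k. v r k) \<longlonglongrightarrow> A" for r
  proof -
    have "(\<lambda>k. v r (k + r)) \<longlonglongrightarrow> A"
    proof -
      have eq: "(\<lambda>k. u k * real (k + r) powr \<alpha>) \<sim>[at_top] (\<lambda>k. u k * real k powr \<alpha>)"
      proof -
        have "(\<lambda>k. real (k + r) powr \<alpha>) \<sim>[at_top] (\<lambda>k. real k powr \<alpha>)"
          unfolding of_nat_add by real_asymp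
        then show ?thesis by (intro asymp_equiv_mult) auto
      qed
      then show ?thesis
        using u tendsto_asymp_equiv_cong[OF eq, of A] by (simp add: power_decay_def v_def)
    qed
    then show ?thesis by (rule LIMSEQ_offset)
  qed
  define a where "a = (\<lambda>(k1, k2) r. if r \<le> min k1 k2 then p r * (v r k1 * v r k2) else 0)"
  have "((\<lambda>z. \<Sum>r. a z r) \<longlongrightarrow> (\<Sum>r. p r * (A * A))) (at_top \<times>\<^sub>F at_top)"
  proof (rule tendsto_suminf_dominated)
    show "at_top \<times>\<^sub>F at_top \<noteq> (bot :: (nat \<times> nat) filter)" by (simp add: prod_filter_eq_bot)
    show "((\<lambda>z. a z r) \<longlongrightarrow> p r * (A * A)) (at_top \<times>\<^sub>F at_top)" for r
    proof -
      have "((\<lambda>z. v r (fst z)) \<longlongrightarrow> A) (at_top \<times>\<^sub>F at_top)" "((\<lambda>z. v r (snd z)) \<longlongrightarrow> A) (at_top \<times>\<^sub>F at_top)"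
        by (rule filterlim_compose[OF v_lim filterlim_fst], rule filterlim_compose[OF v_lim filterlim_snd])
      then have "((\<lambda>z. p r * (v r (fst z) * v r (snd z))) \<longlongrightarrow> p r * (A * A)) (at_top \<times>\<^sub>F at_top)"
        by (intro tendsto_mult tendsto_const)
      moreover have "eventually (\<lambda>z. p r * (v r (fst z) * v r (snd z)) = a z r) (at_top \<times>\<^sub>F at_top)"
      proof -
        have "eventually (\<lambda>z. r \<le> fst z) (at_top \<times>\<^sub>F at_top :: (nat \<times> nat) filter)"
          "eventually (\<lambda>z. r \<le> snd z) (at_top \<times>\<^sub>F at_top :: (nat \<times> nat) filter)"
          using filterlim_fst[of "at_top :: nat filter" "at_top :: nat filter"]
            filterlim_snd[of "at_top :: nat filter" "at_top :: nat filter"]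
          unfolding filterlim_at_top by auto
        then show ?thesis by eventually_elim (simp add: a_def split_beta)
      qed
      ultimately show ?thesis by (rule Lim_transform_eventually)
    qed
    show "summable (\<lambda>r. C\<^sup>2 * (p r * (real r + 1) powr (2 * \<alpha>)))" using p(2) by (rule summable_mult)
    show "eventually (\<lambda>z. \<forall>r. \<bar>a z r\<bar> \<le> C\<^sup>2 * (p r * (real r + 1) powr (2 * \<alpha>))) (at_top \<times>\<^sub>F at_top)"
    proof (intro always_eventually allI)
      fix z :: "nat \<times> nat" and r
      show "\<bar>a z r\<bar> \<le> C\<^sup>2 * (p r * (real r + 1) powr (2 * \<alpha>))"
      proof (cases "r \<le> min (fst z) (snd z)")
        case True
        then have "\<bar>a z r\<bar> = p r * (\<bar>v r (fst z)\<bar> * \<bar>v r (snd z)\<bar>)"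
          using p(1) by (simp add: a_def split_beta abs_mult)
        also have "\<dots> \<le> p r * ((C * (real r + 1) powr \<alpha>) * (C * (real r + 1) powr \<alpha>))"
          using v_le[of r "fst z"] v_le[of r "snd z"] True C(1)
          by (intro mult_left_mono mult_mono p(1)) simp_all
        also have "\<dots> = C\<^sup>2 * (p r * (real r + 1) powr (2 * \<alpha>))"
          unfolding mult_2 powr_add by (simp add: power2_eq_square mult_ac)
        finally show ?thesis .
      next
        case False
        then have "a z r = 0" by (simp only: a_def split_beta if_False)
        then show ?thesis using p(1) by simp
      qed
    qed
  qed
  moreover have "(\<Sum>r. a z r) = (case z of (k1, k2) \<Rightarrow>
      (\<Sum>r=0..min k1 k2. p r * u (k1 - r) * u (k2 - r)) * (real k1 powr \<alpha> * real k2 powr \<alpha>))" for z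
  proof (cases z)
    case (Pair k1 k2)
    have "(\<Sum>r. a z r) = (\<Sum>r\<in>{0..min k1 k2}. a z r)"
      by (rule suminf_finite) (auto simp: a_def Pair)
    also have "\<dots> = (\<Sum>r=0..min k1 k2. p r * u (k1 - r) * u (k2 - r)) * (real k1 powr \<alpha> * real k2 powr \<alpha>)"
      unfolding sum_distrib_right by (intro sum.cong) (auto simp: a_def v_def Pair mult_ac)
    finally show ?thesis by (simp add: Pair)
  qed
  moreover have "(\<Sum>r. p r * (A * A)) = A\<^sup>2 * (\<Sum>r. p r)"
  proof -
    have "summable p"
    proof (rule summable_comparison_test[OF _ p(2)], intro exI allI impI)
      fix r :: nat
      have "1 \<le> (real r + 1) powr (2 * \<alpha>)" using \<alpha> by (intro ge_one_powr_ge_zero) auto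
      from mult_left_mono[OF this p(1)[of r]] p(1)[of r]
      show "norm (p r) \<le> p r * (real r + 1) powr (2 * \<alpha>)" by simp
    qed
    from suminf_mult[OF this, of "A\<^sup>2"] show ?thesis by (simp add: power2_eq_square mult_ac)
  qed
  ultimately show ?thesis by simp
qed

text \<open>Along this filter \<open>k\<^sub>1\<close> and the gap \<open>k\<^sub>2 - k\<^sub>1\<close> tend to infinity, so it suffices to study the two as
independent variables.\<close>

lemma filterlim_far_apart:
  "filterlim (\<lambda>(k1, k2). (k1, k2 - k1)) (at_top \<times>\<^sub>F at_top) far_apart"
  "eventually (\<lambda>(k1, k2). k1 \<le> k2) far_apart"
proof -
  have 1: "filterlim fst at_top far_apart"
    by (rule filterlim_mono[OF filterlim_fst[of at_top "at_top :: nat filter"] order_refl]) (simp add: far_apart_def le_infI1)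
  have 2: "filterlim (\<lambda>(k1, k2). k2 - k1) at_top far_apart"
    by (rule filterlim_mono[OF filterlim_filtercomap order_refl]) (simp add: far_apart_def)
  show "filterlim (\<lambda>(k1, k2). (k1, k2 - k1)) (at_top \<times>\<^sub>F at_top) far_apart"
    using filterlim_Pair[OF 1 2] by (simp add: split_beta')
  have "far_apart \<le> principal {(k1, k2). k1 \<le> k2}"
    by (simp add: far_apart_def le_infI1)
  then show "eventually (\<lambda>(k1, k2). k1 \<le> k2) far_apart"
    by (rule filter_leD) (simp add: eventually_principal)
qed

section \<open>Heavy-tailed Y\<close>

lemma moment_pos:
  assumes "integrable M (\<lambda>\<omega>. Z \<omega> ^ i)" "AE \<omega> in M. 0 \<le> Z \<omega>" "\<not> (AE \<omega> in M. Z \<omega> = 0)" "i > 0"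
  shows "moment M Z i > 0"
proof -
  have nn: "AE \<omega> in M. 0 \<le> Z \<omega> ^ i" using assms(2) by eventually_elim simp
  then have "moment M Z i \<ge> 0" unfolding moment_def by (rule integral_nonneg_AE)
  moreover have "moment M Z i \<noteq> 0"
  proof
    assume "moment M Z i = 0"
    then have "AE \<omega> in M. Z \<omega> ^ i = 0"
      using integral_nonneg_eq_0_iff_AE[OF assms(1) nn] by (simp add: moment_def)
    then have "AE \<omega> in M. Z \<omega> = 0" by eventually_elim simp
    with assms(3) show False by contradiction
  qed
  ultimately show ?thesis by simp
qed

lemma power_decay_product_asymp_equiv:
  assumes "power_decay f \<alpha> A" "A \<noteq> 0"
  shows "(\<lambda>(k1, k2). f k1 * f k2) \<sim>[at_top \<times>\<^sub>F at_top] (\<lambda>(k1, k2). A\<^sup>2 * (real k1 * real k2) powr (-\<alpha>))"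
proof -
  note e = power_decay_imp_asymp_equiv[OF assms]
  have "(\<lambda>(k1, k2). A\<^sup>2 * (real k1 * real k2) powr (-\<alpha>))
      = (\<lambda>(k1, k2). (A * real k1 powr (-\<alpha>)) * (A * real k2 powr (-\<alpha>)))"
    by (auto simp: fun_eq_iff powr_mult power2_eq_square)
  with asymp_equiv_prod[OF e e] show ?thesis by simp
qed

lemma p_infty_asymp_equiv:
  assumes "prob_space M" and Y: "Y \<in> borel_measurable M" "AE \<omega> in M. 0 \<le> Y \<omega>" "\<not> (AE \<omega> in M. Y \<omega> = 0)"
    and b1: "b1 = moment M Y 1" and a2: "a2 > 0"
    and L: "mixed_poisson M (\<lambda>\<omega>. Y \<omega> * a2 * b1) L"
    and pl: "power_law M c \<kappa> Y" and pos: "c > 0" "\<kappa> > 2"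
  shows "(\<lambda>(k1, k2). p_infty M L k1 k2) \<sim>[at_top \<times>\<^sub>F at_top]
    (\<lambda>(k1, k2). c ^ 2 * a2 powr (2 * \<kappa> - 4) * b1 powr (2 * \<kappa> - 6) * (real k1 * real k2) powr (1 - \<kappa>))"
proof -
  have intY: "integrable M Y" by (rule power_law_integrable[OF assms(1) Y(1,2) pl pos])
  have b1p: "b1 > 0" unfolding b1 by (rule moment_pos) (use intY Y in auto)
  have "power_decay (\<lambda>r. \<integral>\<omega>. poisson_prob (Y \<omega> * (a2 * b1)) r \<partial>M) \<kappa> (c * (a2 * b1) powr (\<kappa> - 1))"
    by (rule power_decay_mixed_poisson[OF assms(1) Y(1,2) pl]) (use pos a2 b1p in auto)
  moreover have "(\<lambda>r. \<integral>\<omega>. poisson_prob (Y \<omega> * (a2 * b1)) r \<partial>M) = rv_pmf M L"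
    using L by (simp add: mixed_poisson_def fun_eq_iff mult.assoc)
  ultimately have "power_decay (\<lambda>r. rv_pmf M L (r + 1)) \<kappa> (c * (a2 * b1) powr (\<kappa> - 1))"
    by (simp only: power_decay_shift)
  from power_decay_cmult[OF power_decay_times[OF this, of 1], of "1 / mean M L"]
  have "power_decay (\<lambda>k. p_tilde M L (k + 1)) (\<kappa> - 1) (c * (a2 * b1) powr (\<kappa> - 1) / mean M L)"
    by (simp add: p_tilde_def add.commute)
  also have "mean M L = a2 * b1 * b1"
  proof -
    have "mean M L = (\<integral>\<omega>. Y \<omega> * a2 * b1 \<partial>M)"
      by (rule mixed_poisson_mean[OF assms(1) L])
        (use intY Y(2) a2 b1p in \<open>auto elim: eventually_mono\<close>)
    then show ?thesis by (simp add: b1 moment_def)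
  qed
  also have "c * (a2 * b1) powr (\<kappa> - 1) / (a2 * b1 * b1) = c * a2 powr (\<kappa> - 2) * b1 powr (\<kappa> - 3)"
    using a2 b1p by (simp add: powr_mult powr_diff field_simps power2_eq_square power3_eq_cube)
  finally have "power_decay (\<lambda>k. p_tilde M L (k + 1)) (\<kappa> - 1) (c * a2 powr (\<kappa> - 2) * b1 powr (\<kappa> - 3))" .
  from power_decay_product_asymp_equiv[OF this] a2 b1p pos
  have "(\<lambda>(k1, k2). p_infty M L k1 k2) \<sim>[at_top \<times>\<^sub>F at_top]
    (\<lambda>(k1, k2). (c * a2 powr (\<kappa> - 2) * b1 powr (\<kappa> - 3))\<^sup>2 * (real k1 * real k2) powr (1 - \<kappa>))"
    by (simp add: p_infty_def)
  moreover have "(c * a2 powr (\<kappa> - 2) * b1 powr (\<kappa> - 3))\<^sup>2 = c\<^sup>2 * a2 powr (2 * \<kappa> - 4) * b1 powr (2 * \<kappa> - 6)"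
    by (simp add: power2_eq_square mult_ac flip: powr_add)
  ultimately show ?thesis by simp
qed

lemma integral_size_biased_poisson_prob:
  assumes "\<mu> \<noteq> 0"
  shows "(\<integral>\<omega>. Y \<omega> * poisson_prob (Y \<omega> * \<mu>) n \<partial>M)
    = (real n + 1) * (\<integral>\<omega>. poisson_prob (Y \<omega> * \<mu>) (Suc n) \<partial>M) / \<mu>"
proof -
  have "Y \<omega> * poisson_prob (Y \<omega> * \<mu>) n = (real n + 1) / \<mu> * poisson_prob (Y \<omega> * \<mu>) (Suc n)" for \<omega>
    using poisson_prob_Suc[of n "Y \<omega> * \<mu>"] assms by (simp add: field_simps)
  then show ?thesis by simp
qed

text \<open>For constant \<open>X\<close> both \<open>\<Lambda>\<^sub>0\<close> and \<open>\<tau>\<close> are Poisson of the same rate \<open>l\<close>. Hence \<open>q\<close> is the mixture of Poisson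
probabilities of rates \<open>n l\<close> with weights \<open>w n = E (Y P(Poisson (Y \<mu>) = n))\<close>, and size-biasing shows that the weights have a
power law with exponent \<open>\<kappa> - 1\<close>.\<close>

lemma p_beta_asymp_equiv_constant_X:
  assumes M: "prob_space M" and X: "X \<in> borel_measurable M" "measure M {\<omega> \<in> space M. X \<omega> = x} = 1"
    and Y: "Y \<in> borel_measurable M" "AE \<omega> in M. 0 \<le> Y \<omega>" "\<not> (AE \<omega> in M. Y \<omega> = 0)"
    and pos: "\<beta> > 0" "c > 0" "x > 0" "\<kappa> > 2"
    and b1: "b1 = moment M Y 1" and a1: "a1 = moment M X 1"
    and L0: "mixed_poisson M (\<lambda>\<omega>. X \<omega> * b1 * \<beta> powr (-1/2)) L0"
    and N: "cond_poisson M Y (\<lambda>y. y * a1 * \<beta> powr (1/2)) N"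
    and iid: "prob_space.indep_vars M (\<lambda>_. count_space UNIV) \<tau> {1..}"
    and tau: "\<And>j r. j \<ge> 1 \<Longrightarrow> rv_pmf M (\<tau> j) r = (real r + 1) / mean M L0 * rv_pmf M L0 (r + 1)"
    and ind: "indep_rv M (borel \<Otimes>\<^sub>M count_space UNIV) (\<lambda>\<omega>. (Y \<omega>, N \<omega>))
           (\<Pi>\<^sub>M j\<in>{1..}. count_space UNIV) (\<lambda>\<omega>. \<lambda>j\<in>{1..}. \<tau> j \<omega>)"
    and pl: "power_law M c \<kappa> Y"
  shows "(\<lambda>(k1, k2). p_beta M X Y \<beta> L0 (random_sum N \<tau>) k1 k2) \<sim>[at_top \<times>\<^sub>F at_top]
    (\<lambda>(k1, k2). c ^ 2 * x powr (4 * \<kappa> - 8) * b1 powr (2 * \<kappa> - 6) * (real k1 * real k2) powr (1 - \<kappa>))"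
proof -
  interpret prob_space M by fact
  define qr where "qr = q M Y (random_sum N \<tau>)"
  define l where "l = x * b1 * \<beta> powr (-1/2)"
  define \<mu> where "\<mu> = x * \<beta> powr (1/2)"
  have intY: "integrable M Y" by (rule power_law_integrable[OF M Y(1,2) pl pos(2,4)])
  have b1p: "b1 > 0" unfolding b1 by (rule moment_pos) (use intY Y in auto)
  have AEX: "AE \<omega> in M. X \<omega> = x"
    using X by (subst (asm) prob_eq_1) (auto elim: eventually_mono)
  have mX: "moment M X i = x ^ i" for i
  proof -
    have "moment M X i = (\<integral>\<omega>. x ^ i \<partial>M)"
      unfolding moment_def using AEX X(1) by (intro integral_cong_AE) (auto elim: eventually_mono)
    then show ?thesis by (simp add: prob_space)
  qed
  have lp: "l > 0" and mp: "\<mu> > 0" unfolding l_def \<mu>_def using pos b1p by auto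
  have pmf0: "rv_pmf M L0 r = poisson_prob l r" for r
  proof -
    have "rv_pmf M L0 r = (\<integral>\<omega>. poisson_prob (X \<omega> * b1 * \<beta> powr (-1/2)) r \<partial>M)"
      using L0 by (simp add: mixed_poisson_def)
    also have "\<dots> = (\<integral>\<omega>. poisson_prob l r \<partial>M)"
      using AEX X(1) by (intro integral_cong_AE) (auto elim: eventually_mono simp: l_def)
    finally show ?thesis by (simp add: prob_space)
  qed
  have mean0: "mean M L0 = l"
  proof -
    have AEl: "AE \<omega> in M. X \<omega> * b1 * \<beta> powr (-1/2) = l"
      using AEX by eventually_elim (simp add: l_def)
    have "integrable M (\<lambda>\<omega>. X \<omega> * b1 * \<beta> powr (-1/2))"
      using X(1) AEl by (subst integrable_cong_AE[where g = "\<lambda>_. l"]) auto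
    then have "mean M L0 = (\<integral>\<omega>. X \<omega> * b1 * \<beta> powr (-1/2) \<partial>M)"
      using AEl lp by (intro mixed_poisson_mean[OF M L0]) (auto elim: eventually_mono)
    also have "\<dots> = (\<integral>\<omega>. l \<partial>M)"
      using X(1) AEl by (intro integral_cong_AE) auto
    finally show ?thesis by (simp add: prob_space)
  qed
  have tau': "rv_pmf M (\<tau> j) r = poisson_prob l r" if "j \<ge> 1" for j r
    using poisson_prob_Suc[of r l] lp by (simp add: tau[OF that] mean0 pmf0)
  define m where "m = (\<lambda>n. \<integral>\<omega>. poisson_prob (Y \<omega> * \<mu>) n \<partial>M)"
  define w where "w = (\<lambda>n. \<integral>\<omega>. Y \<omega> * poisson_prob (Y \<omega> * \<mu>) n \<partial>M)"
  have "power_decay m \<kappa> (c * \<mu> powr (\<kappa> - 1))"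
    unfolding m_def by (rule power_decay_mixed_poisson[OF M Y(1,2) pl]) (use pos mp in auto)
  then have "power_decay (\<lambda>n. m (n + 1)) \<kappa> (c * \<mu> powr (\<kappa> - 1))"
    by (simp only: power_decay_shift)
  from power_decay_cmult[OF power_decay_times[OF this, of 1], of "1 / \<mu>"]
  have w: "power_decay w (\<kappa> - 1) (c * \<mu> powr (\<kappa> - 1) / \<mu>)"
    unfolding w_def m_def using mp by (simp add: integral_size_biased_poisson_prob)
  have w0: "w n \<ge> 0" for n
    unfolding w_def
  proof (rule integral_nonneg_AE)
    show "AE \<omega> in M. 0 \<le> Y \<omega> * poisson_prob (Y \<omega> * \<mu>) n"
      using Y(2) by eventually_elim (use mp in \<open>simp add: poisson_prob_nonneg\<close>)
  qed
  have g: "(\<lambda>y. y * a1 * \<beta> powr (1/2)) = (\<lambda>y. y * \<mu>)"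
    by (simp add: \<mu>_def a1 mX mult.assoc)
  have q_eq: "qr r = (\<Sum>n. w n * poisson_prob (real n * l) r)" for r
    using q_compound_sums(2)[OF M intY Y(2) N[unfolded g] _ iid tau' ind, of r]
    by (simp add: qr_def w_def fps_power_poisson_prob sums_iff)
  define A where "A = c * x powr (2 * \<kappa> - 4) * b1 powr (\<kappa> - 2)"
  have qd: "power_decay qr (\<kappa> - 1) A"
  proof -
    have "power_decay qr (\<kappa> - 1) (c * \<mu> powr (\<kappa> - 1) / \<mu> * l powr (\<kappa> - 1 - 1))"
      using power_decay_poisson_mixture_weights[OF w0 w _ lp] pos by (simp add: q_eq[abs_def])
    also have "c * \<mu> powr (\<kappa> - 1) / \<mu> * l powr (\<kappa> - 1 - 1) = c * (\<mu> * l) powr (\<kappa> - 2)"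
      using mp by (simp add: powr_mult powr_diff field_simps power2_eq_square)
    also have "\<mu> * l = x\<^sup>2 * b1"
      unfolding \<mu>_def l_def using pos by (simp add: power2_eq_square mult_ac flip: powr_add)
    also have "c * (x\<^sup>2 * b1) powr (\<kappa> - 2) = A"
      unfolding A_def using pos by (simp add: powr_mult powr_powr algebra_simps flip: powr_numeral)
    finally show ?thesis .
  qed
  define S where "S = (\<lambda>(k1, k2). \<Sum>r=0..min k1 k2. poisson_prob l r * qr (k1 - r) * qr (k2 - r))"
  have "((\<lambda>(k1, k2). (\<Sum>r=0..min k1 k2. poisson_prob l r * qr (k1 - r) * qr (k2 - r)) * (real k1 powr (\<kappa> - 1) * real k2 powr (\<kappa> - 1)))
    \<longlongrightarrow> A\<^sup>2 * (\<Sum>r. poisson_prob l r)) (at_top \<times>\<^sub>F at_top)"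
  proof (rule light_tail_convolution_product[OF qd])
    show "summable (\<lambda>r. poisson_prob l r * (real r + 1) powr (2 * (\<kappa> - 1)))"
    proof -
      obtain C where C: "C > 0" "\<And>n. (real n + 1) powr (2 * (\<kappa> - 1)) \<le> C * 2 ^ n"
        using powr_le_geometric[of 2] by auto
      have "summable (\<lambda>r. C * ((2 * l) ^ r / fact r))"
        using summable_exp[of "2 * l"] by (intro summable_mult) (simp add: field_simps)
      then show ?thesis
      proof (rule summable_comparison_test[rotated], intro exI allI impI)
        fix r
        have "poisson_prob l r * (real r + 1) powr (2 * (\<kappa> - 1)) \<le> l ^ r / fact r * (C * 2 ^ r)"
          using lp C by (intro mult_mono poisson_prob_le_power C(2)) auto
        then show "norm (poisson_prob l r * (real r + 1) powr (2 * (\<kappa> - 1))) \<le> C * ((2 * l) ^ r / fact r)"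
          using lp by (simp add: poisson_prob_nonneg power_mult_distrib mult_ac)
      qed
    qed
  qed (use pos lp in \<open>auto intro: poisson_prob_nonneg\<close>)
  then have "((\<lambda>z. S z * real (fst z) powr (\<kappa> - 1) * real (snd z) powr (\<kappa> - 1)) \<longlongrightarrow> A\<^sup>2) (at_top \<times>\<^sub>F at_top)"
    using poisson_prob_sums_1[of l] by (simp add: S_def split_beta' sums_iff mult.assoc)
  then have "S \<sim>[at_top \<times>\<^sub>F at_top] (\<lambda>z. A\<^sup>2 * real (fst z) powr (-(\<kappa> - 1)) * real (snd z) powr (-(\<kappa> - 1)))"
    by (rule tendsto_imp_asymp_equiv_powr) (use pos b1p in \<open>simp add: A_def\<close>)
  then have "(\<lambda>z. 1 / b1\<^sup>2 * S z) \<sim>[at_top \<times>\<^sub>F at_top]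
      (\<lambda>z. 1 / b1\<^sup>2 * (A\<^sup>2 * real (fst z) powr (-(\<kappa> - 1)) * real (snd z) powr (-(\<kappa> - 1))))"
    by (intro asymp_equiv_mult asymp_equiv_refl)
  moreover have "(\<lambda>(k1, k2). p_beta M X Y \<beta> L0 (random_sum N \<tau>) k1 k2) = (\<lambda>z. 1 / b1\<^sup>2 * S z)"
  proof
    fix z :: "nat \<times> nat"
    obtain k1 k2 where z: "z = (k1, k2)" by (cases z)
    have "(real r + 1) * (real r + 2) * poisson_prob l (r + 2) = l\<^sup>2 * poisson_prob l r" for r
      using poisson_prob_Suc[of "Suc r" l] poisson_prob_Suc[of r l]
      by (simp add: power2_eq_square mult_ac add_ac)
    then have "p_beta M X Y \<beta> L0 (random_sum N \<tau>) k1 k2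
        = \<beta> / (b1 ^ 4 * x\<^sup>2) * (\<Sum>r=0..min k1 k2. l\<^sup>2 * poisson_prob l r * qr (k1 - r) * qr (k2 - r))"
      unfolding p_beta_def b1[symmetric] mX pmf0 qr_def by simp
    also have "\<dots> = \<beta> / (b1 ^ 4 * x\<^sup>2) * l\<^sup>2 * S z"
      by (simp add: S_def z sum_distrib_left mult.assoc)
    also have "\<beta> / (b1 ^ 4 * x\<^sup>2) * l\<^sup>2 = 1 / b1\<^sup>2"
    proof -
      have "(\<beta> powr (-1/2))\<^sup>2 = 1 / \<beta>"
        using pos by (simp add: power2_eq_square powr_minus_divide flip: powr_add)
      then have "l\<^sup>2 = x\<^sup>2 * b1\<^sup>2 / \<beta>" by (simp add: l_def power_mult_distrib)
      then show ?thesis using pos b1p by (simp add: power4_eq_xxxx power2_eq_square)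
    qed
    finally show "(case z of (k1, k2) \<Rightarrow> p_beta M X Y \<beta> L0 (random_sum N \<tau>) k1 k2) = 1 / b1\<^sup>2 * S z"
      by (simp add: z)
  qed
  moreover have "(\<lambda>z. 1 / b1\<^sup>2 * (A\<^sup>2 * real (fst z) powr (-(\<kappa> - 1)) * real (snd z) powr (-(\<kappa> - 1))))
      = (\<lambda>(k1, k2). c ^ 2 * x powr (4 * \<kappa> - 8) * b1 powr (2 * \<kappa> - 6) * (real k1 * real k2) powr (1 - \<kappa>))"
  proof -
    have "(x powr (2 * \<kappa> - 4))\<^sup>2 = x powr (4 * \<kappa> - 8)"
      by (simp add: power2_eq_square flip: powr_add)
    then have "A\<^sup>2 / b1\<^sup>2 = c\<^sup>2 * x powr (4 * \<kappa> - 8) * (b1 powr (\<kappa> - 2) / b1)\<^sup>2"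
      by (simp add: A_def power_mult_distrib power_divide)
    also have "b1 powr (\<kappa> - 2) / b1 = b1 powr (\<kappa> - 3)"
      using b1p by (simp add: powr_diff power2_eq_square power3_eq_cube)
    also have "(b1 powr (\<kappa> - 3))\<^sup>2 = b1 powr (2 * \<kappa> - 6)"
      by (simp add: power2_eq_square flip: powr_add)
    finally have const: "A\<^sup>2 / b1\<^sup>2 = c\<^sup>2 * x powr (4 * \<kappa> - 8) * b1 powr (2 * \<kappa> - 6)" .
    show ?thesis unfolding const[symmetric] by (simp add: fun_eq_iff powr_mult)
  qed
  ultimately show ?thesis by simp
qed

section \<open>Heavy-tailed X\<close>

lemma exp_moment_integrable:
  fixes Y :: "'a \<Rightarrow> real"
  assumes Y: "Y \<in> borel_measurable M" "AE \<omega> in M. 0 \<le> Y \<omega>"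
    and a: "a > 0" "integrable M (\<lambda>\<omega>. exp (a * Y \<omega>))"
  shows "integrable M Y" "integrable M (\<lambda>\<omega>. Y \<omega> ^ 2)" "integrable M (\<lambda>\<omega>. Y \<omega> * exp (a / 2 * Y \<omega>))"
proof -
  show "integrable M Y"
  proof (rule Bochner_Integration.integrable_bound)
    show "integrable M (\<lambda>\<omega>. 1 / a * exp (a * Y \<omega>))" using a(2) by (rule integrable_mult_right)
    show "AE \<omega> in M. norm (Y \<omega>) \<le> norm (1 / a * exp (a * Y \<omega>))"
      using Y(2)
    proof eventually_elim
      case (elim \<omega>)
      have "a * Y \<omega> \<le> exp (a * Y \<omega>)" using exp_ge_add_one_self[of "a * Y \<omega>"] by linarith
      then show ?case using elim a(1) by (simp add: pos_le_divide_eq mult.commute)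
    qed
  qed (rule Y(1))
  show "integrable M (\<lambda>\<omega>. Y \<omega> ^ 2)"
  proof (rule Bochner_Integration.integrable_bound)
    show "integrable M (\<lambda>\<omega>. 2 / a\<^sup>2 * exp (a * Y \<omega>))" using a(2) by (rule integrable_mult_right)
    show "AE \<omega> in M. norm (Y \<omega> ^ 2) \<le> norm (2 / a\<^sup>2 * exp (a * Y \<omega>))"
      using Y(2)
    proof eventually_elim
      case (elim \<omega>)
      have "0 \<le> a * Y \<omega>" using elim a by simp
      then have "(a * Y \<omega>)\<^sup>2 \<le> 2 * exp (a * Y \<omega>)"
        using exp_lower_Taylor_quadratic[of "a * Y \<omega>"] by linarith
      then show ?case using a(1) by (simp add: pos_le_divide_eq power_mult_distrib mult.commute)
    qed
  qed (use Y(1) in measurable)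
  show "integrable M (\<lambda>\<omega>. Y \<omega> * exp (a / 2 * Y \<omega>))"
  proof (rule Bochner_Integration.integrable_bound)
    show "integrable M (\<lambda>\<omega>. 2 / a * exp (a * Y \<omega>))" using a(2) by (rule integrable_mult_right)
    show "AE \<omega> in M. norm (Y \<omega> * exp (a / 2 * Y \<omega>)) \<le> norm (2 / a * exp (a * Y \<omega>))"
      using Y(2)
    proof eventually_elim
      case (elim \<omega>)
      have "a / 2 * Y \<omega> \<le> exp (a / 2 * Y \<omega>)" using exp_ge_add_one_self[of "a / 2 * Y \<omega>"] by linarith
      then have "a / 2 * Y \<omega> * exp (a / 2 * Y \<omega>) \<le> exp (a / 2 * Y \<omega>) * exp (a / 2 * Y \<omega>)"
        by (intro mult_right_mono) auto
      also have "\<dots> = exp (a * Y \<omega>)" by (simp flip: exp_add)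
      finally show ?case using elim a(1) by (simp add: abs_mult pos_le_divide_eq mult_ac)
    qed
  qed (use Y(1) in measurable)
qed

text \<open>Up to a shift by one, the summand \<open>\<tau>\<close> is the size-biased \<open>\<Lambda>\<^sub>0\<close>, so its exponent is \<open>\<kappa> - 1\<close>. The weights
\<open>w n = E (Y P(Poisson (Y \<mu>) = n))\<close> have the generating function \<open>E (Y exp ((z - 1) \<mu> Y))\<close>, finite for some \<open>z > 1\<close>, so all
their polynomial moments exist; the first one, \<open>\<mu> E Y\<^sup>2\<close>, is the expected \<open>Y\<close>-biased number of summands and
enters the constant by the principle of a single big jump.\<close>

lemma q_power_decay_light_Y:
  assumes M: "prob_space M" and X: "X \<in> borel_measurable M" "AE \<omega> in M. 0 \<le> X \<omega>" "\<not> (AE \<omega> in M. X \<omega> = 0)"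
    and Y: "Y \<in> borel_measurable M" "AE \<omega> in M. 0 \<le> Y \<omega>" "\<not> (AE \<omega> in M. Y \<omega> = 0)"
    and pos: "\<beta> > 0" "c > 0" "a > 0" "\<kappa> > 2"
    and b1: "b1 = moment M Y 1" and b2: "b2 = moment M Y 2" and a1: "a1 = moment M X 1"
    and L0: "mixed_poisson M (\<lambda>\<omega>. X \<omega> * b1 * \<beta> powr (-1/2)) L0"
    and N: "cond_poisson M Y (\<lambda>y. y * a1 * \<beta> powr (1/2)) N"
    and iid: "prob_space.indep_vars M (\<lambda>_. count_space UNIV) \<tau> {1..}"
    and tau: "\<And>j r. j \<ge> 1 \<Longrightarrow> rv_pmf M (\<tau> j) r = (real r + 1) / mean M L0 * rv_pmf M L0 (r + 1)"
    and ind: "indep_rv M (borel \<Otimes>\<^sub>M count_space UNIV) (\<lambda>\<omega>. (Y \<omega>, N \<omega>))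
           (\<Pi>\<^sub>M j\<in>{1..}. count_space UNIV) (\<lambda>\<omega>. \<lambda>j\<in>{1..}. \<tau> j \<omega>)"
    and pl: "power_law M c \<kappa> X" and ex: "integrable M (\<lambda>\<omega>. exp (a * Y \<omega>))"
  shows "power_decay (rv_pmf M L0) \<kappa> (c * (b1 * \<beta> powr (-1/2)) powr (\<kappa> - 1))"
    and "power_decay (q M Y (random_sum N \<tau>)) (\<kappa> - 1) (c * b1 powr (\<kappa> - 2) * b2 * \<beta> powr ((3 - \<kappa>) / 2))"
proof -
  interpret prob_space M by fact
  define s where "s = b1 * \<beta> powr (-1/2)"
  define \<mu> where "\<mu> = a1 * \<beta> powr (1/2)"
  define c1 where "c1 = c * s powr (\<kappa> - 1)"
  note intY = exp_moment_integrable[OF Y(1,2) pos(3) ex]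
  have intX: "integrable M X" by (rule power_law_integrable[OF M X(1,2) pl pos(2,4)])
  have b1p: "b1 > 0" unfolding b1 by (rule moment_pos) (use intY(1) Y in auto)
  have a1p: "a1 > 0" unfolding a1 by (rule moment_pos) (use intX X in auto)
  have sp: "s > 0" and mp: "\<mu> > 0" unfolding s_def \<mu>_def using b1p a1p pos by auto
  have rate: "(\<lambda>\<omega>. X \<omega> * b1 * \<beta> powr (-1/2)) = (\<lambda>\<omega>. X \<omega> * s)" by (simp add: s_def mult.assoc)
  have "power_decay (\<lambda>r. \<integral>\<omega>. poisson_prob (X \<omega> * s) r \<partial>M) \<kappa> c1"
    unfolding c1_def by (rule power_decay_mixed_poisson[OF M X(1,2) pl]) (use pos sp in auto)
  moreover have "(\<lambda>r. \<integral>\<omega>. poisson_prob (X \<omega> * s) r \<partial>M) = rv_pmf M L0"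
    using L0 unfolding rate by (simp add: mixed_poisson_def fun_eq_iff)
  ultimately have L0d: "power_decay (rv_pmf M L0) \<kappa> c1" by simp
  then show "power_decay (rv_pmf M L0) \<kappa> (c * (b1 * \<beta> powr (-1/2)) powr (\<kappa> - 1))"
    unfolding c1_def s_def .
  have mean0: "mean M L0 = a1 * s"
  proof -
    have "mean M L0 = (\<integral>\<omega>. X \<omega> * s \<partial>M)"
      by (rule mixed_poisson_mean[OF M L0[unfolded rate]])
        (use intX X(2) sp in \<open>auto elim: eventually_mono\<close>)
    then show ?thesis by (simp add: a1 moment_def)
  qed
  define t where "t = (\<lambda>r. (real r + 1) / mean M L0 * rv_pmf M L0 (r + 1))"
  have t_eq: "t = rv_pmf M (\<tau> 1)" using tau[of 1] by (simp add: t_def fun_eq_iff)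
  have t0: "t r \<ge> 0" for r unfolding t_eq by (rule rv_pmf_nonneg)
  have ts: "t sums 1"
    unfolding t_eq using iid by (intro rv_pmf_sums_1[OF M]) (auto simp: indep_vars_def)
  have td: "power_decay t (\<kappa> - 1) (c1 / mean M L0)"
  proof -
    have "power_decay (\<lambda>r. rv_pmf M L0 (r + 1)) \<kappa> c1" using L0d by (simp only: power_decay_shift)
    from power_decay_cmult[OF power_decay_times[OF this, of 1], of "1 / mean M L0"]
    show ?thesis by (simp add: t_def)
  qed
  define w where "w = (\<lambda>n. \<integral>\<omega>. Y \<omega> * poisson_prob (Y \<omega> * \<mu>) n \<partial>M)"
  have wn: "AE \<omega> in M. 0 \<le> Y \<omega> * poisson_prob (Y \<omega> * \<mu>) n" for n
    using Y(2) by eventually_elim (use mp in \<open>simp add: poisson_prob_nonneg\<close>)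
  have w0: "w n \<ge> 0" for n unfolding w_def by (rule integral_nonneg_AE[OF wn])
  \<comment> \<open>Half of the exponential moment is spent on the factor \<open>Y\<close>.\<close>
  define z where "z = 1 + a / (2 * \<mu>)"
  have z: "z > 1" "(z - 1) * \<mu> = a / 2" using pos mp by (simp_all add: z_def)
  have w_geo: "summable (\<lambda>n. w n * z ^ n)"
  proof -
    have "(\<lambda>n. \<integral>\<omega>. Y \<omega> * poisson_prob (Y \<omega> * \<mu>) n * z ^ n \<partial>M) sums (\<integral>\<omega>. Y \<omega> * exp (a / 2 * Y \<omega>) \<partial>M)"
    proof (rule sums_integral_nonneg(1)[OF _ _ _ intY(3)])
      show "AE \<omega> in M. 0 \<le> Y \<omega> * poisson_prob (Y \<omega> * \<mu>) n * z ^ n" for n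
        using wn[of n] by eventually_elim (use z in simp)
      show "AE \<omega> in M. (\<lambda>n. Y \<omega> * poisson_prob (Y \<omega> * \<mu>) n * z ^ n) sums (Y \<omega> * exp (a / 2 * Y \<omega>))"
      proof (intro always_eventually allI)
        fix \<omega>
        have "(\<lambda>n. Y \<omega> * (poisson_prob (Y \<omega> * \<mu>) n * z ^ n)) sums (Y \<omega> * exp ((z - 1) * (Y \<omega> * \<mu>)))"
          by (intro sums_mult poisson_prob_pgf_sums)
        moreover have "(z - 1) * (Y \<omega> * \<mu>) = a / 2 * Y \<omega>"
          unfolding z(2)[symmetric] by simp
        ultimately show "(\<lambda>n. Y \<omega> * poisson_prob (Y \<omega> * \<mu>) n * z ^ n) sums (Y \<omega> * exp (a / 2 * Y \<omega>))"
          by (simp only: mult.assoc)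
      qed
    qed (use Y(1) in measurable)
    then show ?thesis by (simp add: w_def sums_iff)
  qed
  have w_poly: "summable (\<lambda>n. w n * real n powr (\<kappa> - 1 + 1))"
  proof -
    obtain C where C: "C > 0" "\<And>n. (real n + 1) powr \<kappa> \<le> C * z ^ n"
      using powr_le_geometric[OF z(1)] by blast
    show ?thesis
    proof (rule summable_comparison_test[OF _ summable_mult[OF w_geo, of C]], intro exI allI impI)
      fix n
      have "real n powr \<kappa> \<le> (real n + 1) powr \<kappa>" using pos by (intro powr_mono2) auto
      also note C(2)[of n]
      finally have "w n * real n powr \<kappa> \<le> w n * (C * z ^ n)" by (intro mult_left_mono w0)
      then show "norm (w n * real n powr (\<kappa> - 1 + 1)) \<le> C * (w n * z ^ n)"
        using w0[of n] by (simp add: mult_ac)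
    qed
  qed
  have w_mean: "(\<Sum>n. real n * w n) = \<mu> * b2"
  proof -
    have "(\<lambda>n. \<integral>\<omega>. real n * (Y \<omega> * poisson_prob (Y \<omega> * \<mu>) n) \<partial>M) sums (\<integral>\<omega>. \<mu> * Y \<omega> ^ 2 \<partial>M)"
    proof (rule sums_integral_nonneg(1))
      show "AE \<omega> in M. 0 \<le> real n * (Y \<omega> * poisson_prob (Y \<omega> * \<mu>) n)" for n
        using wn[of n] by eventually_elim simp
      show "AE \<omega> in M. (\<lambda>n. real n * (Y \<omega> * poisson_prob (Y \<omega> * \<mu>) n)) sums (\<mu> * Y \<omega> ^ 2)"
      proof (intro always_eventually allI)
        fix \<omega>
        have "(\<lambda>n. Y \<omega> * (real n * poisson_prob (Y \<omega> * \<mu>) n)) sums (Y \<omega> * (Y \<omega> * \<mu>))"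
          by (intro sums_mult poisson_prob_mean_sums)
        then show "(\<lambda>n. real n * (Y \<omega> * poisson_prob (Y \<omega> * \<mu>) n)) sums (\<mu> * Y \<omega> ^ 2)"
          by (simp add: power2_eq_square mult_ac)
      qed
    qed (use Y(1) intY(2) in auto)
    then show ?thesis by (simp add: w_def b2 moment_def sums_iff)
  qed
  have g: "(\<lambda>y. y * a1 * \<beta> powr (1/2)) = (\<lambda>y. y * \<mu>)" by (simp add: \<mu>_def mult.assoc)
  have q_eq: "q M Y (random_sum N \<tau>) r = (\<Sum>n. w n * fps_nth (Abs_fps t ^ n) r)" for r
    using q_compound_sums(2)[OF M intY(1) Y(2) N[unfolded g] _ iid _ ind, of t r] tau
    by (simp add: w_def t_def sums_iff)
  have "power_decay (q M Y (random_sum N \<tau>)) (\<kappa> - 1) (c1 / mean M L0 * (\<mu> * b2))"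
    using power_decay_compound[OF t0 ts td _ w0 w_poly] pos by (simp add: q_eq[abs_def] w_mean)
  also have "c1 / mean M L0 * (\<mu> * b2) = c * b1 powr (\<kappa> - 2) * b2 * \<beta> powr ((3 - \<kappa>) / 2)"
  proof -
    have "c1 / mean M L0 * (\<mu> * b2) = c * (s powr (\<kappa> - 1) / s) * \<beta> powr (1/2) * b2"
      using a1p by (simp add: c1_def mean0 \<mu>_def)
    also have "s powr (\<kappa> - 1) / s = s powr (\<kappa> - 2)"
      using sp by (simp add: powr_diff power2_eq_square)
    also have "s powr (\<kappa> - 2) = b1 powr (\<kappa> - 2) * \<beta> powr (-(1/2) * (\<kappa> - 2))"
      by (simp add: s_def powr_mult powr_powr)
    finally have "c1 / mean M L0 * (\<mu> * b2)
      = c * b1 powr (\<kappa> - 2) * b2 * (\<beta> powr (-(1/2) * (\<kappa> - 2)) * \<beta> powr (1/2))" by simp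
    also have "\<beta> powr (-(1/2) * (\<kappa> - 2)) * \<beta> powr (1/2) = \<beta> powr ((3 - \<kappa>) / 2)"
      unfolding powr_add[symmetric] by (rule arg_cong[where f = "\<lambda>e. \<beta> powr e"]) (simp add: field_simps)
    finally show ?thesis .
  qed
  finally show "power_decay (q M Y (random_sum N \<tau>)) (\<kappa> - 1) (c * b1 powr (\<kappa> - 2) * b2 * \<beta> powr ((3 - \<kappa>) / 2))" .
qed

lemma p_beta_eq_convolution:
  assumes "k1 \<le> k2"
  shows "p_beta M X Y \<beta> L d k1 k2 = \<beta> / (moment M Y 1 ^ 4 * moment M X 2) *
    (\<Sum>i=0..k1. (real (k1 - i) + 1) * (real (k1 - i) + 2) * rv_pmf M L (k1 - i + 2)
        * (q M Y d i * q M Y d (i + (k2 - k1))))"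
proof -
  have "(\<Sum>r=0..k1. (real r + 1) * (real r + 2) * rv_pmf M L (r + 2) * q M Y d (k1 - r) * q M Y d (k2 - r))
      = (\<Sum>i=0..k1. (real (k1 - i) + 1) * (real (k1 - i) + 2) * rv_pmf M L (k1 - i + 2)
        * (q M Y d i * q M Y d (i + (k2 - k1))))"
    by (rule sum.reindex_bij_witness[of _ "\<lambda>i. k1 - i" "\<lambda>i. k1 - i"])
      (use assms in \<open>auto simp: mult.assoc\<close>)
  then show ?thesis
    using assms by (simp add: p_beta_def min_def)
qed

text \<open>In the convolution form of \<open>p\<^sub>\<beta>\<close> the first factor \<open>h\<close> has exponent \<open>\<kappa> - 2\<close>, while the second is dominated by a
multiple of \<open>q\<close>, which is negligible against \<open>r\<^sup>2\<^sup>-\<^sup>\<kappa>\<close>. The condition \<open>\<kappa> > 3\<close> makes \<open>h\<close> summable.\<close>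

lemma p_beta_asymp_equiv_heavy_X:
  assumes L: "power_decay (rv_pmf M L) \<kappa> c1" and qd: "power_decay (q M Y d) (\<kappa> - 1) c2"
    and q0: "\<And>r. q M Y d r \<ge> 0" and qs: "q M Y d sums moment M Y 1"
    and pos: "c1 > 0" "c2 > 0" "moment M Y 1 > 0" "\<kappa> > 3"
  shows "(\<lambda>(k1, k2). p_beta M X Y \<beta> L d k1 k2) \<sim>[far_apart]
      (\<lambda>(k1, k2). \<beta> / (moment M Y 1 ^ 4 * moment M X 2)
        * (moment M Y 1 * c1 * c2 * real k1 powr (2 - \<kappa>) * real (k2 - k1) powr (1 - \<kappa>)))"
    and "(\<lambda>k1. p_beta M X Y \<beta> L d k1 (k1 + k)) \<sim>[at_top]
      (\<lambda>k1. \<beta> / (moment M Y 1 ^ 4 * moment M X 2)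
        * (c1 * (\<Sum>i. q M Y d i * q M Y d (k + i)) * real k1 powr (2 - \<kappa>)))"
proof -
  define b where "b = moment M Y 1"
  define B where "B = \<beta> / (moment M Y 1 ^ 4 * moment M X 2)"
  define u where "u = q M Y d"
  define h where "h = (\<lambda>r. (real r + 1) * (real r + 2) * rv_pmf M L (r + 2))"
  have u0: "u r \<ge> 0" for r using q0 by (simp add: u_def)
  have ud: "power_decay u (\<kappa> - 1) c2" using qd by (simp add: u_def)
  have us: "u sums b" using qs by (simp add: u_def b_def)
  have hd: "power_decay h (\<kappa> - 2) c1"
  proof -
    have "power_decay (\<lambda>r. rv_pmf M L (r + 2)) \<kappa> c1" using L by (simp only: power_decay_shift)
    from power_decay_times[OF power_decay_times[OF this, of 2], of 1] show ?thesis
      by (simp add: h_def mult.assoc)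
  qed
  obtain C where C: "C > 0" "\<And>r. \<bar>u r\<bar> \<le> C * (real r + 1) powr (-(\<kappa> - 1))"
    using power_decay_bound[OF ud] by blast
  have u_light: "power_decay u (\<kappa> - 2) 0"
  proof -
    have "(\<lambda>r. u r * real r powr (\<kappa> - 1) * (1 / real r)) \<longlonglongrightarrow> c2 * 0"
      using ud unfolding power_decay_def by (intro tendsto_mult lim_1_over_n)
    moreover have "eventually (\<lambda>r. u r * real r powr (\<kappa> - 1) * (1 / real r) = u r * real r powr (\<kappa> - 2)) at_top"
      using eventually_gt_at_top[of 0]
      by eventually_elim (simp add: powr_diff power2_eq_square)
    ultimately show ?thesis unfolding power_decay_def by (auto elim: Lim_transform_eventually)
  qed
  define \<Psi> where "\<Psi> = (\<lambda>z. \<Sum>i=0..fst z. h (fst z - i) * (u i * u (i + snd z)))"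
  have pb: "p_beta M X Y \<beta> L d k1 k2 = B * \<Psi> (k1, k2 - k1)" if "k1 \<le> k2" for k1 k2
    unfolding B_def \<Psi>_def h_def u_def using p_beta_eq_convolution[OF that, of M X Y \<beta> L d] by simp
  have "((\<lambda>z. (\<Sum>i=0..fst z. h (fst z - i) * (u i * (u (i + snd z) * real (snd z) powr (\<kappa> - 1)))) * real (fst z) powr (\<kappa> - 2))
      \<longlongrightarrow> c1 * (\<Sum>i. u i * c2)) (at_top \<times>\<^sub>F at_top)"
  proof (rule convolution_light_family[where K = fst and h = h and H = "\<lambda>i. C * u i"
        and G = "\<lambda>z i. u i * (u (i + snd z) * real (snd z) powr (\<kappa> - 1))"])
    show "at_top \<times>\<^sub>F at_top \<noteq> (bot :: (nat \<times> nat) filter)" by (simp add: prod_filter_eq_bot)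
    show "((\<lambda>z :: nat \<times> nat. u i * (u (i + snd z) * real (snd z) powr (\<kappa> - 1))) \<longlongrightarrow> u i * c2) (at_top \<times>\<^sub>F at_top)" for i
    proof -
      have "power_decay (\<lambda>m. u (m + i)) (\<kappa> - 1) c2" using ud by (simp only: power_decay_shift)
      then have "(\<lambda>m. u (i + m) * real m powr (\<kappa> - 1)) \<longlonglongrightarrow> c2" by (simp add: power_decay_def add.commute)
      from filterlim_compose[OF this filterlim_snd]
      show ?thesis by (rule tendsto_mult_left)
    qed
    show "eventually (\<lambda>z :: nat \<times> nat. \<forall>i. \<bar>u i * (u (i + snd z) * real (snd z) powr (\<kappa> - 1))\<bar> \<le> C * u i) (at_top \<times>\<^sub>F at_top)"
    proof (intro always_eventually allI)
      fix z :: "nat \<times> nat" and i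
      have "u (i + snd z) * real (snd z) powr (\<kappa> - 1)
          \<le> C * (real (i + snd z) + 1) powr (-(\<kappa> - 1)) * (real (i + snd z) + 1) powr (\<kappa> - 1)"
        using C(2)[of "i + snd z"] u0 C(1) pos by (intro mult_mono powr_mono2) auto
      also have "\<dots> = C" by (simp add: mult.assoc powr_add[symmetric] add_nonneg_eq_0_iff)
      finally have "u i * (u (i + snd z) * real (snd z) powr (\<kappa> - 1)) \<le> u i * C"
        by (intro mult_left_mono u0)
      then show "\<bar>u i * (u (i + snd z) * real (snd z) powr (\<kappa> - 1))\<bar> \<le> C * u i"
        using u0 by (simp add: mult.commute)
    qed
    show "power_decay (\<lambda>i. C * u i) (\<kappa> - 2) 0" using power_decay_cmult[OF u_light, of C] by simp
  qed (use hd pos filterlim_fst in auto)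
  moreover have "(\<Sum>i=0..fst z. h (fst z - i) * (u i * (u (i + snd z) * real (snd z) powr (\<kappa> - 1)))) * real (fst z) powr (\<kappa> - 2)
      = \<Psi> z * real (fst z) powr (\<kappa> - 2) * real (snd z) powr (\<kappa> - 1)" for z
    by (simp add: \<Psi>_def sum_distrib_left sum_distrib_right mult_ac)
  moreover have "c1 * (\<Sum>i. u i * c2) = b * c1 * c2"
    using sums_mult2[OF us, of c2] by (simp add: sums_iff mult_ac)
  ultimately have "((\<lambda>z. \<Psi> z * real (fst z) powr (\<kappa> - 2) * real (snd z) powr (\<kappa> - 1)) \<longlongrightarrow> b * c1 * c2) (at_top \<times>\<^sub>F at_top)"
    by simp
  then have "\<Psi> \<sim>[at_top \<times>\<^sub>F at_top] (\<lambda>z. b * c1 * c2 * real (fst z) powr (-(\<kappa> - 2)) * real (snd z) powr (-(\<kappa> - 1)))"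
    by (rule tendsto_imp_asymp_equiv_powr) (use pos in \<open>simp add: b_def\<close>)
  from asymp_equiv_compose'[OF this filterlim_far_apart(1)]
  have "(\<lambda>z. B * \<Psi> (case z of (k1, k2) \<Rightarrow> (k1, k2 - k1))) \<sim>[far_apart]
      (\<lambda>z. B * (case z of (k1, k2) \<Rightarrow> b * c1 * c2 * real k1 powr (2 - \<kappa>) * real (k2 - k1) powr (1 - \<kappa>)))"
    by (intro asymp_equiv_mult asymp_equiv_refl) (simp add: split_beta)
  then show "(\<lambda>(k1, k2). p_beta M X Y \<beta> L d k1 k2) \<sim>[far_apart]
      (\<lambda>(k1, k2). \<beta> / (moment M Y 1 ^ 4 * moment M X 2)
        * (moment M Y 1 * c1 * c2 * real k1 powr (2 - \<kappa>) * real (k2 - k1) powr (1 - \<kappa>)))"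
  proof (rule asymp_equiv_transfer)
    show "eventually (\<lambda>z. B * \<Psi> (case z of (k1, k2) \<Rightarrow> (k1, k2 - k1)) = (case z of (k1, k2) \<Rightarrow> p_beta M X Y \<beta> L d k1 k2)) far_apart"
      using filterlim_far_apart(2) by eventually_elim (auto simp: pb)
  qed (intro always_eventually allI, simp add: B_def b_def split_beta mult_ac)
  define c3 where "c3 = (\<Sum>i. u i * u (k + i))"
  have pd: "power_decay (\<lambda>i. u i * u (k + i)) (\<kappa> - 2) 0"
  proof -
    have "(\<lambda>i. u (k + i)) \<longlonglongrightarrow> 0"
      using LIMSEQ_ignore_initial_segment[OF summable_LIMSEQ_zero[OF sums_summable[OF us]], of k]
      by (simp add: add.commute)
    then have "(\<lambda>i. u i * real i powr (\<kappa> - 2) * u (k + i)) \<longlonglongrightarrow> 0 * 0"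
      using u_light unfolding power_decay_def by (intro tendsto_mult)
    then show ?thesis by (simp add: power_decay_def mult_ac)
  qed
  have "((\<lambda>k1. (\<Sum>i=0..k1. h (k1 - i) * (u i * u (k + i))) * real k1 powr (\<kappa> - 2)) \<longlongrightarrow> c1 * c3) at_top"
    unfolding c3_def
    by (rule convolution_light_family[where K = "\<lambda>k1. k1" and h = h
          and G = "\<lambda>_ i. u i * u (k + i)" and H = "\<lambda>i. u i * u (k + i)"])
      (use hd pd pos u0 in \<open>auto simp: filterlim_ident\<close>)
  moreover have "c3 > 0"
  proof -
    have "eventually (\<lambda>i. u i * real i powr (\<kappa> - 1) > 0) at_top"
      using ud pos(2) unfolding power_decay_def by (rule order_tendstoD(1))
    then have "eventually (\<lambda>i. u i > 0) at_top"
    proof eventually_elim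
      case (elim i)
      then have "u i \<noteq> 0" by (intro notI) simp
      with u0[of i] show ?case by linarith
    qed
    then obtain n where n: "\<And>i. i \<ge> n \<Longrightarrow> u i > 0" unfolding eventually_sequentially by blast
    have sm: "summable (\<lambda>i. u i * u (k + i))"
      using power_decay_summable[OF pd] pos by (simp add: summable_rabs_cancel)
    have "0 < u n * u (k + n)" using n by simp
    then show ?thesis
      unfolding c3_def using u0 by (intro suminf_pos2[OF sm]) auto
  qed
  ultimately have "(\<lambda>k1. \<Sum>i=0..k1. h (k1 - i) * (u i * u (k + i))) \<sim>[at_top] (\<lambda>k1. c1 * c3 * real k1 powr (-(\<kappa> - 2)))"
    using pos by (intro power_decay_imp_asymp_equiv) (auto simp: power_decay_def)
  then have equiv: "(\<lambda>k1. B * (\<Sum>i=0..k1. h (k1 - i) * (u i * u (k + i)))) \<sim>[at_top] (\<lambda>k1. B * (c1 * c3 * real k1 powr (-(\<kappa> - 2))))"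
    by (intro asymp_equiv_mult asymp_equiv_refl)
  have "p_beta M X Y \<beta> L d k1 (k1 + k) = B * (\<Sum>i=0..k1. h (k1 - i) * (u i * u (k + i)))" for k1
    using pb[of k1 "k1 + k"] by (simp add: \<Psi>_def add.commute[of _ k])
  with equiv show "(\<lambda>k1. p_beta M X Y \<beta> L d k1 (k1 + k)) \<sim>[at_top]
      (\<lambda>k1. \<beta> / (moment M Y 1 ^ 4 * moment M X 2)
        * (c1 * (\<Sum>i. q M Y d i * q M Y d (k + i)) * real k1 powr (2 - \<kappa>)))"
    by (simp add: c3_def u_def B_def)
qed

section \<open>The three regimes\<close>

theorem theorem3:
  fixes M :: "'a measure"
    and X Y :: "'a \<Rightarrow> real"
    and \<Lambda>0 \<Lambda>1 \<Lambda>3 d :: "'a \<Rightarrow> nat"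
    and \<tau> :: "nat \<Rightarrow> 'a \<Rightarrow> nat"
    and a \<beta> c x \<kappa> a1 a2 b1 b2 :: real
  assumes "prob_space M"
    and "a > 0" "\<beta> > 0" "c > 0" "x > 0"
    and "prob_space.indep_var M borel X borel Y"
    and "AE \<omega> in M. 0 \<le> X \<omega>" "AE \<omega> in M. 0 \<le> Y \<omega>"
    and "\<not> (AE \<omega> in M. X \<omega> = 0)" "\<not> (AE \<omega> in M. Y \<omega> = 0)"
    and "a1 = moment M X 1" "a2 = moment M X 2"
    and "b1 = moment M Y 1" "b2 = moment M Y 2"
    and "mixed_poisson M (\<lambda>\<omega>. X \<omega> * b1 * \<beta> powr (-1/2)) \<Lambda>0"
    and "cond_poisson M Y (\<lambda>y. y * a1 * \<beta> powr (1/2)) \<Lambda>1"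
    and "mixed_poisson M (\<lambda>\<omega>. Y \<omega> * a2 * b1) \<Lambda>3"
    and "prob_space.indep_vars M (\<lambda>_. count_space UNIV) \<tau> {1..}"
    and "\<forall>j\<ge>1. \<forall>r. rv_pmf M (\<tau> j) r = (real r + 1) / mean M \<Lambda>0 * rv_pmf M \<Lambda>0 (r + 1)"
    and "indep_rv M
           (borel \<Otimes>\<^sub>M count_space UNIV) (\<lambda>\<omega>. (Y \<omega>, \<Lambda>1 \<omega>))
           (\<Pi>\<^sub>M j\<in>{1..}. count_space UNIV) (\<lambda>\<omega>. \<lambda>j\<in>{1..}. \<tau> j \<omega>)"
    and "d = random_sum \<Lambda>1 \<tau>"
  shows
    "(integrable M (\<lambda>\<omega>. X \<omega> ^ 2) \<and> \<kappa> > 2 \<and> power_law M c \<kappa> Y \<longrightarrow>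
        (\<lambda>(k1, k2). p_infty M \<Lambda>3 k1 k2) \<sim>[at_top \<times>\<^sub>F at_top]
        (\<lambda>(k1, k2). c ^ 2 * a2 powr (2 * \<kappa> - 4) * b1 powr (2 * \<kappa> - 6)
                      * (real k1 * real k2) powr (1 - \<kappa>)))
     \<and>
     (integrable M (\<lambda>\<omega>. exp (a * Y \<omega>)) \<and> \<kappa> > 3 \<and> power_law M c \<kappa> X \<longrightarrow>
        (let c1 = c * (b1 * \<beta> powr (-1/2)) powr (\<kappa> - 1);
             c2 = c * b1 powr (\<kappa> - 2) * b2 * \<beta> powr ((3 - \<kappa>) / 2);
             c3 = (\<lambda>k. \<Sum>i. q M Y d i * q M Y d (k + i))
         in
           (\<lambda>(k1, k2). p_beta M X Y \<beta> \<Lambda>0 d k1 k2) \<sim>[far_apart]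
           (\<lambda>(k1, k2). \<beta> / (b1 ^ 4 * a2)
                         * (b1 * c1 * c2 * real k1 powr (2 - \<kappa>) * real (k2 - k1) powr (1 - \<kappa>)))
         \<and> (\<forall>k. (\<lambda>k1. p_beta M X Y \<beta> \<Lambda>0 d k1 (k1 + k)) \<sim>[at_top]
                 (\<lambda>k1. \<beta> / (b1 ^ 4 * a2) * (c1 * c3 k * real k1 powr (2 - \<kappa>))))
         \<and> (\<lambda>r. q M Y d r / (c2 * real r powr (1 - \<kappa>))) \<longlonglongrightarrow> 1))
     \<and>
     (measure M {\<omega> \<in> space M. X \<omega> = x} = 1 \<and> \<kappa> > 2 \<and> power_law M c \<kappa> Y \<longrightarrow>
        (\<lambda>(k1, k2). p_beta M X Y \<beta> \<Lambda>0 d k1 k2) \<sim>[at_top \<times>\<^sub>F at_top]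
        (\<lambda>(k1, k2). c ^ 2 * x powr (4 * \<kappa> - 8) * b1 powr (2 * \<kappa> - 6)
                      * (real k1 * real k2) powr (1 - \<kappa>)))"
proof (intro conjI impI)
  note M = assms(1) and ind_XY = assms(6) and X0 = assms(7) and Y0 = assms(8) and Xn = assms(9) and Yn = assms(10)
    and a1 = assms(11) and a2 = assms(12) and b1 = assms(13) and b2 = assms(14)
    and L0 = assms(15) and N = assms(16) and L3 = assms(17) and iid = assms(18) and ind = assms(20)
  interpret prob_space M by fact
  have Xm: "X \<in> borel_measurable M" and Ym: "Y \<in> borel_measurable M"
    using ind_XY by (auto simp: indep_var_eq)
  have tau: "\<And>j r. j \<ge> 1 \<Longrightarrow> rv_pmf M (\<tau> j) r = (real r + 1) / mean M \<Lambda>0 * rv_pmf M \<Lambda>0 (r + 1)"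
    using assms(19) by blast
  {
    assume "integrable M (\<lambda>\<omega>. X \<omega> ^ 2) \<and> \<kappa> > 2 \<and> power_law M c \<kappa> Y"
    then have intX2: "integrable M (\<lambda>\<omega>. X \<omega> ^ 2)" and \<kappa>: "\<kappa> > 2" and pl: "power_law M c \<kappa> Y" by auto
    have "a2 > 0" unfolding a2 by (rule moment_pos[OF intX2 X0 Xn]) simp
    then show "(\<lambda>(k1, k2). p_infty M \<Lambda>3 k1 k2) \<sim>[at_top \<times>\<^sub>F at_top]
        (\<lambda>(k1, k2). c ^ 2 * a2 powr (2 * \<kappa> - 4) * b1 powr (2 * \<kappa> - 6) * (real k1 * real k2) powr (1 - \<kappa>))"
      by (rule p_infty_asymp_equiv[OF M Ym Y0 Yn b1 _ L3 pl assms(4) \<kappa>])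
  next
    assume "measure M {\<omega> \<in> space M. X \<omega> = x} = 1 \<and> \<kappa> > 2 \<and> power_law M c \<kappa> Y"
    then have X1: "measure M {\<omega> \<in> space M. X \<omega> = x} = 1" and \<kappa>: "\<kappa> > 2" and pl: "power_law M c \<kappa> Y" by auto
    show "(\<lambda>(k1, k2). p_beta M X Y \<beta> \<Lambda>0 d k1 k2) \<sim>[at_top \<times>\<^sub>F at_top]
        (\<lambda>(k1, k2). c ^ 2 * x powr (4 * \<kappa> - 8) * b1 powr (2 * \<kappa> - 6) * (real k1 * real k2) powr (1 - \<kappa>))"
      unfolding \<open>d = random_sum \<Lambda>1 \<tau>\<close>
      by (rule p_beta_asymp_equiv_constant_X[OF M Xm X1 Ym Y0 Yn assms(3,4,5) \<kappa> b1 a1 L0 N iid tau ind pl])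
  next
    assume "integrable M (\<lambda>\<omega>. exp (a * Y \<omega>)) \<and> \<kappa> > 3 \<and> power_law M c \<kappa> X"
    then have ex: "integrable M (\<lambda>\<omega>. exp (a * Y \<omega>))" and \<kappa>: "\<kappa> > 3" and pl: "power_law M c \<kappa> X" by auto
    define c1 where "c1 = c * (b1 * \<beta> powr (-1/2)) powr (\<kappa> - 1)"
    define c2 where "c2 = c * b1 powr (\<kappa> - 2) * b2 * \<beta> powr ((3 - \<kappa>) / 2)"
    note intY = exp_moment_integrable[OF Ym Y0 \<open>a > 0\<close> ex]
    have b1p: "b1 > 0" unfolding b1 by (rule moment_pos) (use intY(1) Y0 Yn in auto)
    have b2p: "b2 > 0" unfolding b2 by (rule moment_pos[OF intY(2) Y0 Yn]) simp
    have c1p: "c1 > 0" and c2p: "c2 > 0" unfolding c1_def c2_def using b1p b2p \<open>c > 0\<close> \<open>\<beta> > 0\<close> by auto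
    have \<kappa>2: "\<kappa> > 2" using \<kappa> by simp
    note decay = q_power_decay_light_Y[OF M Xm X0 Xn Ym Y0 Yn \<open>\<beta> > 0\<close> \<open>c > 0\<close> \<open>a > 0\<close> \<kappa>2 b1 b2 a1 L0 N iid tau ind pl ex,
        folded c1_def c2_def \<open>d = random_sum \<Lambda>1 \<tau>\<close>]
    have dm: "d \<in> measurable M (count_space UNIV)"
      unfolding \<open>d = random_sum \<Lambda>1 \<tau>\<close>
      by (rule q_compound_sums(1)[OF M intY(1) Y0 N _ iid tau ind]) auto
    note qs = q_sums[OF M intY(1) Y0 dm]
    note result = p_beta_asymp_equiv_heavy_X[OF decay qs c1p c2p b1p[unfolded b1] \<kappa>, where X = X and \<beta> = \<beta>,
        folded b1 a2]
    have "(\<lambda>r. q M Y d r / (c2 * real r powr (1 - \<kappa>))) \<longlonglongrightarrow> 1"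
    proof -
      have "(\<lambda>r. q M Y d r * real r powr (\<kappa> - 1) / c2) \<longlonglongrightarrow> c2 / c2"
        using decay(2) c2p unfolding power_decay_def by (intro tendsto_intros) auto
      moreover have "q M Y d r / (c2 * real r powr (1 - \<kappa>)) = q M Y d r * real r powr (\<kappa> - 1) / c2" for r
        using powr_minus_divide[of "real r" "\<kappa> - 1"] by simp
      ultimately show ?thesis using c2p by simp
    qed
    with result show "let c1 = c * (b1 * \<beta> powr (-1/2)) powr (\<kappa> - 1);
             c2 = c * b1 powr (\<kappa> - 2) * b2 * \<beta> powr ((3 - \<kappa>) / 2);
             c3 = (\<lambda>k. \<Sum>i. q M Y d i * q M Y d (k + i))
         in
           (\<lambda>(k1, k2). p_beta M X Y \<beta> \<Lambda>0 d k1 k2) \<sim>[far_apart]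
           (\<lambda>(k1, k2). \<beta> / (b1 ^ 4 * a2)
                         * (b1 * c1 * c2 * real k1 powr (2 - \<kappa>) * real (k2 - k1) powr (1 - \<kappa>)))
         \<and> (\<forall>k. (\<lambda>k1. p_beta M X Y \<beta> \<Lambda>0 d k1 (k1 + k)) \<sim>[at_top]
                 (\<lambda>k1. \<beta> / (b1 ^ 4 * a2) * (c1 * c3 k * real k1 powr (2 - \<kappa>))))
         \<and> (\<lambda>r. q M Y d r / (c2 * real r powr (1 - \<kappa>))) \<longlonglongrightarrow> 1"
      unfolding Let_def c1_def[symmetric] c2_def[symmetric] by blast
  }
qed

end
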